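(* Let $f\colon[0,1]\times\mathbb{R}\to\mathbb{R}$ be continuous with $f(t,\mathbb{R}_+)\subset\mathbb{R}_+$ for all $t\in[0,1]$. Let $c_\infty>0$ be a constant such that $\|v\|_\infty\le c_\infty|v|$ for all $v\in K$. Assume: (1) there exist $R_0,R_1$ with $0<R_0<\|\phi\|R_1$ such that $$R_0\le\|J\underline g\|\qquad\text{and}\qquad R_1\ge c_\infty\|\overline g\|_{L^1(0,1)},$$ where $$\underline g(t)=\min\{f(t,u): M(t)R_0\le u\le c_\infty R_1\},\qquad \overline g(t)=\max\{f(t,u): M(t)R_0\le u\le c_\infty R_1\};$$ (2) $E$ has the mountain pass geometry in $K_{R_0R_1}$, i.e. there exist $u_0,u_1$ in the same connected component of $K_{R_0R_1}$ and $r>0$ such that $|u_0|<r<|u_1|$ and $$\max\{E(u_0),E(u_1)\}<\inf\{E(u):u\in K_{R_0R_1},\ |u|=r\};$$ and, with $$c=\inf_{\gamma\in\Gamma}\max_{t\in[0,1]}E(\gamma(t)),\qquad \Gamma=\{\gamma\in C([0,1];K_{R_0R_1}):\gamma(0)=u_0,\ \gamma(1)=u_1\},$$ there exists $\rho>0$ such that $E(u)\ge c+\rho$ for all $u\in K_{R_0R_1}$ which simultaneously satisfy $\|u\|=R_0$ and $|u|=R_1$. Let $m=\inf_{u\in K_{R_0R_1}}E(u)$. Then the boundary value problem $$u^{(4)}(t)-f(t,u(t))=0\ \ (0<t<1),\qquad u(0)=u'(0)=u''(1)=u'''(1)=0$$ has at least two positive solutions $u_m,u_c\in K_{R_0R_1}$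 with $E(u_m)=m$ and $E(u_c)=c$.
   Context: $\mathbb{R}_+=[0,\infty)$. $X=\{u\in H^2(0,1): u(0)=u'(0)=0\}$ is the Hilbert space with inner product $(u,v)=\int_0^1u''v''\,dt$ and norm $|u|=\bigl(\int_0^1 u''(t)^2dt\bigr)^{1/2}$. $\|\cdot\|$ denotes the norm of $L^2(0,1)$ and $\|\cdot\|_\infty$ the max norm on $[0,1]$. The energy functional $E\colon X\to\mathbb{R}$ is $E(u)=\frac12|u|^2-\int_0^1F(t,u(t))\,dt$, where $F(t,u)=\int_0^uf(t,s)\,ds$. For $t\in[0,1]$, $M(t)=\frac{(3-t)t^2}{3}$. The cone is $K=\{u\in X:u\text{ is convex and }u(t)\ge M(t)\|u\|\text{ for all }t\in[0,1]\}$, and the conical shell (defined by two norms) is $K_{R_0R_1}=\{u\in K:\|u\|\ge R_0,\ |u|\le R_1\}$. Continuity of paths and connected components are with respect to the norm $|\cdot|$ of $X$. (A constant $c_\infty$ as required exists; for example $c_\infty=2/3$.) For $v\in L^2(0,1)$, $(Jv)(t)=\int_0^1G(t,s)v(s)\,ds$, where $G(t,s)=\frac{s^2}{6}(3t-s)$ for $0\le s\le t\le1$ and $G(t,s)=\frac{t^2}{6}(3s-t)$ for $0\le t<s\le1$ (the Green's function of $u^{(4)}=v$, $u(0)=u'(0)=u''(1)=u'''(1)=0$). $\phi=\phi_1/|\phi_1|$, where $$\phi_1(t)=\sin\beta t-\sinh\beta t+\frac{\sinh\beta+\sin\beta}{\cosh\beta+\cos\beta}\,(\cosh\beta t-\cos\beta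 t)$$ and $\beta$ is the smallest positive solution of $\cos\lambda\cosh\lambda+1=0$ ($\phi_1$ is a positive eigenfunction for the first eigenvalue $\beta^4$ of $\phi^{(4)}=\lambda\phi$, $\phi(0)=\phi'(0)=\phi''(1)=\phi'''(1)=0$). A solution of the problem is a classical one ($u\in C^4[0,1]$); it is positive if it is nonnegative on $[0,1]$ and not identically zero. *)

theory Defs
  imports "HOL-Analysis.Analysis"
begin

definition L2 :: "(real \<Rightarrow> real) set" where
  "L2 = {v \<in> borel_measurable (lebesgue_on {0..1}). integrable (lebesgue_on {0..1}) (\<lambda>t. (v t)\<^sup>2)}"

definition L2_norm :: "(real \<Rightarrow> real) \<Rightarrow> real" where
  "L2_norm v = sqrt (LINT t|lebesgue_on {0..1}. (v t)\<^sup>2)"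

definition L1_norm :: "(real \<Rightarrow> real) \<Rightarrow> real" where
  "L1_norm v = (LINT t|lebesgue_on {0..1}. \<bar>v t\<bar>)"

definition max_norm :: "(real \<Rightarrow> real) \<Rightarrow> real" where
  "max_norm v = (SUP t\<in>{0..1}. \<bar>v t\<bar>)"

text \<open>Weak derivatives on the open interval (0,1) are tested against C^1 functions with compact
  support in (0,1), extended by zero to the real line.\<close>

definition test_functions :: "(real \<Rightarrow> real) set" where
  "test_functions = {\<psi>. \<psi> C1_differentiable_on UNIV \<and>
     (\<exists>a b. 0 < a \<and> b < 1 \<and> (\<forall>t. t \<notin> {a..b} \<longrightarrow> \<psi> t = 0))}"

definition has_weak_deriv :: "(real \<Rightarrow> real) \<Rightarrow> (real \<Rightarrow> real) \<Rightarrow> bool" where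
  "has_weak_deriv u g \<longleftrightarrow> (\<forall>\<psi>\<in>test_functions.
     (LINT t|lebesgue_on {0..1}. u t * deriv \<psi> t) = - (LINT t|lebesgue_on {0..1}. g t * \<psi> t))"

definition H1 :: "(real \<Rightarrow> real) set" where
  "H1 = {u \<in> L2. \<exists>g\<in>L2. has_weak_deriv u g}"

definition H2 :: "(real \<Rightarrow> real) set" where
  "H2 = {u \<in> L2. \<exists>g\<in>H1. has_weak_deriv u g}"

text \<open>A weak derivative in \<^const>\<open>L2\<close> is unique up to a null set of (0,1), so that integrals over
  the unit interval do not depend on the representative chosen here.\<close>

definition weak_deriv :: "(real \<Rightarrow> real) \<Rightarrow> real \<Rightarrow> real" where
  "weak_deriv u = (SOME g. g \<in> L2 \<and> has_weak_deriv u g)"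

text \<open>Each class in \<^const>\<open>H2\<close> contains exactly one function that is continuously differentiable on
  the closed unit interval and vanishes outside it.  The elements of \<open>X\<close> are these
  representatives; the boundary values at 0 refer to them.\<close>

definition X :: "(real \<Rightarrow> real) set" where
  "X = {u \<in> H2. (\<forall>t. t \<notin> {0..1} \<longrightarrow> u t = 0) \<and>
     (\<exists>u'. continuous_on {0..1} u' \<and>
        (\<forall>t\<in>{0..1}. (u has_real_derivative u' t) (at t within {0..1})) \<and>
        u 0 = 0 \<and> u' 0 = 0)}"

text \<open>The metric below comes from the inner product, the integral of the product of the weak second
  derivatives; elements of \<open>X\<close> that agree on the unit interval are equal.\<close>

definition X_norm :: "(real \<Rightarrow> real) \<Rightarrow> real" where
  "X_norm u = sqrt (LINT t|lebesgue_on {0..1}. (weak_deriv (weak_deriv u) t)\<^sup>2)"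

definition X_topology :: "(real \<Rightarrow> real) topology" where
  "X_topology = Metric_space.mtopology X (\<lambda>u v. X_norm (\<lambda>t. u t - v t))"

definition M :: "real \<Rightarrow> real" where
  "M t = (3 - t) * t\<^sup>2 / 3"

definition K :: "(real \<Rightarrow> real) set" where
  "K = {u \<in> X. convex_on {0..1} u \<and> (\<forall>t\<in>{0..1}. u t \<ge> M t * L2_norm u)}"

definition shell :: "real \<Rightarrow> real \<Rightarrow> (real \<Rightarrow> real) set" where
  "shell R0 R1 = {u \<in> K. L2_norm u \<ge> R0 \<and> X_norm u \<le> R1}"

text \<open>Green's function of the operator u'''' with u(0) = u'(0) = u''(1) = u'''(1) = 0.\<close>

definition G :: "real \<Rightarrow> real \<Rightarrow> real" where
  "G t s = (if s \<le> t then s\<^sup>2 / 6 * (3 * t - s) else t\<^sup>2 / 6 * (3 * s - t))"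

definition J :: "(real \<Rightarrow> real) \<Rightarrow> real \<Rightarrow> real" where
  "J v t = (LINT s|lebesgue_on {0..1}. G t s * v s)"

text \<open>The first eigenvalue of u'''' = l u under the same boundary conditions is beta^4, with positive
  eigenfunction phi1.\<close>

definition beta :: real where
  "beta = (LEAST l. 0 < l \<and> cos l * cosh l + 1 = 0)"

definition phi1 :: "real \<Rightarrow> real" where
  "phi1 t = sin (beta * t) - sinh (beta * t)
     + (sinh beta + sin beta) / (cosh beta + cos beta) * (cosh (beta * t) - cos (beta * t))"

definition phi :: "real \<Rightarrow> real" where
  "phi t = phi1 t / X_norm phi1"

text \<open>The interval integral is oriented, as needed for \<open>x < 0\<close>.\<close>

definition F :: "(real \<Rightarrow> real \<Rightarrow> real) \<Rightarrow> real \<Rightarrow> real \<Rightarrow> real" where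
  "F f t x = (LBINT s=0..x. f t s)"

definition E :: "(real \<Rightarrow> real \<Rightarrow> real) \<Rightarrow> (real \<Rightarrow> real) \<Rightarrow> real" where
  "E f u = (X_norm u)\<^sup>2 / 2 - (LINT t|lebesgue_on {0..1}. F f t (u t))"

definition paths :: "real \<Rightarrow> real \<Rightarrow> (real \<Rightarrow> real) \<Rightarrow> (real \<Rightarrow> real) \<Rightarrow> (real \<Rightarrow> real \<Rightarrow> real) set" where
  "paths R0 R1 u0 u1 =
     {\<gamma>. pathin (subtopology X_topology (shell R0 R1)) \<gamma> \<and> \<gamma> 0 = u0 \<and> \<gamma> 1 = u1}"

text \<open>The supremum is attained because E is continuous.  Path components and connected components of
  the shell coincide (for \<open>0 < R0 < L2_norm phi * R1\<close>), so the infimum is over a nonempty set whenever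
  \<open>u0\<close> and \<open>u1\<close> lie in the same connected component.\<close>

definition mp_level ::
  "(real \<Rightarrow> real \<Rightarrow> real) \<Rightarrow> real \<Rightarrow> real \<Rightarrow> (real \<Rightarrow> real) \<Rightarrow> (real \<Rightarrow> real) \<Rightarrow> real" where
  "mp_level f R0 R1 u0 u1 = (INF \<gamma>\<in>paths R0 R1 u0 u1. SUP t\<in>{0..1}. E f (\<gamma> t))"

text \<open>For continuous \<open>f\<close> these extrema over a compact (nonempty) interval are attained, so they are
  the minimum and the maximum.\<close>

definition f_lower :: "(real \<Rightarrow> real \<Rightarrow> real) \<Rightarrow> real \<Rightarrow> real \<Rightarrow> real \<Rightarrow> real \<Rightarrow> real" where
  "f_lower f c_inf R0 R1 t = (INF x\<in>{M t * R0..c_inf * R1}. f t x)"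

definition f_upper :: "(real \<Rightarrow> real \<Rightarrow> real) \<Rightarrow> real \<Rightarrow> real \<Rightarrow> real \<Rightarrow> real \<Rightarrow> real" where
  "f_upper f c_inf R0 R1 t = (SUP x\<in>{M t * R0..c_inf * R1}. f t x)"

definition bvp_solution :: "(real \<Rightarrow> real \<Rightarrow> real) \<Rightarrow> (real \<Rightarrow> real) \<Rightarrow> bool" where
  "bvp_solution f u \<longleftrightarrow> (\<exists>D :: nat \<Rightarrow> real \<Rightarrow> real.
     D 0 = u \<and>
     (\<forall>k<4. \<forall>t\<in>{0..1}. (D k has_real_derivative D (Suc k) t) (at t within {0..1})) \<and>
     continuous_on {0..1} (D 4) \<and>
     (\<forall>t. 0 < t \<and> t < 1 \<longrightarrow> D 4 t - f t (u t) = 0) \<and>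
     D 0 0 = 0 \<and> D 1 0 = 0 \<and> D 2 1 = 0 \<and> D 3 1 = 0)"

definition positive_solution :: "(real \<Rightarrow> real \<Rightarrow> real) \<Rightarrow> (real \<Rightarrow> real) \<Rightarrow> bool" where
  "positive_solution f u \<longleftrightarrow>
     bvp_solution f u \<and> (\<forall>t\<in>{0..1}. 0 \<le> u t) \<and> (\<exists>t\<in>{0..1}. u t \<noteq> 0)"

end

(* The energy E has the gradient u - N u with N u = J f(., u), and the hypotheses on the lower and upper
   envelopes of f make N map the conical shell into itself. Suppose that there is no fixed point of N
   at a level l <= c. Put w = N u - u and move u to u + h (w + k J u), where the multiplier k >= 0 is
   just large enough to preserve ||u|| >= R0; J u is the gradient of ||u||^2 / 2 in X. Since N and J are
   compact, the energy drops by a fixed amount near the level l for one small step h: the only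
   obstruction would be a solution of u = N u + k J u with ||u|| = R0, and k > 0 is impossible there
   because ||N u|| >= R0 and N u, J u >= 0. The step preserves |u| <= R1 by convexity when k = 0, and when k > 0
   because points near the corner ||u|| = R0, |u| = R1 have energy above c. So one discrete step,
   instead of a flow, contradicts the definition of c (applied to paths) or of m (applied to points).

   A path from u0 to u1 exists because each point w of the shell can be joined to a point with
   ||.|| > R0 by moving towards J w and normalizing: this increases ||w|| / |w| unless w is a positive
   eigenfunction of J. Such an eigenfunction maximizes the quotient on X, so that ||w|| / |w| is at least
   ||phi||, which exceeds R0 / R1; no information on beta is needed. *)
theory Submission
  imports Defs "HOL-Complex_Analysis.Great_Picard"
begin

text \<open>Both norms are treated inside one Hilbert space: ||x||^2 = (J x, x), so along a straight
  step it is a quadratic polynomial with nonnegative leading coefficient. The constraint ||u|| >= R0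
  is not convex, but thanks to this sign a first-order condition on the step preserves it without
  any error term; this makes a finite step possible. Compactness enters only through the max norm:
  bounded sets of X are precompact in C[0,1], and N and J turn uniform convergence into convergence
  in X.

  The corner is the delicate place. The hypothesis bounds the energy at points exactly on the
  corner, while a step needs a neighbourhood, and the shell is not compact. The integral of F sees
  only the max norm, whereas |.| can be raised by uniformly small functions; so a point near the
  corner can be moved onto it with little change of energy.

  Since the definitions choose weak derivatives arbitrarily, the groundwork identifies elements of X
  with double primitives of L2 functions.\<close>

abbreviation leb01 :: "real measure" where "leb01 \<equiv> lebesgue_on {0..1}"

lemma finite_measure_leb01: "finite_measure leb01"
  by (rule finite_measure_lebesgue_on) (metis cbox_interval lmeasurable_cbox)

lemma measure_leb01 [simp]: "measure leb01 {0..1} = 1"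
  by (simp add: measure_restrict_space)

lemma integral_const_leb01 [simp]: "(LINT t|leb01. c) = (c::real)"
  by (simp add: measure_restrict_space)

lemma continuous_imp_integrable_leb01 [intro]:
  "continuous_on {0..1} f \<Longrightarrow> integrable leb01 (f :: real \<Rightarrow> real)"
  by (rule continuous_imp_integrable_real)

lemma integral_leb01_eq: "integrable leb01 f \<Longrightarrow> (LINT t|leb01. f t) = integral {0..1} (f :: real \<Rightarrow> real)"
  by (rule lebesgue_integral_eq_integral) auto

lemma integral_leb01_cong: "(\<And>t. t \<in> {0..1} \<Longrightarrow> f t = g t) \<Longrightarrow> (LINT t|leb01. f t) = (LINT t|leb01. g t :: real)"
  by (rule Bochner_Integration.integral_cong) auto

lemma integral_leb01_mono:
  fixes f g :: "real \<Rightarrow> real"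
  assumes "integrable leb01 f" "integrable leb01 g" "\<And>t. t \<in> {0..1} \<Longrightarrow> f t \<le> g t"
  shows "(LINT t|leb01. f t) \<le> (LINT t|leb01. g t)"
  using assms by (intro integral_mono) auto

section \<open>Square-integrable functions on the unit interval\<close>

lemma L2_measurable: "v \<in> L2 \<Longrightarrow> v \<in> borel_measurable leb01"
  and L2_sq_integrable: "v \<in> L2 \<Longrightarrow> integrable leb01 (\<lambda>t. (v t)\<^sup>2)"
  by (auto simp: L2_def)

lemma L2_mult_integrable:
  assumes "u \<in> L2" "v \<in> L2" shows "integrable leb01 (\<lambda>t. u t * v t)"
proof (rule Bochner_Integration.integrable_bound)
  show "integrable leb01 (\<lambda>t. (u t)\<^sup>2 + (v t)\<^sup>2)"
    using assms by (intro Bochner_Integration.integrable_add L2_sq_integrable)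
  show "(\<lambda>t. u t * v t) \<in> borel_measurable leb01"
    using assms L2_measurable by (intro borel_measurable_times) auto
  have "norm (u t * v t) \<le> norm ((u t)\<^sup>2 + (v t)\<^sup>2)" for t
    using sum_squares_bound[of "\<bar>u t\<bar>" "\<bar>v t\<bar>"] mult_nonneg_nonneg[of "\<bar>u t\<bar>" "\<bar>v t\<bar>"]
    by (simp only: abs_mult real_norm_def power2_abs)
  then show "AE t in leb01. norm (u t * v t) \<le> norm ((u t)\<^sup>2 + (v t)\<^sup>2)" by simp
qed

lemma continuous_imp_L2: "continuous_on {0..1} f \<Longrightarrow> f \<in> L2"
  unfolding L2_def by (auto intro!: continuous_imp_integrable_leb01 continuous_intros borel_measurable_integrable)

lemma L2_integrable: "v \<in> L2 \<Longrightarrow> integrable leb01 v"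
  using L2_mult_integrable[of v "\<lambda>t. 1"] continuous_imp_L2[of "\<lambda>t. 1"] by simp

lemma L2_lin:
  assumes "u \<in> L2" "v \<in> L2" shows "(\<lambda>t. a * u t + b * v t) \<in> L2"
proof -
  have "(\<lambda>t. (a * u t + b * v t)\<^sup>2) = (\<lambda>t. a\<^sup>2 * (u t * u t) + (2 * a * b) * (u t * v t) + b\<^sup>2 * (v t * v t))"
    by (auto simp: power2_eq_square algebra_simps)
  moreover have "integrable leb01 (\<lambda>t. a\<^sup>2 * (u t * u t) + (2 * a * b) * (u t * v t) + b\<^sup>2 * (v t * v t))"
    by (intro Bochner_Integration.integrable_add Bochner_Integration.integrable_mult_right L2_mult_integrable assms)
  ultimately have "integrable leb01 (\<lambda>t. (a * u t + b * v t)\<^sup>2)" by (simp only:)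
  moreover have "(\<lambda>t. a * u t + b * v t) \<in> borel_measurable leb01"
    by (intro borel_measurable_add borel_measurable_times borel_measurable_const L2_measurable assms)
  ultimately show ?thesis unfolding L2_def by blast
qed

text \<open>The measure has total mass 1, so this is nonnegativity of the variance of
  \<open>\<bar>g\<bar>\<close>.\<close>

lemma L1_le_L2:
  assumes "g \<in> L2" shows "(LINT t|leb01. \<bar>g t\<bar>) \<le> L2_norm g"
proof -
  define m where "m = (LINT t|leb01. \<bar>g t\<bar>)"
  have i: "integrable leb01 (\<lambda>t. \<bar>g t\<bar>)" "integrable leb01 (\<lambda>t. (g t)\<^sup>2)"
    using L2_integrable[OF assms] L2_sq_integrable[OF assms] by auto
  have "0 \<le> (LINT t|leb01. (\<bar>g t\<bar> - m)\<^sup>2)" by simp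
  also have "\<dots> = (LINT t|leb01. (g t)\<^sup>2 - (2 * m) * \<bar>g t\<bar> + m\<^sup>2)"
    by (rule Bochner_Integration.integral_cong) (auto simp: power2_eq_square algebra_simps)
  also have "\<dots> = (LINT t|leb01. (g t)\<^sup>2) - 2 * m * m + m\<^sup>2"
    using i by (simp add: m_def measure_restrict_space)
  finally have "m\<^sup>2 \<le> (LINT t|leb01. (g t)\<^sup>2)"
    unfolding power2_eq_square[of m] by linarith
  then show ?thesis unfolding m_def[symmetric] L2_norm_def by (rule real_le_rsqrt)
qed

text \<open>Squaring removes the kink of the positive part, so products of such terms are C^1
  building blocks for test functions.\<close>

lemma DERIV_max0_sq: "((\<lambda>x::real. (max 0 x)\<^sup>2) has_real_derivative 2 * max 0 x) (at x)"
proof -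
  consider "x > 0" | "x < 0" | "x = 0" by linarith
  then show ?thesis
  proof cases
    case 1
    have "((\<lambda>x::real. x\<^sup>2) has_real_derivative 2 * x) (at x)" by (auto intro!: derivative_eq_intros)
    then have "((\<lambda>x::real. (max 0 x)\<^sup>2) has_real_derivative 2 * x) (at x)"
      by (rule has_field_derivative_transform_within_open[of _ _ _ "{0<..}"]) (use 1 in auto)
    then show ?thesis using 1 by simp
  next
    case 2
    have "((\<lambda>x::real. 0) has_real_derivative 0) (at x)" by simp
    then have "((\<lambda>x::real. (max 0 x)\<^sup>2) has_real_derivative 0) (at x)"
      by (rule has_field_derivative_transform_within_open[of _ _ _ "{..<0}"]) (use 2 in auto)
    then show ?thesis using 2 by simp
  next
    case 3
    have "((\<lambda>h::real. (max 0 h)\<^sup>2 / h) \<longlongrightarrow> 0) (at 0)"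
    proof (rule Lim_null_comparison)
      show "\<forall>\<^sub>F h in at (0::real). norm ((max 0 h)\<^sup>2 / h) \<le> \<bar>h\<bar>"
        by (auto simp: max_def power2_eq_square)
      show "((\<lambda>h::real. \<bar>h\<bar>) \<longlongrightarrow> 0) (at 0)" by (intro tendsto_rabs_zero) simp
    qed
    then show ?thesis using 3 by (simp add: DERIV_def)
  qed
qed

section \<open>Weak derivatives\<close>

text \<open>The form \<open>p / (1 + p)\<close> keeps the values in the unit interval for every
  \<open>n\<close> and tends to 1 wherever the factor of \<open>n\<close> is positive: a C^1
  approximation of the indicator of an open interval.\<close>

definition bump :: "real \<Rightarrow> real \<Rightarrow> nat \<Rightarrow> real \<Rightarrow> real" where
  "bump a b n t = (let p = n * ((max 0 (t - a))\<^sup>2 * (max 0 (b - t))\<^sup>2) in p / (1 + p))"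

lemma bump_outside: "t \<notin> {a..b} \<Longrightarrow> bump a b n t = 0"
  by (auto simp: bump_def)

lemma bump_nonneg: "0 \<le> bump a b n t" and bump_le_1: "bump a b n t \<le> 1"
proof -
  have *: "0 \<le> real n * ((max 0 (t - a))\<^sup>2 * (max 0 (b - t))\<^sup>2)" by simp
  then show "0 \<le> bump a b n t" unfolding bump_def Let_def by simp
  show "bump a b n t \<le> 1" unfolding bump_def Let_def using * by (subst divide_le_eq_1) linarith
qed

lemma bump_C1: "bump a b n C1_differentiable_on UNIV"
proof -
  let ?p = "\<lambda>t. real n * ((max 0 (t - a))\<^sup>2 * (max 0 (b - t))\<^sup>2)"
  let ?p' = "\<lambda>t. real n * ((2 * max 0 (t - a)) * (max 0 (b - t))\<^sup>2 + (max 0 (t - a))\<^sup>2 * (- (2 * max 0 (b - t))))"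
  have pos: "0 < 1 + ?p t" for t by (smt (verit) mult_nonneg_nonneg of_nat_0_le_iff zero_le_power2)
  have d1: "((\<lambda>t. (max 0 (t - a))\<^sup>2) has_real_derivative 2 * max 0 (t - a)) (at t)" for t
  proof -
    have "((\<lambda>t. t - a) has_real_derivative 1) (at t)" by (auto intro!: derivative_eq_intros)
    from DERIV_chain2[OF DERIV_max0_sq this] show ?thesis by simp
  qed
  have d2: "((\<lambda>t. (max 0 (b - t))\<^sup>2) has_real_derivative - (2 * max 0 (b - t))) (at t)" for t
  proof -
    have "((\<lambda>t. b - t) has_real_derivative - 1) (at t)" by (auto intro!: derivative_eq_intros)
    from DERIV_chain2[OF DERIV_max0_sq this] show ?thesis by simp
  qed
  have dp: "(?p has_real_derivative ?p' t) (at t)" for t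
    by (rule derivative_eq_intros d1 d2 refl | simp)+
  have d: "(bump a b n has_real_derivative ?p' t / (1 + ?p t)\<^sup>2) (at t)" for t
  proof -
    have "((\<lambda>t. ?p t / (1 + ?p t)) has_real_derivative (?p' t * (1 + ?p t) - ?p t * (0 + ?p' t)) / ((1 + ?p t) * (1 + ?p t))) (at t)"
      using pos[of t] by (intro DERIV_divide dp DERIV_add DERIV_const) linarith
    moreover have "bump a b n = (\<lambda>t. ?p t / (1 + ?p t))" by (auto simp: bump_def Let_def)
    ultimately show ?thesis by (simp add: power2_eq_square algebra_simps)
  qed
  have c: "continuous_on UNIV (\<lambda>t. ?p' t / (1 + ?p t)\<^sup>2)"
  proof (intro continuous_intros ballI)
    fix t show "(1 + ?p t)\<^sup>2 \<noteq> 0" using pos[of t] by simp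
  qed
  show ?thesis unfolding C1_differentiable_on_def
    by (intro exI[of _ "\<lambda>t. ?p' t / (1 + ?p t)\<^sup>2"] conjI ballI c
        d[unfolded has_real_derivative_iff_has_vector_derivative])
qed

lemma bump_test_function: "0 < a \<Longrightarrow> b < 1 \<Longrightarrow> bump a b n \<in> test_functions"
  unfolding test_functions_def using bump_C1 bump_outside by blast

lemma bump_tendsto: "(\<lambda>n. bump a b n t) \<longlonglongrightarrow> indicator {a<..<b} t"
proof (cases "t \<in> {a<..<b}")
  case True
  define c where "c = (max 0 (t - a))\<^sup>2 * (max 0 (b - t))\<^sup>2"
  have "c > 0" using True by (auto simp: c_def)
  have "(\<lambda>n. 1 - 1 / (1 + real n * c)) \<longlonglongrightarrow> 1 - 0"
  proof (intro tendsto_diff tendsto_const)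
    have "filterlim (\<lambda>n. 1 + real n * c) at_top sequentially"
      using \<open>c > 0\<close>
      by (intro filterlim_tendsto_add_at_top[OF tendsto_const] filterlim_at_top_mult_tendsto_pos[OF tendsto_const]
          filterlim_real_sequentially)
    then show "(\<lambda>n. 1 / (1 + real n * c)) \<longlonglongrightarrow> 0"
      by (intro real_tendsto_divide_at_top[OF tendsto_const])
  qed
  moreover have "1 - 1 / (1 + real n * c) = bump a b n t" for n
  proof -
    have "0 < 1 + real n * c" using \<open>c > 0\<close> by (simp add: add_pos_nonneg)
    then show ?thesis unfolding bump_def Let_def c_def[symmetric] by (simp add: field_simps)
  qed
  ultimately show ?thesis using True by simp
next
  case False
  then have "bump a b n t = 0" for n by (auto simp: bump_def)
  then show ?thesis using False by simp
qed

lemma borel_measurable_bump [measurable]: "bump a b n \<in> borel_measurable leb01"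
  unfolding bump_def Let_def by (intro borel_measurable_integrable continuous_imp_integrable_leb01 continuous_intros)
     (smt (verit) mult_nonneg_nonneg of_nat_0_le_iff zero_le_power2)

text \<open>The indefinite integral is differentiable with derivative \<open>w\<close> at almost every point.\<close>

lemma AE_zero_if_interval_integrals_zero:
  assumes w: "integrable leb01 w"
    and zero: "\<And>a b. 0 < a \<Longrightarrow> a < b \<Longrightarrow> b < 1 \<Longrightarrow> integral {a..b} w = (0::real)"
  shows "AE t in leb01. w t = 0"
proof -
  define v where "v t = (if t \<in> {0..1} then w t else 0)" for t
  have "w integrable_on {0..1}" by (rule integrable_on_lebesgue_on[OF w]) simp
  then have "v integrable_on UNIV" unfolding v_def by (subst integrable_restrict_UNIV)
  then have "v integrable_on cbox a b" for a b by (rule integrable_on_subcbox) auto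
  then obtain N where N: "negligible N"
    "\<And>x e. \<lbrakk>x \<notin> N; 0 < e\<rbrakk> \<Longrightarrow> \<exists>d>0. \<forall>h. 0 < h \<and> h < d \<longrightarrow>
                         norm (integral (cbox x (x + h *\<^sub>R One)) v /\<^sub>R h ^ DIM(real) - v x) < e"
    using integrable_ccontinuous_explicit[of v] by blast
  have z: "w x = 0" if "x \<notin> N" "0 < x" "x < 1" for x
  proof (rule ccontr)
    assume "w x \<noteq> 0"
    then have "0 < \<bar>w x\<bar>" by simp
    from N(2)[OF that(1) this] obtain d where "d > 0" and
      d: "\<And>h. 0 < h \<Longrightarrow> h < d \<Longrightarrow> \<bar>integral {x..x+h} v / h - v x\<bar> < \<bar>w x\<bar>"
      by (auto simp: divide_inverse mult.commute)
    \<comment> \<open>The step stays below \<open>d\<close>, where the difference quotient is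
      controlled, and keeps \<open>x + h\<close> inside the open interval, where the integral is
      zero by hypothesis.\<close>
    define h where "h = min (d/2) ((1-x)/2)"
    have h: "0 < h" "h < d" using \<open>d>0\<close> that by (auto simp: h_def)
    have "h \<le> (1-x)/2" unfolding h_def by (rule min.cobounded2)
    then have "x + h < 1" using that by (simp add: field_simps)
    note h = h this
    have "integral {x..x+h} v = integral {x..x+h} w"
      using h that by (intro Henstock_Kurzweil_Integration.integral_cong) (auto simp: v_def)
    also have "\<dots> = 0" using h that by (intro zero) auto
    finally show False using d[OF h(1,2)] that by (simp add: v_def)
  qed
  have "negligible (N \<union> {0,1})" using N(1) by simp
  then have "N \<union> {0,1} \<in> null_sets lebesgue" by (simp add: negligible_iff_null_sets)
  then have "AE t in lebesgue. t \<notin> N \<union> {0,1}" by (rule AE_not_in)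
  then have "AE t in lebesgue. t \<in> {0..1} \<longrightarrow> w t = 0"
    by (rule AE_mp) (intro AE_I2, use z in force)
  then show ?thesis by (subst AE_restrict_space_iff) auto
qed

text \<open>Dominated convergence with majorant \<open>\<bar>w t\<bar>\<close> replaces the bumps by
  the interval indicators which they approximate.\<close>

lemma AE_zero_if_bump_integrals_zero:
  assumes w: "integrable leb01 w"
    and zero: "\<And>a b n. 0 < a \<Longrightarrow> a < b \<Longrightarrow> b < 1 \<Longrightarrow> (LINT t|leb01. w t * bump a b n t) = (0::real)"
  shows "AE t in leb01. w t = 0"
proof (rule AE_zero_if_interval_integrals_zero[OF w])
  fix a b :: real assume ab: "0 < a" "a < b" "b < 1"
  have meas: "{a<..<b} \<in> sets leb01" by (subst sets_restrict_space_iff) (use ab in auto)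
  have "(\<lambda>n. LINT t|leb01. w t * bump a b n t) \<longlonglongrightarrow> (LINT t|leb01. w t * indicator {a<..<b} t)"
  proof (rule integral_dominated_convergence[where w = "\<lambda>t. \<bar>w t\<bar>"])
    show "AE t in leb01. (\<lambda>n. w t * bump a b n t) \<longlonglongrightarrow> w t * indicator {a<..<b} t"
      by (intro AE_I2 tendsto_mult tendsto_const bump_tendsto)
    fix n
    have "\<bar>w t * bump a b n t\<bar> \<le> \<bar>w t\<bar>" for t
      using mult_left_mono[OF bump_le_1, of "\<bar>w t\<bar>" a b n t] bump_nonneg[of a b n t] by (simp add: abs_mult)
    then show "AE t in leb01. norm (w t * bump a b n t) \<le> \<bar>w t\<bar>" by simp
    show "(\<lambda>t. w t * bump a b n t) \<in> borel_measurable leb01" using w by measurable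
    show "(\<lambda>t. w t * indicator {a<..<b} t) \<in> borel_measurable leb01"
      by (intro borel_measurable_times borel_measurable_indicator borel_measurable_integrable[OF w] meas)
  qed (use w in auto)
  then have *: "(LINT t|leb01. w t * indicator {a<..<b} t) = 0"
    unfolding zero[OF ab] using LIMSEQ_unique[OF _ tendsto_const] by blast
  have i: "integrable leb01 (\<lambda>t. w t * indicator {a<..<b} t)"
    using w integrable_mult_indicator[of "{a<..<b}" leb01 w] meas by (simp add: mult.commute)
  have "integral {a..b} w = integral {a<..<b} w"
    using integral_open_interval[of a b w] by simp
  also have "\<dots> = integral {0..1} (\<lambda>t. w t * indicator {a<..<b} t)"
  proof -
    have "integral {0..1} (\<lambda>t. if t \<in> {a<..<b} then w t else 0) = integral ({0..1} \<inter> {a<..<b}) w"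
      by (simp only: integral_restrict_Int Int_commute)
    moreover have "{0..1} \<inter> {a<..<b} = {a<..<b}" using ab by auto
    moreover have "(\<lambda>t. if t \<in> {a<..<b} then w t else 0) = (\<lambda>t. w t * indicator {a<..<b} t)" by (auto simp: indicator_def)
    ultimately show ?thesis by simp
  qed
  also have "\<dots> = 0" using integral_leb01_eq[OF i] * by simp
  finally show "integral {a..b} w = 0" .
qed

section \<open>Primitives and integration by parts\<close>

definition prim :: "(real \<Rightarrow> real) \<Rightarrow> real \<Rightarrow> real" where
  "prim g t = integral {0..t} g"

lemma prim_0 [simp]: "prim g 0 = 0" by (simp add: prim_def)

lemma continuous_bounded_01:
  assumes "continuous_on {0..1::real} p"
  obtains B :: real where "\<And>t. t \<in> {0..1} \<Longrightarrow> \<bar>p t\<bar> \<le> B" "0 \<le> B"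
proof -
  obtain B where B: "\<forall>y\<in>p ` {0..1}. norm y \<le> B"
    using compact_imp_bounded[OF compact_continuous_image[OF assms compact_Icc]] unfolding bounded_iff by blast
  then have "\<bar>p t\<bar> \<le> B" if "t \<in> {0..1}" for t using that by auto
  moreover from this[of 0] have "0 \<le> B" by auto
  ultimately show ?thesis using that by blast
qed

lemma integrable_on_sub:
  fixes g :: "real \<Rightarrow> real"
  assumes "integrable leb01 g" "0 \<le> a" "b \<le> 1" shows "g integrable_on {a..b}"
proof -
  have "g integrable_on {0..1}" by (rule integrable_on_lebesgue_on[OF assms(1)]) simp
  then show ?thesis using assms by (rule_tac integrable_on_subinterval) auto
qed

lemma prim_continuous: "integrable leb01 g \<Longrightarrow> continuous_on {0..1} (prim g)"
  unfolding prim_def by (intro indefinite_integral_continuous_1 integrable_on_sub) auto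

text \<open>An indicator under the Lebesgue integral over the whole interval makes the primitive
  accessible to almost-everywhere arguments, absolute bounds and Fubini.\<close>

lemma prim_eq_LINT:
  assumes g: "integrable leb01 g" and t: "t \<in> {0..1}"
  shows "prim g t = (LINT s|leb01. indicator {..t} s * g s)"
proof -
  have m: "{0..1} \<inter> {..t} \<in> sets leb01" using t by (subst sets_restrict_space_iff) auto
  have i: "integrable leb01 (\<lambda>s. indicator ({0..1} \<inter> {..t}) s * g s)"
    using integrable_mult_indicator[OF m g] by simp
  have "(LINT s|leb01. indicator {..t} s * g s) = (LINT s|leb01. indicator ({0..1} \<inter> {..t}) s * g s)"
    by (rule integral_leb01_cong) (auto simp: indicator_def)
  also have "\<dots> = integral {0..1} (\<lambda>s. indicator ({0..1} \<inter> {..t}) s * g s)"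
    by (rule integral_leb01_eq[OF i])
  also have "(\<lambda>s. indicator ({0..1} \<inter> {..t}) s * g s) = (\<lambda>s. if s \<in> {0..1} \<inter> {..t} then g s else 0)"
    by (auto simp: indicator_def)
  also have "integral {0..1} \<dots> = integral ({0..1} \<inter> ({0..1} \<inter> {..t})) g" by (simp only: integral_restrict_Int Int_commute)
  also have "{0..1} \<inter> ({0..1} \<inter> {..t}) = {0..t}" using t by auto
  finally show ?thesis by (simp add: prim_def)
qed

lemma prim_cong_AE:
  assumes "integrable leb01 g" "integrable leb01 h" "AE t in leb01. g t = h t" "t \<in> {0..1}"
  shows "prim g t = prim h t"
proof -
  have meas: "{..t} \<inter> space leb01 \<in> sets leb01" by (subst sets_restrict_space_iff) auto
  have "(indicator {..t} :: real \<Rightarrow> real) \<in> borel_measurable leb01" using meas by (subst borel_measurable_indicator_iff)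
  then show ?thesis unfolding prim_eq_LINT[OF assms(1,4)] prim_eq_LINT[OF assms(2,4)]
    using borel_measurable_integrable[OF assms(1)] borel_measurable_integrable[OF assms(2)] assms(3)
    by (intro integral_cong_AE borel_measurable_times) (auto elim: eventually_mono)
qed

lemma prim_diff:
  assumes "integrable leb01 g" "s \<in> {0..1}" "t \<in> {0..1}" "s \<le> t"
  shows "prim g t - prim g s = integral {s..t} g"
  unfolding prim_def
  using Henstock_Kurzweil_Integration.integral_combine[of 0 s t g] integrable_on_sub[OF assms(1)] assms by auto

lemma prim_deriv:
  assumes "continuous_on {0..1} p'" "\<And>t. t \<in> {0..1} \<Longrightarrow> (p has_real_derivative p' t) (at t within {0..1})"
    "t \<in> {0..1}"
  shows "p t = p 0 + prim p' t"
proof -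
  have "(p' has_integral p t - p 0) {0..t}"
  proof (rule fundamental_theorem_of_calculus)
    fix x assume "x \<in> {0..t}"
    then have "(p has_real_derivative p' x) (at x within {0..t})"
      using assms(2)[of x] assms(3) by (auto intro: has_field_derivative_subset)
    then show "(p has_vector_derivative p' x) (at x within {0..t})"
      by (simp add: has_real_derivative_iff_has_vector_derivative)
  qed (use assms(3) in auto)
  then show ?thesis by (simp add: prim_def integral_unique)
qed

lemma deriv_prim:
  "continuous_on {0..1} g \<Longrightarrow> t \<in> {0..1} \<Longrightarrow> (prim g has_real_derivative g t) (at t within {0..1})"
  unfolding prim_def by (rule integral_has_real_derivative)

lemma abs_prim_le:
  assumes g: "integrable leb01 g" and t: "t \<in> {0..1}"
  shows "\<bar>prim g t\<bar> \<le> (LINT s|leb01. \<bar>g s\<bar>)"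
proof -
  have "\<bar>prim g t\<bar> \<le> (LINT s|leb01. \<bar>indicator {..t} s * g s\<bar>)"
    unfolding prim_eq_LINT[OF assms] by (rule integral_abs_bound)
  also have "\<dots> \<le> (LINT s|leb01. \<bar>g s\<bar>)"
    by (rule integral_mono') (use g in \<open>auto simp: indicator_def\<close>)
  finally show ?thesis .
qed

text \<open>Fubini on the triangle \<open>s \<le> t\<close>.\<close>

lemma integral_by_parts:
  assumes g: "integrable leb01 g" and p'c: "continuous_on {0..1} p'"
    and p': "\<And>t. t \<in> {0..1} \<Longrightarrow> (p has_real_derivative p' t) (at t within {0..1})"
  shows "(LINT t|leb01. p t * g t) = p 1 * prim g 1 - (LINT t|leb01. p' t * prim g t)"
proof -
  interpret finite_measure leb01 by (rule finite_measure_leb01)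
  interpret pair_sigma_finite leb01 leb01 ..
  let ?K = "\<lambda>t s. indicator {x. fst x \<le> snd x} (t, s) * (p' s * g t) :: real"
  have pi: "integrable leb01 p'" using p'c by auto
  obtain B where B: "\<And>t. t \<in> {0..1} \<Longrightarrow> \<bar>p' t\<bar> \<le> B"
    using continuous_bounded_01[OF p'c] by blast
  have idm: "(\<lambda>x. x) \<in> borel_measurable leb01"
    using id_borel_measurable_lebesgue_on[of "{0..1}"] by (simp add: id_def)
  have f1: "(\<lambda>x. fst x) \<in> borel_measurable (leb01 \<Otimes>\<^sub>M leb01)"
    and f2: "(\<lambda>x. snd x) \<in> borel_measurable (leb01 \<Otimes>\<^sub>M leb01)"
    using measurable_compose[OF measurable_fst idm] measurable_compose[OF measurable_snd idm] by auto
  have "{x \<in> space (leb01 \<Otimes>\<^sub>M leb01). fst x \<le> snd x} \<in> sets (leb01 \<Otimes>\<^sub>M leb01)"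
    using f1 f2 by (rule borel_measurable_le)
  then have ind: "(indicator {x. fst x \<le> snd x} :: _ \<Rightarrow> real) \<in> borel_measurable (leb01 \<Otimes>\<^sub>M leb01)"
    by (subst borel_measurable_indicator_iff) (simp add: Collect_conj_eq Int_commute)
  have m1: "(\<lambda>x. p' (snd x)) \<in> borel_measurable (leb01 \<Otimes>\<^sub>M leb01)"
    by (rule measurable_compose[OF measurable_snd borel_measurable_integrable[OF pi]])
  have m2: "(\<lambda>x. g (fst x)) \<in> borel_measurable (leb01 \<Otimes>\<^sub>M leb01)"
    by (rule measurable_compose[OF measurable_fst borel_measurable_integrable[OF g]])
  \<comment> \<open>The bound \<open>B\<close> for \<open>p'\<close> dominates the kernel by a
    multiple of \<open>g\<close>, a function of one variable only, which is integrable on the square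
    because the measure is finite.\<close>
  have Kint: "integrable (leb01 \<Otimes>\<^sub>M leb01) (case_prod ?K)"
  proof -
    have g2: "integrable (leb01 \<Otimes>\<^sub>M leb01) (\<lambda>x. B * g (fst x))"
    proof (rule Fubini_integrable)
      show "(\<lambda>x. B * g (fst x)) \<in> borel_measurable (leb01 \<Otimes>\<^sub>M leb01)" using m2 by measurable
    qed (use g in \<open>auto simp: integral_mult_right_zero measure_restrict_space\<close>)
    show ?thesis
    proof (rule Bochner_Integration.integrable_bound[OF g2])
      show "(case_prod ?K) \<in> borel_measurable (leb01 \<Otimes>\<^sub>M leb01)"
        using ind m1 m2 by (simp add: split_beta')
      have "norm (case_prod ?K x) \<le> norm (B * g (fst x))" if "x \<in> space (leb01 \<Otimes>\<^sub>M leb01)" for x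
      proof -
        have "\<bar>p' (snd x)\<bar> \<le> B" using that B by (auto simp: space_pair_measure)
        then have "\<bar>p' (snd x)\<bar> * \<bar>g (fst x)\<bar> \<le> \<bar>B\<bar> * \<bar>g (fst x)\<bar>" by (intro mult_right_mono) auto
        then show ?thesis by (auto simp: split_beta' indicator_def abs_mult)
      qed
      then show "AE x in leb01 \<Otimes>\<^sub>M leb01. norm (case_prod ?K x) \<le> norm (B * g (fst x))" by (rule AE_I2)
    qed
  qed
  have e1: "(LINT s|leb01. (LINT t|leb01. ?K t s)) = (LINT s|leb01. p' s * prim g s)"
  proof (rule integral_leb01_cong)
    fix s :: real assume s: "s \<in> {0..1}"
    have "(LINT t|leb01. ?K t s) = (LINT t|leb01. p' s * (indicator {..s} t * g t))"
      by (rule integral_leb01_cong) (auto simp: indicator_def)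
    then show "(LINT t|leb01. ?K t s) = p' s * prim g s"
      by (simp add: prim_eq_LINT[OF g s])
  qed
  have e2: "(LINT t|leb01. (LINT s|leb01. ?K t s)) = (LINT t|leb01. g t * p 1 - p t * g t)"
  proof (rule integral_leb01_cong)
    fix t :: real assume t: "t \<in> {0..1}"
    have m: "{t..1} \<in> sets leb01" using t by (subst sets_restrict_space_iff) auto
    have i: "integrable leb01 (\<lambda>s. indicator {t..1} s * p' s)"
      using integrable_mult_indicator[OF m pi] by simp
    have "(LINT s|leb01. ?K t s) = (LINT s|leb01. g t * (indicator {t..1} s * p' s))"
      by (rule integral_leb01_cong) (auto simp: indicator_def)
    also have "\<dots> = g t * (LINT s|leb01. indicator {t..1} s * p' s)" by simp
    also have "(LINT s|leb01. indicator {t..1} s * p' s) = integral {0..1} (\<lambda>s. indicator {t..1} s * p' s)"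
      by (rule integral_leb01_eq[OF i])
    also have "(\<lambda>s. indicator {t..1} s * p' s) = (\<lambda>s. if s \<in> {t..1} then p' s else 0)"
      by (auto simp: indicator_def)
    also have "integral {0..1} \<dots> = integral ({0..1} \<inter> {t..1}) p'" by (simp only: integral_restrict_Int Int_commute)
    also have "{0..1} \<inter> {t..1} = {t..1}" using t by auto
    also have "integral {t..1} p' = p 1 - p t"
      using prim_diff[OF pi t, of 1] prim_deriv[OF p'c p' t] prim_deriv[OF p'c p', of 1] t by simp
    finally show "(LINT s|leb01. ?K t s) = g t * p 1 - p t * g t" by (simp add: algebra_simps)
  qed
  have pg: "integrable leb01 (\<lambda>t. p t * g t)"
  proof -
    have pc: "continuous_on {0..1} p"
      using p' by (meson DERIV_continuous continuous_on_eq_continuous_within)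
    obtain C where C: "\<And>t. t \<in> {0..1} \<Longrightarrow> \<bar>p t\<bar> \<le> C"
      using continuous_bounded_01[OF pc] by blast
    have "integrable leb01 (\<lambda>t. C * g t)" using g by simp
    then show ?thesis
    proof (rule Bochner_Integration.integrable_bound)
      show "(\<lambda>t. p t * g t) \<in> borel_measurable leb01"
        by (rule borel_measurable_times[OF borel_measurable_integrable[OF continuous_imp_integrable_leb01[OF pc]]
              borel_measurable_integrable[OF g]])
      have "norm (p t * g t) \<le> norm (C * g t)" if "t \<in> {0..1}" for t
        using mult_right_mono[of "\<bar>p t\<bar>" "\<bar>C\<bar>" "\<bar>g t\<bar>"] C[OF that] by (simp add: abs_mult)
      then show "AE t in leb01. norm (p t * g t) \<le> norm (C * g t)" by (intro AE_I2) auto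
    qed
  qed
  have "prim g 1 = (LINT t|leb01. g t)"
    unfolding prim_def using integral_leb01_eq[OF g] by simp
  then have "(LINT t|leb01. g t * p 1 - p t * g t) = p 1 * prim g 1 - (LINT t|leb01. p t * g t)"
    using g pg by simp
  then show ?thesis using Fubini_integral[OF Kint] e1 e2 by simp
qed

section \<open>Weak derivatives of primitives, uniqueness, and du Bois-Reymond's lemma\<close>

lemma test_function_deriv:
  assumes "\<psi> \<in> test_functions"
  shows "(\<psi> has_real_derivative deriv \<psi> t) (at t within S)" "continuous_on S (deriv \<psi>)" "\<psi> 0 = 0" "\<psi> 1 = 0"
proof -
  obtain D where D: "\<And>x. (\<psi> has_vector_derivative D x) (at x)" "continuous_on UNIV D"
    using assms unfolding test_functions_def C1_differentiable_on_def by auto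
  have D': "(\<psi> has_real_derivative D x) (at x)" for x
    using D(1) by (simp add: has_real_derivative_iff_has_vector_derivative)
  then have eq: "deriv \<psi> = D" by (auto intro: DERIV_imp_deriv)
  show "(\<psi> has_real_derivative deriv \<psi> t) (at t within S)" unfolding eq
    using D' by (rule has_field_derivative_at_within)
  show "continuous_on S (deriv \<psi>)" unfolding eq using D(2) continuous_on_subset by blast
  show "\<psi> 0 = 0" "\<psi> 1 = 0" using assms unfolding test_functions_def by auto
qed

text \<open>Integration by parts. Test functions vanish at both endpoints, so no boundary term
  remains and \<open>c\<close> integrates to zero against \<open>deriv \<psi>\<close>.\<close>

lemma weak_deriv_prim:
  assumes g: "integrable leb01 g" and u: "\<And>t. t \<in> {0..1} \<Longrightarrow> u t = c + prim g t"
  shows "has_weak_deriv u g"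
  unfolding has_weak_deriv_def
proof
  fix \<psi> assume \<psi>: "\<psi> \<in> test_functions"
  note d = test_function_deriv[OF \<psi>]
  have di: "integrable leb01 (deriv \<psi>)" using d(2) by auto
  have "(LINT t|leb01. g t * \<psi> t) = - (LINT t|leb01. deriv \<psi> t * prim g t)"
    using integral_by_parts[OF g d(2) d(1)] d by (simp add: mult.commute)
  moreover have "(LINT t|leb01. u t * deriv \<psi> t) = (LINT t|leb01. c * deriv \<psi> t + deriv \<psi> t * prim g t)"
    by (rule integral_leb01_cong) (simp add: u algebra_simps)
  moreover have "\<dots> = c * (LINT t|leb01. deriv \<psi> t) + (LINT t|leb01. deriv \<psi> t * prim g t)"
    using di d(2) prim_continuous[OF g]
    by (subst Bochner_Integration.integral_add) (auto intro!: continuous_imp_integrable_leb01 continuous_intros)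
  moreover have "(LINT t|leb01. deriv \<psi> t) = 0"
    using integral_leb01_eq[OF di] prim_deriv[OF d(2) d(1), of 1] d by (simp add: prim_def)
  ultimately show "(LINT t|leb01. u t * deriv \<psi> t) = - (LINT t|leb01. g t * \<psi> t)" by simp
qed

lemma test_function_L2: "\<psi> \<in> test_functions \<Longrightarrow> \<psi> \<in> L2"
  by (intro continuous_imp_L2) (meson DERIV_continuous continuous_on_eq_continuous_within test_function_deriv(1))

lemma deriv_test_function_L2: "\<psi> \<in> test_functions \<Longrightarrow> deriv \<psi> \<in> L2"
  by (intro continuous_imp_L2 test_function_deriv(2))

lemma weak_deriv_unique:
  assumes "g \<in> L2" "h \<in> L2" "has_weak_deriv u g" "has_weak_deriv u h"
  shows "AE t in leb01. g t = h t"
proof -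
  have w: "(\<lambda>t. 1 * g t + (-1) * h t) \<in> L2" by (rule L2_lin[OF assms(1,2)])
  have "AE t in leb01. 1 * g t + (-1) * h t = 0"
  proof (rule AE_zero_if_bump_integrals_zero[OF L2_integrable[OF w]])
    fix a b :: real and n assume ab: "0 < a" "a < b" "b < 1"
    have b: "bump a b n \<in> test_functions" using ab by (intro bump_test_function)
    have "(LINT t|leb01. (1 * g t + (-1) * h t) * bump a b n t)
        = (LINT t|leb01. g t * bump a b n t - h t * bump a b n t)"
      by (rule integral_leb01_cong) (simp add: algebra_simps)
    also have "\<dots> = (LINT t|leb01. g t * bump a b n t) - (LINT t|leb01. h t * bump a b n t)"
      using assms(1,2) test_function_L2[OF b] L2_mult_integrable by (intro Bochner_Integration.integral_diff)
    also have "\<dots> = 0"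
    proof -
      have "(LINT t|leb01. u t * deriv (bump a b n) t) = - (LINT t|leb01. g t * bump a b n t)"
        "(LINT t|leb01. u t * deriv (bump a b n) t) = - (LINT t|leb01. h t * bump a b n t)"
        using assms(3,4) b unfolding has_weak_deriv_def by blast+
      then show ?thesis by linarith
    qed
    finally show "(LINT t|leb01. (1 * g t + (-1) * h t) * bump a b n t) = 0" .
  qed
  then show ?thesis by simp
qed

lemma has_weak_deriv_cong_AE:
  assumes "AE t in leb01. u t = v t" "u \<in> L2" "v \<in> L2" "has_weak_deriv u g"
  shows "has_weak_deriv v g"
proof -
  have "(LINT t|leb01. u t * deriv \<psi> t) = (LINT t|leb01. v t * deriv \<psi> t)" if "\<psi> \<in> test_functions" for \<psi>
    using assms(1) L2_measurable[OF assms(2)] L2_measurable[OF assms(3)] L2_measurable[OF deriv_test_function_L2[OF that]]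
    by (intro integral_cong_AE borel_measurable_times) (auto elim: eventually_mono)
  then show ?thesis using assms(4) unfolding has_weak_deriv_def by simp
qed

text \<open>The lemma of du Bois-Reymond: a test function of mean zero is a derivative of a test function.\<close>

lemma weak_deriv_zero_imp_const:
  assumes w: "w \<in> L2" and z: "has_weak_deriv w (\<lambda>t. 0)"
  obtains C where "AE t in leb01. w t = C"
proof -
  let ?m = "\<lambda>\<theta>. (LINT t|leb01. \<theta> t)"
  define \<theta>0 where "\<theta>0 = bump (1/4) (3/4) 1"
  have t0: "\<theta>0 \<in> test_functions" unfolding \<theta>0_def by (rule bump_test_function) auto
  have mean: "(LINT t|leb01. w t * \<theta> t) = 0" if th: "\<theta> \<in> test_functions" and th0: "?m \<theta> = 0" for \<theta>
  proof -
    obtain a b where ab: "0 < a" "b < 1" "\<And>t. t \<notin> {a..b} \<Longrightarrow> \<theta> t = 0"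
      using th unfolding test_functions_def by blast
    have c: "continuous_on S \<theta>" for S
      by (meson DERIV_continuous continuous_on_eq_continuous_within th test_function_deriv(1))
    have c01: "continuous_on {0..1} \<theta>" by (rule c)
    \<comment> \<open>The lower limit -1 lies to the left of the support, so \<psi> vanishes on both
      sides of 0. That it also vanishes to the right of \<open>b\<close> is where the zero mean of
      \<theta> enters.\<close>
    define \<psi> where "\<psi> t = integral {-1..t} \<theta>" for t
    have io: "\<theta> integrable_on {x..y}" for x y by (rule integrable_continuous_interval[OF c])
    have z0: "\<psi> t = 0" if "t < a" for t
      using Henstock_Kurzweil_Integration.integral_cong[of "{-1..t}" \<theta> "\<lambda>_. 0"] that ab
      by (auto simp: \<psi>_def)
    have z1: "\<psi> t = 0" if "b < t" for t
    proof (cases "a \<le> b")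
      case True
      have "integral {-1..1} \<theta> = integral {0..1} \<theta>"
        using Henstock_Kurzweil_Integration.integral_combine[of "-1" 0 1 \<theta>] io z0[of 0] ab by (simp add: \<psi>_def)
      also have "\<dots> = 0" using th0 integral_leb01_eq[of \<theta>] c01 by auto
      finally have i1: "integral {-1..1} \<theta> = 0" .
      have ib: "integral {b..s} \<theta> = 0" for s
        using ab integral_spike[of "{b}" "{b..s}" "\<lambda>_. 0" \<theta>] by fastforce
      have "integral {-1..b} \<theta> = 0"
        using Henstock_Kurzweil_Integration.integral_combine[of "-1" b 1 \<theta>] io i1 ib True ab by simp
      then show ?thesis unfolding \<psi>_def
        using Henstock_Kurzweil_Integration.integral_combine[of "-1" b t \<theta>] io ib True ab that by simp
    next
      case False
      then show ?thesis 
        using Henstock_Kurzweil_Integration.integral_cong[of "{-1..t}" \<theta> "\<lambda>_. 0"] ab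
        by (auto simp: \<psi>_def)
    qed
    have d: "(\<psi> has_real_derivative \<theta> t) (at t)" for t
    proof (cases "t < a")
      case True
      have "((\<lambda>t. 0) has_real_derivative 0) (at t)" by simp
      then have "(\<psi> has_real_derivative 0) (at t)"
        by (rule has_field_derivative_transform_within_open[of _ _ _ "{..<a}"]) (use True z0 in auto)
      then show ?thesis using True ab by simp
    next
      case False
      have "(\<psi> has_real_derivative \<theta> t) (at t within {-1..t+1})"
        unfolding \<psi>_def by (rule integral_has_real_derivative[OF c]) (use False ab in auto)
      then show ?thesis using False ab by (simp add: at_within_Icc_at)
    qed
    have "\<psi> C1_differentiable_on UNIV" unfolding C1_differentiable_on_def
      by (intro exI[of _ \<theta>] conjI ballI c d[unfolded has_real_derivative_iff_has_vector_derivative])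
    moreover have "\<psi> t = 0" if "t \<notin> {a..b}" for t using that z0[of t] z1[of t] by fastforce
    ultimately have "\<psi> \<in> test_functions" unfolding test_functions_def using ab(1,2) by blast
    moreover have "deriv \<psi> = \<theta>" using d by (auto intro: DERIV_imp_deriv)
    ultimately show ?thesis using z unfolding has_weak_deriv_def by fastforce
  qed
  have m0: "?m \<theta>0 \<noteq> 0"
  proof
    assume "?m \<theta>0 = 0"
    moreover have c0: "continuous_on {0..1} \<theta>0"
      by (meson DERIV_continuous continuous_on_eq_continuous_within t0 test_function_deriv(1))
    ultimately have "(\<theta>0 has_integral 0) {0..1}"
      using has_integral_integral_lebesgue_on[of "{0..1}" \<theta>0] continuous_imp_integrable_leb01[OF c0] by simp
    then have "\<theta>0 (1/2) = 0"
      using has_integral_0_cbox_imp_0[of 0 1 \<theta>0 "1/2"] c0 bump_nonneg by (simp add: \<theta>0_def)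
    then show False by (simp add: \<theta>0_def bump_def Let_def power_divide)
  qed
  define C where "C = (LINT t|leb01. w t * \<theta>0 t) / ?m \<theta>0"
  have wC: "(\<lambda>t. 1 * w t + (-C) * 1) \<in> L2"
    by (intro L2_lin w continuous_imp_L2 continuous_intros)
  have "AE t in leb01. 1 * w t + (-C) * 1 = 0"
  proof (rule AE_zero_if_bump_integrals_zero[OF L2_integrable[OF wC]])
    fix a b :: real and n assume ab: "0 < a" "a < b" "b < 1"
    let ?b = "bump a b n"
    have b: "?b \<in> test_functions" using ab by (intro bump_test_function)
    \<comment> \<open>Subtracting \<open>k\<close> times \<theta>0 from the bump leaves mean zero,
      so \<open>mean\<close> applies to the difference.\<close>
    define k where "k = ?m ?b / ?m \<theta>0"
    have t: "(\<lambda>t. ?b t - k * \<theta>0 t) \<in> test_functions"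
    proof -
      have "(\<lambda>t. ?b t - k * \<theta>0 t) C1_differentiable_on UNIV"
        using bump_C1 unfolding \<theta>0_def by (intro C1_differentiable_on_diff C1_differentiable_on_mult C1_differentiable_on_const)
      moreover have "?b t - k * \<theta>0 t = 0" if "t \<notin> {min a (1/4)..max b (3/4)}" for t
      proof -
        have "t \<notin> {a..b}" "t \<notin> {1/4..3/4}" using that by auto
        from this[THEN bump_outside] show ?thesis by (simp add: \<theta>0_def)
      qed
      moreover have "0 < min a (1/4)" "max b (3/4) < 1" using ab by auto
      ultimately show ?thesis unfolding test_functions_def by blast
    qed
    have i: "integrable leb01 ?b" "integrable leb01 \<theta>0"
      using b t0 by (auto intro: L2_integrable test_function_L2)
    have iw: "integrable leb01 (\<lambda>t. w t * ?b t)" "integrable leb01 (\<lambda>t. w t * \<theta>0 t)"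
      using b t0 w by (auto intro: L2_mult_integrable test_function_L2)
    have "?m (\<lambda>t. ?b t - k * \<theta>0 t) = 0" using i m0 by (simp add: k_def)
    then have "0 = (LINT t|leb01. w t * (?b t - k * \<theta>0 t))" using mean[OF t] by simp
    also have "\<dots> = (LINT t|leb01. w t * ?b t - k * (w t * \<theta>0 t))"
      by (rule integral_leb01_cong) (simp add: algebra_simps)
    also have "\<dots> = (LINT t|leb01. w t * ?b t) - k * (LINT t|leb01. w t * \<theta>0 t)" using iw by simp
    also have "k * (LINT t|leb01. w t * \<theta>0 t) = C * ?m ?b" by (simp add: k_def C_def)
    also have "(LINT t|leb01. w t * ?b t) - C * ?m ?b = (LINT t|leb01. w t * ?b t - C * ?b t)" using iw i
      by (subst Bochner_Integration.integral_diff) auto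
    also have "\<dots> = (LINT t|leb01. (1 * w t + (-C) * 1) * ?b t)"
      by (rule integral_leb01_cong) (simp add: algebra_simps)
    finally show "(LINT t|leb01. (1 * w t + (-C) * 1) * ?b t) = 0" by simp
  qed
  then show ?thesis using that[of C] by simp
qed

lemma continuous_AE_zero:
  assumes h: "continuous_on {0..1} h" and "AE t in leb01. h t = (0::real)" and t: "t \<in> {0..1}"
  shows "h t = 0"
proof -
  have c: "continuous_on {0..1} (\<lambda>t. (h t)\<^sup>2)" using h by (intro continuous_intros)
  have "(LINT t|leb01. (h t)\<^sup>2) = (LINT t|leb01. 0)"
    using assms(2) borel_measurable_integrable[OF continuous_imp_integrable_leb01[OF c]]
    by (intro integral_cong_AE) (auto elim: eventually_mono)
  then have "((\<lambda>t. (h t)\<^sup>2) has_integral 0) {0..1}"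
    using has_integral_integral_lebesgue_on[of "{0..1}" "\<lambda>t. (h t)\<^sup>2"] continuous_imp_integrable_leb01[OF c] by simp
  then have "(h t)\<^sup>2 = 0"
    using has_integral_0_cbox_imp_0[of 0 1 "\<lambda>t. (h t)\<^sup>2" t] c t by simp
  then show ?thesis by simp
qed

section \<open>Elements of X as double primitives of L2 functions\<close>

definition d2 :: "(real \<Rightarrow> real) \<Rightarrow> real \<Rightarrow> real" where
  "d2 u = weak_deriv (weak_deriv u)"

lemma weak_derivI:
  assumes "g \<in> L2" "has_weak_deriv u g"
  shows "weak_deriv u \<in> L2" "has_weak_deriv u (weak_deriv u)" "AE t in leb01. weak_deriv u t = g t"
proof -
  have "weak_deriv u \<in> L2 \<and> has_weak_deriv u (weak_deriv u)"
    unfolding weak_deriv_def by (rule someI[where x = g]) (use assms in auto)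
  then show "weak_deriv u \<in> L2" "has_weak_deriv u (weak_deriv u)" by auto
  then show "AE t in leb01. weak_deriv u t = g t" by (intro weak_deriv_unique[OF _ assms(1) _ assms(2)])
qed

lemma deriv_imp_continuous:
  "(\<And>t. t \<in> S \<Longrightarrow> (u has_real_derivative u' t) (at t within S)) \<Longrightarrow> continuous_on S u"
  by (meson DERIV_continuous continuous_on_eq_continuous_within)

text \<open>\<open>weak_deriv u\<close> is an arbitrary representative, equal to
  \<open>c + prim g\<close> only almost everywhere. Being a weak derivative does not depend on null
  sets, so \<open>g\<close> is still a weak derivative of that representative.\<close>

lemma d2_eq_AE:
  assumes g: "g \<in> L2" and u: "\<And>t. t \<in> {0..1} \<Longrightarrow> (u has_real_derivative c + prim g t) (at t within {0..1})"
  shows "d2 u \<in> L2" "AE t in leb01. d2 u t = g t" "u \<in> H2"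
proof -
  note gi = L2_integrable[OF g]
  let ?u' = "\<lambda>t. c + prim g t"
  have c: "continuous_on {0..1} ?u'" using prim_continuous[OF gi] by (intro continuous_intros)
  have h1: "has_weak_deriv u ?u'"
    using weak_deriv_prim[OF continuous_imp_integrable_leb01[OF c]] prim_deriv[OF c u] by blast
  have h2: "has_weak_deriv ?u' g" by (rule weak_deriv_prim[OF gi]) simp
  note w = weak_derivI[OF continuous_imp_L2[OF c] h1]
  have "has_weak_deriv (weak_deriv u) g"
    using has_weak_deriv_cong_AE[OF _ continuous_imp_L2[OF c] w(1) h2] w(3) by (simp add: eq_commute)
  then show "d2 u \<in> L2" "AE t in leb01. d2 u t = g t"
    unfolding d2_def using weak_derivI[OF g] by auto
  have "u \<in> L2" using deriv_imp_continuous[OF u] by (intro continuous_imp_L2) auto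
  then show "u \<in> H2" unfolding H2_def H1_def using h1 h2 continuous_imp_L2[OF c] g by blast
qed

lemma XI:
  assumes "g \<in> L2" "\<And>t. t \<in> {0..1} \<Longrightarrow> (u has_real_derivative prim g t) (at t within {0..1})"
    "u 0 = 0" "\<And>t. t \<notin> {0..1} \<Longrightarrow> u t = 0"
  shows "u \<in> X"
proof -
  have "u \<in> H2" using d2_eq_AE(3)[of g u 0] assms by simp
  then show ?thesis unfolding X_def using assms(2-4) prim_continuous[OF L2_integrable[OF assms(1)]] prim_0[of g] by blast
qed

text \<open>The converse of \<open>XI\<close>. The classical derivative and the primitive of the
  second weak derivative have the same weak derivative, hence differ by a constant almost
  everywhere; by continuity they do so everywhere, and their common value 0 at 0 removes the
  constant.\<close>

lemma XD:
  assumes "u \<in> X"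
  shows "d2 u \<in> L2" "t \<in> {0..1} \<Longrightarrow> (u has_real_derivative prim (d2 u) t) (at t within {0..1})"
    "u 0 = 0" "t \<notin> {0..1} \<Longrightarrow> u t = 0"
proof -
  obtain u' where u': "continuous_on {0..1} u'"
    "\<And>t. t \<in> {0..1} \<Longrightarrow> (u has_real_derivative u' t) (at t within {0..1})" "u 0 = 0" "u' 0 = 0"
    using assms unfolding X_def by blast
  obtain g1 g2 where g: "g1 \<in> L2" "has_weak_deriv u g1" "g2 \<in> L2" "has_weak_deriv g1 g2"
    using assms unfolding X_def H2_def H1_def by blast
  note g2i = L2_integrable[OF g(3)]
  have pc: "continuous_on {0..1} (prim g2)" by (rule prim_continuous[OF g2i])
  have "has_weak_deriv u u'"
    using weak_deriv_prim[OF continuous_imp_integrable_leb01[OF u'(1)]] prim_deriv[OF u'(1,2)] by blast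
  then have "AE t in leb01. g1 t = u' t" using weak_deriv_unique g continuous_imp_L2[OF u'(1)] by blast
  then have h: "has_weak_deriv u' g2" using has_weak_deriv_cong_AE g continuous_imp_L2[OF u'(1)] by blast
  have hp: "has_weak_deriv (prim g2) g2" by (rule weak_deriv_prim[OF g2i, of _ 0]) simp
  let ?w = "\<lambda>t. 1 * u' t + (-1) * prim g2 t"
  have w: "?w \<in> L2" by (intro L2_lin continuous_imp_L2 u' pc)
  have "has_weak_deriv ?w (\<lambda>t. 0)" unfolding has_weak_deriv_def
  proof
    fix \<psi> assume \<psi>: "\<psi> \<in> test_functions"
    have "(LINT t|leb01. ?w t * deriv \<psi> t) = (LINT t|leb01. u' t * deriv \<psi> t - prim g2 t * deriv \<psi> t)"
      by (rule integral_leb01_cong) (simp add: algebra_simps)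
    also have "\<dots> = (LINT t|leb01. u' t * deriv \<psi> t) - (LINT t|leb01. prim g2 t * deriv \<psi> t)"
      by (intro Bochner_Integration.integral_diff L2_mult_integrable continuous_imp_L2 u' pc deriv_test_function_L2 \<psi>)
    also have "\<dots> = 0" using h hp \<psi> unfolding has_weak_deriv_def by simp
    finally show "(LINT t|leb01. ?w t * deriv \<psi> t) = - (LINT t|leb01. 0 * \<psi> t)" by simp
  qed
  then obtain C where C: "AE t in leb01. ?w t = C" using weak_deriv_zero_imp_const[OF w] by blast
  have *: "?w t - C = 0" if "t \<in> {0..1}" for t
    by (rule continuous_AE_zero[OF _ _ that]) (use C u'(1) pc in \<open>auto intro!: continuous_intros\<close>)
  have "C = 0" using *[of 0] u'(4) by simp
  then have e: "u' t = prim g2 t" if "t \<in> {0..1}" for t using *[OF that] by simp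
  have u2: "(u has_real_derivative prim g2 t) (at t within {0..1})" if "t \<in> {0..1}" for t
    using u'(2)[OF that] e[OF that] by simp
  then have d: "d2 u \<in> L2" "AE t in leb01. d2 u t = g2 t" using d2_eq_AE[OF g(3), of u 0] by auto
  then show "d2 u \<in> L2" by simp
  show "(u has_real_derivative prim (d2 u) t) (at t within {0..1})" if "t \<in> {0..1}"
    using u2[OF that] prim_cong_AE[OF L2_integrable[OF d(1)] g2i d(2) that] by simp
  show "u 0 = 0" by fact
  show "t \<notin> {0..1} \<Longrightarrow> u t = 0" using assms unfolding X_def by blast
qed

section \<open>The Hilbert space X\<close>

lemma prim_lin:
  assumes "integrable leb01 g" "integrable leb01 h" "t \<in> {0..1}"
  shows "prim (\<lambda>t. a * g t + b * h t) t = a * prim g t + b * prim h t"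
proof -
  have "g integrable_on {0..t}" "h integrable_on {0..t}"
    using assms by (auto intro!: integrable_on_sub)
  then show ?thesis unfolding prim_def
    by (subst Henstock_Kurzweil_Integration.integral_add)
       (auto intro: integrable_on_mult_right simp: Henstock_Kurzweil_Integration.integral_mult_right)
qed

lemma d2_lin:
  assumes "u \<in> X" "v \<in> X"
  shows "(\<lambda>t. a * u t + b * v t) \<in> X"
    and "AE t in leb01. d2 (\<lambda>t. a * u t + b * v t) t = a * d2 u t + b * d2 v t"
proof -
  note u = XD[OF assms(1)] and v = XD[OF assms(2)]
  let ?g = "\<lambda>t. a * d2 u t + b * d2 v t"
  have g: "?g \<in> L2" by (intro L2_lin u v)
  have d: "((\<lambda>t. a * u t + b * v t) has_real_derivative prim ?g t) (at t within {0..1})" if "t \<in> {0..1}" for t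
    unfolding prim_lin[OF L2_integrable[OF u(1)] L2_integrable[OF v(1)] that]
    using u(2)[OF that] v(2)[OF that] by (auto intro!: derivative_eq_intros)
  show "(\<lambda>t. a * u t + b * v t) \<in> X"
    by (rule XI[OF g d]) (use u v in auto)
  show "AE t in leb01. d2 (\<lambda>t. a * u t + b * v t) t = ?g t"
    using d2_eq_AE(2)[OF g, of _ 0] d by simp
qed

text \<open>Functions in \<^const>\<open>X\<close> as a type of class \<^class>\<open>real_inner\<close>; its topology is carried over to
  \<^const>\<open>X_topology\<close> by \<open>ap\<close> and \<open>mk\<close>.\<close>

typedef xs = X morphisms ap mk
proof
  show "(\<lambda>t. 0) \<in> X" by (rule XI[of "\<lambda>t. 0"]) (auto simp: prim_def[abs_def] intro: continuous_imp_L2)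
qed

lemma ap_X: "ap x \<in> X" by (rule ap)

text \<open>Every operation is written as a combination \<open>a * u t + b * v t\<close>, so that
  the single closure fact \<open>d2_lin\<close> covers all of them.\<close>

instantiation xs :: real_vector
begin
definition "0 = mk (\<lambda>t. 0)"
definition "x + y = mk (\<lambda>t. 1 * ap x t + 1 * ap y t)"
definition "- x = mk (\<lambda>t. (-1) * ap x t + 0 * ap x t)"
definition "x - y = mk (\<lambda>t. 1 * ap x t + (-1) * ap y t)"
definition "a *\<^sub>R x = mk (\<lambda>t. a * ap x t + 0 * ap x t)"

lemma ap_0 [simp]: "ap 0 t = 0"
proof -
  have "(\<lambda>t. 0 * ap x t + 0 * ap x t) \<in> X" for x by (rule d2_lin[OF ap_X ap_X])
  then show ?thesis unfolding zero_xs_def by (simp add: mk_inverse)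
qed

lemma ap_add [simp]: "ap (x + y) t = ap x t + ap y t"
  and ap_minus [simp]: "ap (- x) t = - ap x t"
  and ap_diff [simp]: "ap (x - y) t = ap x t - ap y t"
  and ap_scale [simp]: "ap (a *\<^sub>R x) t = a * ap x t"
  unfolding plus_xs_def uminus_xs_def minus_xs_def scaleR_xs_def
  by (simp_all only: mk_inverse d2_lin(1)[OF ap_X ap_X])

lemma xs_eqI: "(\<And>t. ap x t = ap y t) \<Longrightarrow> x = y"
  using ap_inject by blast

instance by standard (auto intro!: xs_eqI simp: algebra_simps)
end

lemma d2_L2: "d2 (ap x) \<in> L2" by (rule XD[OF ap_X])

lemma d2_add: "AE t in leb01. d2 (ap (x + y)) t = d2 (ap x) t + d2 (ap y) t"
proof -
  have "ap (x + y) = (\<lambda>t. 1 * ap x t + 1 * ap y t)" by auto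
  then show ?thesis using d2_lin(2)[OF ap_X ap_X, of 1 x 1 y] by simp
qed

lemma d2_scale: "AE t in leb01. d2 (ap (a *\<^sub>R x)) t = a * d2 (ap x) t"
proof -
  have "ap (a *\<^sub>R x) = (\<lambda>t. a * ap x t + 0 * ap x t)" by auto
  then show ?thesis using d2_lin(2)[OF ap_X ap_X, of a x 0 x] by simp
qed

lemma ap_deriv: "t \<in> {0..1} \<Longrightarrow> (ap x has_real_derivative prim (d2 (ap x)) t) (at t within {0..1})"
  and ap_at_0 [simp]: "ap x 0 = 0"
  and ap_outside: "t \<notin> {0..1} \<Longrightarrow> ap x t = 0"
  using XD[OF ap_X] by auto

lemma ap_cont: "continuous_on {0..1} (ap x)"
  by (rule deriv_imp_continuous[OF ap_deriv])

text \<open>The first derivative is a primitive of the second, hence bounded by its L1 norm. The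
  estimate gives definiteness of the inner product and later the equicontinuity of bounded
  sets.\<close>

lemma ap_lipschitz_L2:
  assumes "s \<in> {0..1}" "t \<in> {0..1}"
  shows "\<bar>ap x t - ap x s\<bar> \<le> L2_norm (d2 (ap x)) * \<bar>t - s\<bar>"
proof -
  have "norm (ap x t - ap x s) \<le> L2_norm (d2 (ap x)) * norm (t - s)"
  proof (rule field_differentiable_bound[of "{0..1}"])
    fix r :: real assume r: "r \<in> {0..1}"
    show "(ap x has_field_derivative prim (d2 (ap x)) r) (at r within {0..1})" by (rule ap_deriv[OF r])
    show "norm (prim (d2 (ap x)) r) \<le> L2_norm (d2 (ap x))"
      using abs_prim_le[OF L2_integrable[OF d2_L2] r, of x] L1_le_L2[OF d2_L2, of x] by simp
  qed (use assms in auto)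
  then show ?thesis by simp
qed

instantiation xs :: real_inner
begin
definition "inner x y = (LINT t|leb01. d2 (ap x) t * d2 (ap y) t)"
definition "norm (x :: xs) = sqrt (inner x x)"
definition "sgn (x :: xs) = x /\<^sub>R norm x"
definition "dist (x :: xs) y = norm (x - y)"
definition "(uniformity :: (xs \<times> xs) filter) = (INF e\<in>{0<..}. principal {(x, y). dist x y < e})"
definition "open (U :: xs set) \<longleftrightarrow> (\<forall>x\<in>U. \<forall>\<^sub>F (x', y) in uniformity. x' = x \<longrightarrow> y \<in> U)"

instance
proof
  fix x y z :: xs and r :: real
  note i = L2_mult_integrable[OF d2_L2 d2_L2]
  note m = borel_measurable_integrable[OF i] L2_measurable[OF d2_L2]
  show "inner x y = inner y x" unfolding inner_xs_def by (simp add: mult.commute)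
  have "inner (x + y) z = (LINT t|leb01. d2 (ap x) t * d2 (ap z) t + d2 (ap y) t * d2 (ap z) t)"
    unfolding inner_xs_def
    by (rule integral_cong_AE)
       (use d2_add[of x y] m in \<open>auto intro!: borel_measurable_add elim!: eventually_mono simp: algebra_simps\<close>)
  then show "inner (x + y) z = inner x z + inner y z"
    unfolding inner_xs_def using i by simp
  have "inner (r *\<^sub>R x) y = (LINT t|leb01. r * (d2 (ap x) t * d2 (ap y) t))"
    unfolding inner_xs_def
    by (rule integral_cong_AE)
       (use d2_scale[of r x] m in \<open>auto elim!: eventually_mono simp: algebra_simps\<close>)
  then show "inner (r *\<^sub>R x) y = r * inner x y" unfolding inner_xs_def by simp
  show "0 \<le> inner x x" unfolding inner_xs_def by simp
  show "inner x x = 0 \<longleftrightarrow> x = 0"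
  proof
    assume "inner x x = 0"
    then have z: "L2_norm (d2 (ap x)) = 0" by (simp add: inner_xs_def L2_norm_def power2_eq_square)
    have "ap x t = 0" for t
    proof (cases "t \<in> {0..1}")
      case True then show ?thesis using ap_lipschitz_L2[of 0 t x] z by simp
    qed (rule ap_outside)
    then show "x = 0" by (intro xs_eqI) simp
  next
    assume "x = 0"
    have "inner (0 *\<^sub>R x) x = 0 * inner x x" 
    proof -
      have "inner (0 *\<^sub>R x) x = (LINT t|leb01. 0 * (d2 (ap x) t * d2 (ap x) t))"
        unfolding inner_xs_def
        by (rule integral_cong_AE)
           (use d2_scale[of 0 x] m in \<open>auto elim!: eventually_mono simp: algebra_simps\<close>)
      then show ?thesis by simp
    qed
    then show "inner x x = 0" using \<open>x = 0\<close> by simp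
  qed
qed (simp_all add: norm_xs_def sgn_xs_def dist_xs_def uniformity_xs_def open_xs_def)
end

lemma norm_eq_L2_norm: "norm x = L2_norm (d2 (ap x))"
  by (simp add: norm_xs_def inner_xs_def L2_norm_def power2_eq_square)

lemma X_norm_eq_L2_norm: "X_norm u = L2_norm (d2 u)"
  by (simp add: X_norm_def L2_norm_def d2_def)

lemma X_norm_ap: "X_norm (ap x) = norm x"
  by (simp add: norm_eq_L2_norm X_norm_eq_L2_norm)

lemma ap_lipschitz: "s \<in> {0..1} \<Longrightarrow> t \<in> {0..1} \<Longrightarrow> \<bar>ap x t - ap x s\<bar> \<le> norm x * \<bar>t - s\<bar>"
  using ap_lipschitz_L2 by (simp add: norm_eq_L2_norm)

lemma abs_ap_le: "\<bar>ap x t\<bar> \<le> norm x"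
proof (cases "t \<in> {0..1}")
  case True
  have "\<bar>ap x t\<bar> \<le> norm x * t" using ap_lipschitz[of 0 t x] True by simp
  also have "\<dots> \<le> norm x * 1" using True by (intro mult_left_mono) auto
  finally show ?thesis by simp
qed (simp add: ap_outside)

text \<open>Functions given by formulas (Green potentials, polynomials, \<open>phi1\<close>) enter
  the Hilbert space here. The last two claims concern \<open>u\<close> before it is cut off outside
  the unit interval, the form in which \<open>phi1\<close> occurs in \<open>phi\<close>.\<close>

lemma ap_mk_C2:
  assumes g: "continuous_on {0..1} g"
    and u': "\<And>t. t \<in> {0..1} \<Longrightarrow> (u' has_real_derivative g t) (at t within {0..1})"
    and u: "\<And>t. t \<in> {0..1} \<Longrightarrow> (u has_real_derivative u' t) (at t within {0..1})"
    and "u 0 = 0" "u' 0 = 0"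
  defines "x \<equiv> mk (\<lambda>t. if t \<in> {0..1} then u t else 0)"
  shows "t \<in> {0..1} \<Longrightarrow> ap x t = u t"
    and "AE t in leb01. d2 (ap x) t = g t"
    and "AE t in leb01. d2 u t = g t" and "d2 u \<in> L2"
proof -
  have g2: "g \<in> L2" by (rule continuous_imp_L2[OF g])
  have u'': "u' t = prim g t" if "t \<in> {0..1}" for t using prim_deriv[OF g u' that] assms(5) by simp
  have du: "(u has_real_derivative prim g t) (at t within {0..1})" if "t \<in> {0..1}" for t
    using u[OF that] u''[OF that] by simp
  let ?v = "\<lambda>t. if t \<in> {0..1} then u t else 0"
  have dv: "(?v has_real_derivative prim g t) (at t within {0..1})" if "t \<in> {0..1}" for t
    by (rule has_field_derivative_transform_within[OF du[OF that], of 1]) (use that in auto)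
  have "?v \<in> X" by (rule XI[OF g2 dv]) (use assms(4) in auto)
  then have ap: "ap x = ?v" unfolding x_def by (rule mk_inverse)
  show "t \<in> {0..1} \<Longrightarrow> ap x t = u t" by (simp add: ap)
  show "AE t in leb01. d2 (ap x) t = g t" unfolding ap using d2_eq_AE(2)[OF g2, of _ 0] dv by simp
  show "AE t in leb01. d2 u t = g t" "d2 u \<in> L2" using d2_eq_AE[OF g2, of _ 0] du by auto
qed

lemma L2_norm_cong_AE:
  assumes "AE t in leb01. g t = h t" "g \<in> L2" "h \<in> L2"
  shows "L2_norm g = L2_norm h"
proof -
  have "(LINT t|leb01. (g t)\<^sup>2) = (LINT t|leb01. (h t)\<^sup>2)"
    using borel_measurable_integrable[OF L2_sq_integrable[OF assms(2)]] borel_measurable_integrable[OF L2_sq_integrable[OF assms(3)]] assms(1)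
    by (intro integral_cong_AE) (auto elim: eventually_mono)
  then show ?thesis by (simp add: L2_norm_def)
qed

section \<open>The Green operator\<close>

lemma integrable_indicator_mult:
  assumes g: "integrable leb01 (g :: real \<Rightarrow> real)"
  shows "integrable leb01 (\<lambda>s. indicator {..t} s * g s)"
proof (rule Bochner_Integration.integrable_bound[OF g])
  have "{..t} \<inter> space leb01 \<in> sets leb01" by (subst sets_restrict_space_iff) auto
  then have "(indicator {..t} :: real \<Rightarrow> real) \<in> borel_measurable leb01"
    by (subst borel_measurable_indicator_iff)
  then show "(\<lambda>s. indicator {..t} s * g s) \<in> borel_measurable leb01"
    using borel_measurable_integrable[OF g] by (rule borel_measurable_times)
qed (auto simp: indicator_def)

text \<open>Expanding the piecewise polynomial kernel separates the variables: what remains are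
  primitives of s^k v(s) with coefficients polynomial in t, and these can be differentiated by the
  product rule.\<close>

lemma J_eq:
  assumes v: "continuous_on {0..1} v" and t: "t \<in> {0..1}"
  shows "J v t = t / 2 * prim (\<lambda>s. s\<^sup>2 * v s) t - prim (\<lambda>s. s ^ 3 * v s) t / 6
     + t\<^sup>2 / 2 * (prim (\<lambda>s. s * v s) 1 - prim (\<lambda>s. s * v s) t) - t ^ 3 / 6 * (prim v 1 - prim v t)"
proof -
  let ?I = "\<lambda>s. indicator {..t} s :: real"
  have i: "integrable leb01 (\<lambda>s. s\<^sup>2 * v s)" "integrable leb01 (\<lambda>s. s ^ 3 * v s)"
    "integrable leb01 (\<lambda>s. s * v s)" "integrable leb01 v"
    using v by (auto intro!: continuous_imp_integrable_leb01 continuous_intros)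
  note j = i[THEN integrable_indicator_mult, of t]
  note p = i[THEN prim_eq_LINT, OF t]
  have one: "prim g 1 = (LINT s|leb01. g s)" if "integrable leb01 g" for g
    unfolding prim_def using integral_leb01_eq[OF that] by simp
  have "J v t = (LINT s|leb01. t / 2 * (?I s * (s\<^sup>2 * v s)) - (?I s * (s ^ 3 * v s)) / 6
     + (t\<^sup>2 / 2 * (s * v s) - t\<^sup>2 / 2 * (?I s * (s * v s))) - (t ^ 3 / 6 * v s - t ^ 3 / 6 * (?I s * v s)))"
    unfolding J_def
    by (rule integral_leb01_cong)
       (auto simp: G_def indicator_def power2_eq_square power3_eq_cube field_simps)
  also have "\<dots> = t / 2 * (LINT s|leb01. ?I s * (s\<^sup>2 * v s)) - (LINT s|leb01. ?I s * (s ^ 3 * v s)) / 6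
     + (t\<^sup>2 / 2 * (LINT s|leb01. s * v s) - t\<^sup>2 / 2 * (LINT s|leb01. ?I s * (s * v s)))
     - (t ^ 3 / 6 * (LINT s|leb01. v s) - t ^ 3 / 6 * (LINT s|leb01. ?I s * v s))"
    using i j by simp
  finally show ?thesis unfolding p one[OF i(3)] one[OF i(4)] by (simp add: algebra_simps)
qed

text \<open>\<open>J1\<close>, \<open>J2\<close>, \<open>J3\<close> come from termwise
  differentiation of \<open>J_eq\<close>; at each of these stages the terms containing
  \<open>v t\<close> itself cancel, and only the fourth derivative returns \<open>v\<close>.\<close>

definition J1 :: "(real \<Rightarrow> real) \<Rightarrow> real \<Rightarrow> real" where
  "J1 v t = prim (\<lambda>s. s\<^sup>2 * v s) t / 2 + t * (prim (\<lambda>s. s * v s) 1 - prim (\<lambda>s. s * v s) t)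
     - t\<^sup>2 / 2 * (prim v 1 - prim v t)"

definition J2 :: "(real \<Rightarrow> real) \<Rightarrow> real \<Rightarrow> real" where
  "J2 v t = (prim (\<lambda>s. s * v s) 1 - prim (\<lambda>s. s * v s) t) - t * (prim v 1 - prim v t)"

definition J3 :: "(real \<Rightarrow> real) \<Rightarrow> real \<Rightarrow> real" where
  "J3 v t = - (prim v 1 - prim v t)"

lemma J_deriv:
  assumes v: "continuous_on {0..1} v" and t: "t \<in> {0..1}"
  shows "(J v has_real_derivative J1 v t) (at t within {0..1})"
    and "(J1 v has_real_derivative J2 v t) (at t within {0..1})"
    and "(J2 v has_real_derivative J3 v t) (at t within {0..1})"
    and "(J3 v has_real_derivative v t) (at t within {0..1})"
proof -
  have c: "continuous_on {0..1} (\<lambda>s. s\<^sup>2 * v s)" "continuous_on {0..1} (\<lambda>s. s ^ 3 * v s)"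
    "continuous_on {0..1} (\<lambda>s. s * v s)" using v by (auto intro!: continuous_intros)
  define a b e w where abew: "a = prim (\<lambda>s. s\<^sup>2 * v s)" "b = prim (\<lambda>s. s ^ 3 * v s)"
    "e = prim (\<lambda>s. s * v s)" "w = prim v"
  have d: "(a has_real_derivative t\<^sup>2 * v t) (at t within {0..1})"
    "(b has_real_derivative t ^ 3 * v t) (at t within {0..1})"
    "(e has_real_derivative t * v t) (at t within {0..1})"
    "(w has_real_derivative v t) (at t within {0..1})"
    unfolding abew using deriv_prim[OF c(1) t] deriv_prim[OF c(2) t] deriv_prim[OF c(3) t] deriv_prim[OF v t] by auto
  have "((\<lambda>t. t / 2 * a t - b t / 6 + t\<^sup>2 / 2 * (e 1 - e t) - t ^ 3 / 6 * (w 1 - w t))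
      has_real_derivative J1 v t) (at t within {0..1})"
    unfolding J1_def abew[symmetric]
    by (auto intro!: derivative_eq_intros d simp: power2_eq_square power3_eq_cube field_simps)
  then show "(J v has_real_derivative J1 v t) (at t within {0..1})"
    by (rule has_field_derivative_transform_within[of _ _ _ _ 1]) (use t in \<open>auto simp: J_eq[OF v] abew\<close>)
  show "(J1 v has_real_derivative J2 v t) (at t within {0..1})"
    unfolding J1_def[abs_def] J2_def abew[symmetric]
    by (auto intro!: derivative_eq_intros d simp: power2_eq_square field_simps)
  show "(J2 v has_real_derivative J3 v t) (at t within {0..1})"
    unfolding J2_def[abs_def] J3_def abew[symmetric]
    by (auto intro!: derivative_eq_intros d simp: field_simps)
  show "(J3 v has_real_derivative v t) (at t within {0..1})"
    unfolding J3_def[abs_def] abew[symmetric] by (auto intro!: derivative_eq_intros d)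
qed

lemma J_boundary: "J1 v 0 = 0" "J2 v 1 = 0" "J3 v 1 = 0"
  by (simp_all add: J1_def J2_def J3_def)

lemma J_at_0: "continuous_on {0..1} v \<Longrightarrow> J v 0 = 0"
  by (simp add: J_eq)

definition solJ :: "(real \<Rightarrow> real) \<Rightarrow> xs" where
  "solJ v = mk (\<lambda>t. if t \<in> {0..1} then J v t else 0)"

lemma J2_cont: "continuous_on {0..1} v \<Longrightarrow> continuous_on {0..1} (J2 v)"
  by (rule deriv_imp_continuous[OF J_deriv(3)])

lemma ap_solJ: "continuous_on {0..1} v \<Longrightarrow> t \<in> {0..1} \<Longrightarrow> ap (solJ v) t = J v t"
  unfolding solJ_def by (rule ap_mk_C2(1)[OF J2_cont J_deriv(2) J_deriv(1) J_at_0 J_boundary(1)])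

lemma d2_solJ: "continuous_on {0..1} v \<Longrightarrow> AE t in leb01. d2 (ap (solJ v)) t = J2 v t"
  unfolding solJ_def by (rule ap_mk_C2(2)[OF J2_cont J_deriv(2) J_deriv(1) J_at_0 J_boundary(1)])

lemma prim_d2_ap: "t \<in> {0..1} \<Longrightarrow> ap x t = prim (prim (d2 (ap x))) t"
  using prim_deriv[OF prim_continuous[OF L2_integrable[OF d2_L2]] ap_deriv, of t x] by simp

text \<open>Two integrations by parts: the conditions u''(1) = u'''(1) = 0 remove the boundary terms
  at 1, and the primitives start from 0 at the other end. Thus \<open>solJ v\<close> is the Riesz
  representative of integration against \<open>v\<close>, which is how the gradients below are
  identified.\<close>

lemma inner_solJ:
  assumes v: "continuous_on {0..1} v"
  shows "inner (solJ v) x = (LINT t|leb01. v t * ap x t)"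
proof -
  let ?g = "d2 (ap x)"
  have g: "integrable leb01 ?g" by (rule L2_integrable[OF d2_L2])
  have pg: "integrable leb01 (prim ?g)" using prim_continuous[OF g] by auto
  have J3c: "continuous_on {0..1} (J3 v)" by (rule deriv_imp_continuous[OF J_deriv(4)[OF v]])
  have "inner (solJ v) x = (LINT t|leb01. J2 v t * ?g t)"
    unfolding inner_xs_def
    by (rule integral_cong_AE)
       (use d2_solJ[OF v] borel_measurable_integrable[OF L2_mult_integrable[OF d2_L2 d2_L2]]
         borel_measurable_integrable[OF L2_mult_integrable[OF continuous_imp_L2[OF J2_cont[OF v]] d2_L2]]
        in \<open>auto elim!: eventually_mono\<close>)
  also have "\<dots> = - (LINT t|leb01. J3 v t * prim ?g t)"
    using integral_by_parts[OF g J3c J_deriv(3)[OF v]] by (simp add: J_boundary)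
  also have "\<dots> = (LINT t|leb01. v t * prim (prim ?g) t)"
    using integral_by_parts[OF pg v J_deriv(4)[OF v]] by (simp add: J_boundary)
  also have "\<dots> = (LINT t|leb01. v t * ap x t)"
    by (rule integral_leb01_cong) (simp add: prim_d2_ap)
  finally show ?thesis .
qed

text \<open>The difference is tested against itself and bounded by \<open>abs_ap_le\<close>. As only
  the max norm of the data enters, uniform convergence of data gives convergence in X; the
  compactness of \<open>T\<close> and of the nonlinear operator rests on this.\<close>

lemma norm_solJ_diff_le:
  assumes v: "continuous_on {0..1} v" and w: "continuous_on {0..1} w"
    and B: "\<And>t. t \<in> {0..1} \<Longrightarrow> \<bar>v t - w t\<bar> \<le> B"
  shows "norm (solJ v - solJ w) \<le> B"
proof -
  let ?d = "solJ v - solJ w"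
  have "norm ?d * norm ?d = inner (solJ v) ?d - inner (solJ w) ?d"
    by (simp add: inner_diff_left[symmetric] dot_square_norm power2_eq_square)
  also have "\<dots> = (LINT t|leb01. v t * ap ?d t - w t * ap ?d t)"
    unfolding inner_solJ[OF v] inner_solJ[OF w] using v w ap_cont
    by (intro Bochner_Integration.integral_diff[symmetric] continuous_imp_integrable_leb01 continuous_intros)
  also have "\<dots> \<le> (LINT t|leb01. B * norm ?d)"
  proof (rule integral_leb01_mono)
    show "integrable leb01 (\<lambda>t. v t * ap ?d t - w t * ap ?d t)" using v w ap_cont
      by (intro continuous_imp_integrable_leb01 continuous_intros)
    fix t :: real assume t: "t \<in> {0..1}"
    have "v t * ap ?d t - w t * ap ?d t \<le> \<bar>v t - w t\<bar> * \<bar>ap ?d t\<bar>"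
      unfolding left_diff_distrib[symmetric] abs_mult[symmetric] by (rule abs_ge_self)
    also have "\<dots> \<le> B * norm ?d"
      by (rule mult_mono[OF B[OF t] abs_ap_le]) (use B[OF t] in auto)
    finally show "v t * ap ?d t - w t * ap ?d t \<le> B * norm ?d" .
  qed auto
  finally have "norm ?d * norm ?d \<le> B * norm ?d" by simp
  moreover have "0 \<le> B" using B[of 0] by auto
  ultimately show ?thesis
    by (cases "norm ?d = 0") (auto simp: mult_le_cancel_right)
qed

section \<open>The operator that represents the L2 inner product\<close>

definition T :: "xs \<Rightarrow> xs" where "T x = solJ (ap x)"

lemma inner_T: "inner (T x) y = (LINT t|leb01. ap x t * ap y t)"
  unfolding T_def by (rule inner_solJ[OF ap_cont])

lemma inner_T_commute: "inner (T x) y = inner (T y) x"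
  unfolding inner_T by (simp add: mult.commute)

text \<open>Symmetry moves \<open>T\<close> to the other argument, where linearity is that of the
  inner product.\<close>

lemma T_add: "T (x + y) = T x + T y" and T_scale: "T (a *\<^sub>R x) = a *\<^sub>R T x"
proof -
  have "inner (T (x + y)) z = inner (T x + T y) z" for z
    by (simp add: inner_T_commute[of _ z] inner_add_left inner_add_right)
  then show "T (x + y) = T x + T y" by (metis inner_diff_left inner_eq_zero_iff right_minus_eq)
  have "inner (T (a *\<^sub>R x)) z = inner (a *\<^sub>R T x) z" for z
    by (simp add: inner_T_commute[of _ z])
  then show "T (a *\<^sub>R x) = a *\<^sub>R T x" by (metis inner_diff_left inner_eq_zero_iff right_minus_eq)
qed

lemma bounded_linear_T: "bounded_linear T"
proof (rule bounded_linear_intro[of _ 1])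
  fix x
  have "T 0 = 0" using T_scale[of 0 0] by simp
  then have "norm (T x - T 0) \<le> norm x" unfolding T_def
    by (intro norm_solJ_diff_le ap_cont) (simp add: abs_ap_le)
  then show "norm (T x) \<le> norm x * 1" using \<open>T 0 = 0\<close> by simp
qed (rule T_add T_scale)+

lemma inner_T_self: "inner (T x) x = (L2_norm (ap x))\<^sup>2"
  unfolding inner_T L2_norm_def by (simp add: power2_eq_square[symmetric])

lemma inner_T_nonneg: "0 \<le> inner (T x) x" by (simp add: inner_T_self)

lemma L2_norm_nonneg [simp]: "0 \<le> L2_norm v" by (simp add: L2_norm_def)

lemma L2_norm_ap: "L2_norm (ap x) = sqrt (inner (T x) x)" by (simp add: inner_T_self)

lemma norm_T_le: "norm (T x) \<le> norm x"
proof -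
  have "T 0 = 0" using T_scale[of 0 0] by simp
  then have "norm (T x - T 0) \<le> norm x" unfolding T_def
    by (intro norm_solJ_diff_le ap_cont) (simp add: abs_ap_le)
  then show ?thesis using \<open>T 0 = 0\<close> by simp
qed

lemma L2_norm_ap_le: "L2_norm (ap x) \<le> norm x"
proof -
  have "inner (T x) x \<le> norm (T x) * norm x" by (rule norm_cauchy_schwarz)
  also have "\<dots> \<le> norm x * norm x" by (intro mult_right_mono norm_T_le) auto
  finally show ?thesis unfolding L2_norm_ap by (intro real_le_lsqrt) (auto simp: power2_eq_square)
qed

section \<open>Pointwise bounds for Green's function, and a convexity criterion\<close>

lemma G_nonneg: "t \<in> {0..1} \<Longrightarrow> s \<in> {0..1} \<Longrightarrow> 0 \<le> G t s"
  by (auto simp: G_def intro!: mult_nonneg_nonneg)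

lemma G_le_G1:
  assumes "t \<in> {0..1}" "s \<in> {0..1}" shows "G t s \<le> G 1 s"
proof (cases "s \<le> t")
  case True
  then show ?thesis using assms by (auto simp: G_def intro!: mult_left_mono)
next
  case False
  \<comment> \<open>The product equals 2 s^3 - t^2 (3 s - t). Writing 2 s^2 - t^2 as s^2 + (s^2 -
    t^2) shows the sign of the second factor.\<close>
  have "0 \<le> (s - t) * (s\<^sup>2 + (s\<^sup>2 - t\<^sup>2) + 2 * (s * t))"
    using False assms by (intro mult_nonneg_nonneg add_nonneg_nonneg) (auto simp: power2_eq_square intro: mult_mono)
  then have "t\<^sup>2 * (3 * s - t) \<le> 2 * s * s\<^sup>2" by (simp add: power2_eq_square algebra_simps)
  also have "\<dots> \<le> (3 - s) * s\<^sup>2" using assms by (intro mult_right_mono) auto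
  finally show ?thesis using False assms by (simp add: G_def field_simps)
qed

text \<open>The factor \<open>M\<close> comes from \<open>M t = 2 * G t 1\<close>; the bound \<open>r * (3 - r) \<le> 2\<close> on the unit
  interval makes the remaining inequality linear.\<close>

lemma M_G1_le_G:
  assumes t: "t \<in> {0..1}" and s: "s \<in> {0..1}" shows "M t * G 1 s \<le> G t s"
proof -
  have r: "r * (3 - r) \<le> 2" if "r \<in> {0..1}" for r :: real
  proof -
    have "0 \<le> (1 - r) * (2 - r)" using that by (intro mult_nonneg_nonneg) auto
    then show ?thesis by (simp add: algebra_simps)
  qed
  show ?thesis
  proof (cases "s \<le> t")
    case True
    have "(t * (3 - t)) * (t * (3 - s)) \<le> 2 * (t * (3 - s))" using r[OF t] s t by (intro mult_right_mono) auto
    also have "\<dots> \<le> 3 * (3 * t - s)"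
    proof -
      have "0 \<le> 3 * (t - s) + 2 * (t * s)" using True s t by auto
      then show ?thesis by (simp add: algebra_simps)
    qed
    finally have "s\<^sup>2 * ((t * (3 - t)) * (t * (3 - s))) \<le> s\<^sup>2 * (3 * (3 * t - s))" by (intro mult_left_mono) auto
    then show ?thesis using True s by (simp add: M_def G_def power2_eq_square field_simps)
  next
    case False
    have "(s * (3 - s)) * (s * (3 - t)) \<le> 2 * (s * (3 - t))" using r[OF s] s t by (intro mult_right_mono) auto
    also have "\<dots> \<le> 3 * (3 * s - t)"
    proof -
      have "0 \<le> 3 * (s - t) + 2 * (t * s)" using False s t by auto
      then show ?thesis by (simp add: algebra_simps)
    qed
    finally have "t\<^sup>2 * ((s * (3 - s)) * (s * (3 - t))) \<le> t\<^sup>2 * (3 * (3 * s - t))" by (intro mult_left_mono) auto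
    then show ?thesis using False s by (simp add: M_def G_def power2_eq_square field_simps)
  qed
qed

text \<open>The mean value theorem on the two sides of the intermediate point compares the slopes of
  the chords. Derivatives are taken within the closed interval, as functions on [0,1] provide
  them.\<close>

lemma convex_on_deriv_mono:
  fixes u :: "real \<Rightarrow> real"
  assumes d: "\<And>t. t \<in> {a..b} \<Longrightarrow> (u has_real_derivative u' t) (at t within {a..b})"
    and m: "\<And>s t. a \<le> s \<Longrightarrow> s \<le> t \<Longrightarrow> t \<le> b \<Longrightarrow> u' s \<le> u' t"
  shows "convex_on {a..b} u"
proof (rule convex_on_linorderI)
  fix t x y :: real
  assume t: "0 < t" "t < 1" and x: "x \<in> {a..b}" and y: "y \<in> {a..b}" and xy: "x < y"
  define z where "z = (1 - t) * x + t * y"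
  have zx: "z - x = t * (y - x)" and yz: "y - z = (1 - t) * (y - x)" by (auto simp: z_def algebra_simps)
  have "0 < z - x" "0 < y - z" unfolding zx yz using t xy by auto
  then have z: "x < z" "z < y" by auto
  have c: "continuous_on {p..q} u" if "p \<in> {a..b}" "q \<in> {a..b}" for p q
    using deriv_imp_continuous[OF d] by (rule continuous_on_subset) (use that in auto)
  have D: "(u has_real_derivative u' r) (at r)" if "a < r" "r < b" for r
    using d[of r] that by (simp add: at_within_Icc_at)
  have mv: "\<exists>r. p < r \<and> r < q \<and> u q - u p = u' r * (q - p)" if "p \<in> {a..b}" "q \<in> {a..b}" "p < q" for p q
  proof -
    have "(u has_derivative (\<lambda>h. u' r * h)) (at r)" if "p < r" "r < q" for r
      using D[of r] that \<open>p \<in> {a..b}\<close> \<open>q \<in> {a..b}\<close> by (auto simp: has_field_derivative_def)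
    from mvt[OF that(3) c[OF that(1,2)] this] show ?thesis by metis
  qed
  obtain p where p: "x < p" "p < z" "u z - u x = u' p * (z - x)" using mv[of x z] x y z by auto
  obtain q where q: "z < q" "q < y" "u y - u z = u' q * (y - z)" using mv[of z y] x y z by auto
  have "(1 - t) * (u z - u x) = (t * (1 - t) * (y - x)) * u' p" unfolding p(3) zx by simp
  also have "\<dots> \<le> (t * (1 - t) * (y - x)) * u' q"
    using m[of p q] p q x y t xy by (intro mult_left_mono) auto
  also have "\<dots> = t * (u y - u z)" unfolding q(3) yz by simp
  finally have "(1 - t) * (u z - u x) \<le> t * (u y - u z)" .
  then have "u z \<le> (1 - t) * u x + t * u y" by (simp add: algebra_simps)
  then show "u ((1 - t) *\<^sub>R x + t *\<^sub>R y) \<le> (1 - t) * u x + t * u y" by (simp add: z_def)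
qed simp

section \<open>The cone\<close>

abbreviation l2 :: "xs \<Rightarrow> real" where "l2 x \<equiv> L2_norm (ap x)"

lemma l2_sq: "(l2 x)\<^sup>2 = inner (T x) x" by (simp add: inner_T_self)

lemma l2_scale: "l2 (a *\<^sub>R x) = \<bar>a\<bar> * l2 x"
proof -
  have "(l2 (a *\<^sub>R x))\<^sup>2 = (\<bar>a\<bar> * l2 x)\<^sup>2"
    by (simp add: l2_sq T_scale power_mult_distrib power2_eq_square[of a])
  then show ?thesis by (rule power2_eq_imp_eq) auto
qed

lemma l2_minus [simp]: "l2 (- x) = l2 x" using l2_scale[of "-1" x] by simp

lemma T_minus [simp]: "T (- x) = - T x" using T_scale[of "-1" x] by simp

lemma l2_sq_add: "(l2 (x + y))\<^sup>2 = (l2 x)\<^sup>2 + 2 * inner (T x) y + (l2 y)\<^sup>2"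
  unfolding l2_sq T_add inner_add_left inner_add_right by (simp add: inner_T_commute[of y x])

text \<open>Cauchy-Schwarz for the form (T x, y), handled as a semidefinite form; hence the separate
  case in which one of the seminorms vanishes.\<close>

lemma inner_T_le: "inner (T x) y \<le> l2 x * l2 y"
proof (cases "l2 x = 0 \<or> l2 y = 0")
  case False
  let ?a = "l2 x" and ?b = "l2 y"
  have "0 \<le> (l2 (?b *\<^sub>R x + (- ?a) *\<^sub>R y))\<^sup>2" by simp
  also have "\<dots> = 2 * (?a * ?b) * (?a * ?b - inner (T x) y)"
    unfolding l2_sq_add by (simp add: l2_scale T_scale power_mult_distrib power2_eq_square algebra_simps)
  finally have "0 \<le> (?a * ?b) * (?a * ?b - inner (T x) y)" by simp
  moreover have "0 < ?a * ?b" using False by (metis L2_norm_nonneg mult_pos_pos order_le_less)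
  ultimately show ?thesis by (simp add: zero_le_mult_iff)
next
  case True
  have *: "inner (T x) y \<le> 0" if "l2 y = 0" for x y
  proof (rule ccontr)
    assume c: "\<not> inner (T x) y \<le> 0"
    \<comment> \<open>Since \<open>l2 y = 0\<close>, the square is affine in \<open>s\<close>; this
      \<open>s\<close> gives it the value -1.\<close>
    define s where "s = - (1 + (l2 x)\<^sup>2) / (2 * inner (T x) y)"
    have "0 \<le> (l2 (x + s *\<^sub>R y))\<^sup>2" by simp
    also have "\<dots> = (l2 x)\<^sup>2 + 2 * s * inner (T x) y" unfolding l2_sq_add using that by (simp add: l2_scale)
    also have "\<dots> = - 1" using c by (simp add: s_def field_simps)
    finally show False by simp
  qed
  show ?thesis using True *[of y x] *[of x y] by (auto simp: inner_T_commute[of y x])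
qed

lemma l2_triangle: "l2 (x + y) \<le> l2 x + l2 y"
proof (rule power2_le_imp_le)
  show "(l2 (x + y))\<^sup>2 \<le> (l2 x + l2 y)\<^sup>2"
    using inner_T_le[of x y] unfolding l2_sq_add by (simp add: power2_sum)
qed simp

lemma l2_lipschitz: "\<bar>l2 x - l2 y\<bar> \<le> norm (x - y)"
proof -
  have "l2 x \<le> l2 y + norm (x - y)" for x y
    using l2_triangle[of y "x - y"] L2_norm_ap_le[of "x - y"] by simp
  from this[of x y] this[of y x] show ?thesis by (simp add: abs_le_iff norm_minus_commute)
qed

lemma continuous_on_l2: "continuous_on S (\<lambda>x. l2 x)"
  unfolding continuous_on_iff dist_real_def dist_norm
  by (intro ballI allI impI exI conjI) (assumption, rule order_le_less_trans[OF l2_lipschitz])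

lemma continuous_on_T: "continuous_on S T"
  by (rule linear_continuous_on[OF bounded_linear_T])

lemma tendsto_ap: "(Y \<longlongrightarrow> x) net \<Longrightarrow> ((\<lambda>n. ap (Y n) t) \<longlongrightarrow> ap x t) net"
proof -
  assume "(Y \<longlongrightarrow> x) net"
  then have "((\<lambda>n. norm (Y n - x)) \<longlongrightarrow> 0) net" using LIM_zero tendsto_norm_zero by blast
  moreover have *: "norm (ap (Y n) t - ap x t) \<le> norm (Y n - x)" for n
    using abs_ap_le[of "Y n - x" t] by simp
  have "\<forall>\<^sub>F n in net. norm (ap (Y n) t - ap x t) \<le> norm (Y n - x)"
    by (rule always_eventually) (rule allI, rule *)
  ultimately have "((\<lambda>n. ap (Y n) t - ap x t) \<longlongrightarrow> 0) net"
    by (rule Lim_null_comparison[rotated])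
  then show ?thesis by (rule LIM_zero_cancel)
qed

lemma tendsto_l2: "(Y \<longlongrightarrow> x) net \<Longrightarrow> ((\<lambda>n. l2 (Y n)) \<longlongrightarrow> l2 x) net"
  using continuous_on_l2[of UNIV] by (intro isCont_tendsto_compose[where g = "\<lambda>x. l2 x"])
    (auto simp: continuous_on_eq_continuous_at)

definition Kcone :: "xs set" where "Kcone = {x. ap x \<in> K}"

lemma cone_iff: "x \<in> Kcone \<longleftrightarrow> convex_on {0..1} (ap x) \<and> (\<forall>t\<in>{0..1}. M t * l2 x \<le> ap x t)"
  unfolding Kcone_def K_def using ap_X by auto

lemma M_nonneg: "t \<in> {0..1} \<Longrightarrow> 0 \<le> M t" by (simp add: M_def)

lemma M_ge: "t \<in> {0..1} \<Longrightarrow> 2 / 3 * t\<^sup>2 \<le> M t"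
  unfolding M_def using mult_right_mono[of 2 "3 - t" "t\<^sup>2"] by simp

lemma cone_lower: "x \<in> Kcone \<Longrightarrow> t \<in> {0..1} \<Longrightarrow> M t * l2 x \<le> ap x t"
  by (simp add: cone_iff)

lemma cone_nonneg: "x \<in> Kcone \<Longrightarrow> 0 \<le> ap x t"
proof (cases "t \<in> {0..1}")
  case True
  assume "x \<in> Kcone"
  have "0 \<le> M t * l2 x" using M_nonneg[OF True] by simp
  also have "\<dots> \<le> ap x t" by (rule cone_lower[OF \<open>x \<in> Kcone\<close> True])
  finally show ?thesis .
qed (simp add: ap_outside)

lemma cone_add:
  assumes "x \<in> Kcone" "y \<in> Kcone" shows "x + y \<in> Kcone"
  unfolding cone_iff
proof
  have "ap (x + y) = (\<lambda>t. ap x t + ap y t)" by auto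
  then show "convex_on {0..1} (ap (x + y))"
    using assms by (simp add: cone_iff convex_on_add)
  show "\<forall>t\<in>{0..1}. M t * l2 (x + y) \<le> ap (x + y) t"
  proof
    fix t :: real assume t: "t \<in> {0..1}"
    have "M t * l2 (x + y) \<le> M t * (l2 x + l2 y)" by (intro mult_left_mono l2_triangle M_nonneg t)
    then show "M t * l2 (x + y) \<le> ap (x + y) t"
      using cone_lower[OF assms(1) t] cone_lower[OF assms(2) t] by (simp add: distrib_left)
  qed
qed

lemma cone_scale:
  assumes "x \<in> Kcone" "0 \<le> a" shows "a *\<^sub>R x \<in> Kcone"
  unfolding cone_iff
proof
  have "ap (a *\<^sub>R x) = (\<lambda>t. a * ap x t)" by auto
  then show "convex_on {0..1} (ap (a *\<^sub>R x))"
    using assms by (simp add: cone_iff convex_on_cmul)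
  show "\<forall>t\<in>{0..1}. M t * l2 (a *\<^sub>R x) \<le> ap (a *\<^sub>R x) t"
  proof
    fix t :: real assume t: "t \<in> {0..1}"
    show "M t * l2 (a *\<^sub>R x) \<le> ap (a *\<^sub>R x) t"
      using mult_left_mono[OF cone_lower[OF assms(1) t] assms(2)] assms(2) by (simp add: l2_scale mult.left_commute)
  qed
qed

text \<open>Convergence in X implies pointwise convergence and convergence of \<open>l2\<close>, and
  both cone conditions are inequalities between such quantities.\<close>

lemma closed_cone: "closed Kcone"
  unfolding closed_sequential_limits
proof (intro allI impI, elim conjE)
  fix Y x assume Y: "\<forall>n. Y n \<in> Kcone" and l: "Y \<longlonglongrightarrow> x"
  show "x \<in> Kcone" unfolding cone_iff
  proof
    show "convex_on {0..1} (ap x)"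
    proof (rule convex_onI)
      fix t r s :: real assume a: "0 < t" "t < 1" "r \<in> {0..1}" "s \<in> {0..1}"
      have "ap (Y n) ((1 - t) *\<^sub>R r + t *\<^sub>R s) \<le> (1 - t) * ap (Y n) r + t * ap (Y n) s" for n
        using Y a convex_onD[of "{0..1}" "ap (Y n)" t r s] by (auto simp: cone_iff)
      moreover have "(\<lambda>n. (1 - t) * ap (Y n) r + t * ap (Y n) s) \<longlonglongrightarrow> (1 - t) * ap x r + t * ap x s"
        by (intro tendsto_intros tendsto_ap[OF l])
      ultimately show "ap x ((1 - t) *\<^sub>R r + t *\<^sub>R s) \<le> (1 - t) * ap x r + t * ap x s"
        using LIMSEQ_le[OF tendsto_ap[OF l]] by blast
    qed simp
    show "\<forall>t\<in>{0..1}. M t * l2 x \<le> ap x t"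
    proof
      fix t :: real assume "t \<in> {0..1}"
      then show "M t * l2 x \<le> ap x t"
        using Y cone_lower
        by (intro LIMSEQ_le[OF tendsto_mult[OF tendsto_const tendsto_l2[OF l]] tendsto_ap[OF l]]) auto
    qed
  qed
qed

lemma l2_mono:
  assumes "\<And>t. t \<in> {0..1} \<Longrightarrow> 0 \<le> ap x t" "\<And>t. t \<in> {0..1} \<Longrightarrow> ap x t \<le> ap y t"
  shows "l2 x \<le> l2 y"
  unfolding L2_norm_def
  by (intro real_sqrt_le_mono integral_leb01_mono power_mono assms continuous_imp_integrable_leb01
      continuous_on_power ap_cont)

lemma inner_T_cone_nonneg: "x \<in> Kcone \<Longrightarrow> y \<in> Kcone \<Longrightarrow> 0 \<le> inner (T x) y"
  unfolding inner_T by (rule Bochner_Integration.integral_nonneg) (auto intro: mult_nonneg_nonneg cone_nonneg)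

lemma G_cont: "continuous_on {0..1} (G t)"
proof -
  have "G t = (\<lambda>s. (min s t)\<^sup>2 / 6 * (3 * max s t - min s t))"
    by (auto simp: G_def min_def max_def)
  then show ?thesis by (simp only:) (intro continuous_intros, auto)
qed

lemma convex_on_eq:
  "convex_on S f \<Longrightarrow> (\<And>x. x \<in> S \<Longrightarrow> f x = g x) \<Longrightarrow> convex_on S g"
  by (rule convex_onI) (metis convex_on_def convex_onD convexD_alt order_less_imp_le, metis convex_on_def)

lemma J_mono:
  assumes "continuous_on {0..1} v" "continuous_on {0..1} w" "\<And>s. s \<in> {0..1} \<Longrightarrow> v s \<le> w s" "t \<in> {0..1}"
  shows "J v t \<le> J w t"
  unfolding J_def using assms G_cont G_nonneg
  by (intro integral_leb01_mono continuous_imp_integrable_leb01 continuous_intros mult_left_mono) auto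

lemma J_lin:
  assumes "continuous_on {0..1} v" "continuous_on {0..1} w"
  shows "J (\<lambda>s. a * v s + b * w s) t = a * J v t + b * J w t"
proof -
  have "J (\<lambda>s. a * v s + b * w s) t = (LINT s|leb01. a * (G t s * v s) + b * (G t s * w s))"
    unfolding J_def by (rule integral_leb01_cong) (simp add: algebra_simps)
  also have "\<dots> = a * J v t + b * J w t"
    unfolding J_def using assms G_cont
    by (subst Bochner_Integration.integral_add) (auto intro!: continuous_imp_integrable_leb01 continuous_intros)
  finally show ?thesis .
qed

text \<open>Convexity: the second derivative at t is the integral of (s - t) v(s) over [t, 1]. Lower
  bound: \<open>J v\<close> is largest at 1, so its L2 norm is at most \<open>J v 1\<close>, and the
  kernel inequality \<open>M_G1_le_G\<close> gives \<open>M t * J v 1 \<le> J v t\<close>.\<close>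

lemma cone_solJ:
  assumes v: "continuous_on {0..1} v" and nn: "\<And>t. t \<in> {0..1} \<Longrightarrow> 0 \<le> v t"
  shows "solJ v \<in> Kcone"
  unfolding cone_iff
proof
  have ge: "0 \<le> J2 v t" if t: "t \<in> {0..1}" for t
  proof -
    have c: "continuous_on {0..1} (\<lambda>s. s * v s)" using v by (intro continuous_intros)
    have i: "(\<lambda>s. s * v s) integrable_on {t..1}" "v integrable_on {t..1}"
      using t v c by (auto intro!: integrable_on_sub)
    have "J2 v t = integral {t..1} (\<lambda>s. s * v s) - t * integral {t..1} v"
      unfolding J2_def using prim_diff[of "\<lambda>s. s * v s" t 1] prim_diff[of v t 1] v c t
      by (auto simp: continuous_imp_integrable_leb01)
    also have "\<dots> = integral {t..1} (\<lambda>s. s * v s - t * v s)"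
      using i by (simp add: Henstock_Kurzweil_Integration.integral_diff integrable_on_mult_right)
    also have "\<dots> \<ge> 0"
      using t nn by (intro Henstock_Kurzweil_Integration.integral_nonneg integrable_diff integrable_on_mult_right i)
        (auto intro: mult_right_mono)
    finally show ?thesis .
  qed
  have mono: "J1 v s \<le> J1 v t" if "0 \<le> s" "s \<le> t" "t \<le> 1" for s t
  proof (rule DERIV_nonneg_imp_increasing_open[OF that(2)])
    show "continuous_on {s..t} (J1 v)"
      using deriv_imp_continuous[OF J_deriv(2)[OF v]] by (rule continuous_on_subset) (use that in auto)
    fix r assume r: "s < r" "r < t"
    then have "(J1 v has_real_derivative J2 v r) (at r)"
      using J_deriv(2)[OF v, of r] that by (simp add: at_within_Icc_at)
    then show "\<exists>y. (J1 v has_real_derivative y) (at r) \<and> 0 \<le> y" using ge[of r] r that by auto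
  qed
  have "convex_on {0..1} (J v)"
    using J_deriv(1)[OF v] mono by (rule convex_on_deriv_mono)
  then show "convex_on {0..1} (ap (solJ v))"
    by (rule convex_on_eq) (simp add: ap_solJ[OF v])
  have J_le: "J v t \<le> J v 1" and J_ge: "M t * J v 1 \<le> J v t" and J_nn: "0 \<le> J v t" if t: "t \<in> {0..1}" for t
  proof -
    have i: "integrable leb01 (\<lambda>s. G t s * v s)" "integrable leb01 (\<lambda>s. G 1 s * v s)"
      using v G_cont by (auto intro!: continuous_imp_integrable_leb01 continuous_intros)
    show "J v t \<le> J v 1" unfolding J_def
      using i nn t by (intro integral_leb01_mono mult_right_mono G_le_G1) auto
    have "M t * J v 1 = (LINT s|leb01. M t * (G 1 s * v s))" by (simp add: J_def)
    also have "\<dots> \<le> J v t" unfolding J_def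
      using i nn t mult_right_mono[OF M_G1_le_G[OF t]] by (intro integral_leb01_mono) (auto simp: mult.assoc)
    finally show "M t * J v 1 \<le> J v t" .
    show "0 \<le> J v t" unfolding J_def using nn t G_nonneg by (intro Bochner_Integration.integral_nonneg) auto
  qed
  have "l2 (solJ v) \<le> J v 1"
  proof -
    have "(l2 (solJ v))\<^sup>2 = (LINT t|leb01. (ap (solJ v) t)\<^sup>2)"
      by (simp add: L2_norm_def)
    also have "\<dots> \<le> (LINT t|leb01. (J v 1)\<^sup>2)"
    proof (rule integral_leb01_mono)
      show "integrable leb01 (\<lambda>t. (ap (solJ v) t)\<^sup>2)"
        by (intro continuous_imp_integrable_leb01 continuous_on_power ap_cont)
      show "(ap (solJ v) t)\<^sup>2 \<le> (J v 1)\<^sup>2" if "t \<in> {0..1}" for t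
        unfolding ap_solJ[OF v that] using J_le[OF that] J_nn[OF that] by (rule power_mono)
    qed simp
    finally have "(l2 (solJ v))\<^sup>2 \<le> (J v 1)\<^sup>2" by simp
    then show ?thesis by (rule power2_le_imp_le) (rule J_nn, simp)
  qed
  then have "M t * l2 (solJ v) \<le> ap (solJ v) t" if t: "t \<in> {0..1}" for t
    using J_ge[OF t] mult_left_mono[OF _ M_nonneg[OF t], of "l2 (solJ v)" "J v 1"]
    unfolding ap_solJ[OF v t] by linarith
  then show "\<forall>t\<in>{0..1}. M t * l2 (solJ v) \<le> ap (solJ v) t" by blast
qed

lemma T_cone: "x \<in> Kcone \<Longrightarrow> T x \<in> Kcone"
  unfolding T_def by (intro cone_solJ ap_cont cone_nonneg)

section \<open>Compactness, small cone elements of large norm, and extremality of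
  eigenfunctions\<close>

text \<open>Arzela-Ascoli with the common Lipschitz constant given by the norm bound. The limit is
  claimed only as a continuous function; \<open>solJ\<close> accepts it in this form.\<close>

lemma uniform_limit_subsequence:
  fixes Y :: "nat \<Rightarrow> xs"
  assumes "\<And>n. norm (Y n) \<le> R"
  obtains g r where "continuous_on {0..1} g" "strict_mono (r :: nat \<Rightarrow> nat)"
    "\<And>e. 0 < e \<Longrightarrow> \<exists>N. \<forall>n\<ge>N. \<forall>t\<in>{0..1}. \<bar>ap (Y (r n)) t - g t\<bar> < e"
proof -
  have b: "norm (ap (Y n) t) \<le> R" for n t using abs_ap_le[of "Y n" t] assms[of n] by simp
  have eq: "\<exists>d. 0 < d \<and> (\<forall>n y. y \<in> {0..1} \<and> norm (x - y) < d \<longrightarrow> norm (ap (Y n) x - ap (Y n) y) < e)"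
    if x: "x \<in> {0..1}" and e: "0 < e" for x e :: real
  proof -
    have R: "0 \<le> R" using assms[of 0] norm_ge_zero order_trans by blast
  have "norm (ap (Y n) x - ap (Y n) y) < e" if "y \<in> {0..1}" "norm (x - y) < e / (R + 1)" for n y
  proof -
    have "norm (ap (Y n) x - ap (Y n) y) \<le> norm (Y n) * \<bar>x - y\<bar>"
      using ap_lipschitz[OF that(1) x] by simp
    also have "\<dots> \<le> (R + 1) * \<bar>x - y\<bar>" using assms[of n] by (intro mult_right_mono) auto
    also have "\<dots> < e" using that(2) R by (simp add: field_simps)
    finally show ?thesis .
  qed
  moreover have "0 < e / (R + 1)" using e R by simp
  ultimately show "\<exists>d. 0 < d \<and> (\<forall>n y. y \<in> {0..1} \<and> norm (x - y) < d \<longrightarrow> norm (ap (Y n) x - ap (Y n) y) < e)"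
    by blast
  qed
  obtain g r where "continuous_on {0..1} g" "strict_mono (r :: nat \<Rightarrow> nat)"
    "\<And>e. 0 < e \<Longrightarrow> \<exists>N. \<forall>n x. n \<ge> N \<and> x \<in> {0..1} \<longrightarrow> norm (ap (Y (r n)) x - g x) < e"
    using Arzela_Ascoli[OF compact_Icc b eq] by blast
  note gr = this
  have "\<exists>N. \<forall>n\<ge>N. \<forall>t\<in>{0..1}. \<bar>ap (Y (r n)) t - g t\<bar> < e" if "0 < e" for e
    using gr(3)[OF that] by (metis real_norm_def)
  then show ?thesis by (rule that[OF gr(1,2)])
qed

lemma integral_leb01_power: "(LINT t|leb01. real (Suc n) * t ^ n) = (1 :: real)"
proof -
  have c: "continuous_on {0..1} (\<lambda>t. real (Suc n) * t ^ n :: real)" by (intro continuous_intros)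
  have "((\<lambda>t. t ^ Suc n) has_real_derivative real (Suc n) * t ^ n) (at t within {0..1})" for t :: real
    using DERIV_pow[of "Suc n" t] by (auto intro: has_field_derivative_at_within)
  then have "prim (\<lambda>t. real (Suc n) * t ^ n) 1 = (1::real)"
    using prim_deriv[OF c, of "\<lambda>t. t ^ Suc n" 1] by simp
  then show ?thesis using integral_leb01_eq[OF continuous_imp_integrable_leb01[OF c]] by (simp add: prim_def)
qed

text \<open>\<open>\<sigma> * (t\<^sup>2 + t ^ p)\<close> stays bounded by \<open>2 * \<sigma>\<close> while its second derivative blows up at \<open>1\<close> as
  \<open>p\<close> grows; the summand \<open>t\<^sup>2\<close> keeps it in the cone.\<close>

lemma small_large_cone:
  assumes \<sigma>: "0 < \<sigma>"
  obtains z where "z \<in> Kcone" "\<And>t. \<bar>ap z t\<bar> \<le> 2 * \<sigma>" "L \<le> norm z" "l2 z \<le> \<sigma>"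
proof -
  \<comment> \<open>The squared norm of \<open>z\<close> will be at least \<sigma>^2 n / 2, and this
    \<open>n\<close> lifts it above L^2.\<close>
  obtain n :: nat where n: "2 * (L / \<sigma>)\<^sup>2 < real n" using reals_Archimedean2 by blast
  define u where "u t = \<sigma> * (t\<^sup>2 + t ^ (n + 2))" for t :: real
  define u' where "u' t = \<sigma> * (2 * t + real (n + 2) * t ^ (n + 1))" for t :: real
  define g where "g t = \<sigma> * (2 + real (n + 2) * (real (n + 1) * t ^ n))" for t :: real
  have gc: "continuous_on {0..1} g" unfolding g_def by (intro continuous_intros)
  have du: "(u has_real_derivative u' t) (at t within {0..1})" for t
    unfolding u_def u'_def by (rule derivative_eq_intros refl | simp)+
  have du': "(u' has_real_derivative g t) (at t within {0..1})" for t
    unfolding u'_def g_def by (rule derivative_eq_intros refl | simp)+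
  define z where "z = mk (\<lambda>t. if t \<in> {0..1} then u t else 0)"
  have z: "ap z t = u t" if "t \<in> {0..1}" for t
    unfolding z_def by (rule ap_mk_C2(1)[OF gc du' du _ _ that]) (auto simp: u_def u'_def)
  have d2z: "AE t in leb01. d2 (ap z) t = g t"
    unfolding z_def by (rule ap_mk_C2(2)[OF gc du' du]) (auto simp: u_def u'_def)
  have le: "u t \<le> 2 * \<sigma> * t\<^sup>2" "\<sigma> * t\<^sup>2 \<le> u t" if "t \<in> {0..1}" for t
  proof -
    have "t ^ (n + 2) \<le> t\<^sup>2" using that by (intro power_decreasing) auto
    then have "\<sigma> * (t\<^sup>2 + t ^ (n + 2)) \<le> \<sigma> * (t\<^sup>2 + t\<^sup>2)" using \<sigma> by (intro mult_left_mono) auto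
    then show "u t \<le> 2 * \<sigma> * t\<^sup>2" by (simp add: u_def)
    show "\<sigma> * t\<^sup>2 \<le> u t" unfolding u_def using \<sigma> that by (intro mult_left_mono) auto
  qed
  have bound: "\<bar>ap z t\<bar> \<le> 2 * \<sigma>" for t
  proof (cases "t \<in> {0..1}")
    case True
    have "0 \<le> \<sigma> * t\<^sup>2" using \<sigma> by simp
    moreover have "2 * \<sigma> * t\<^sup>2 \<le> 2 * \<sigma> * 1"
      using \<sigma> True by (intro mult_left_mono) (auto simp: power_le_one)
    ultimately show ?thesis using le[OF True] z[OF True] by simp
  qed (use \<sigma> in \<open>simp add: ap_outside\<close>)
  have l2z: "l2 z \<le> \<sigma>"
  proof -
    \<comment> \<open>The bound u <= 2 \<sigma> t^2 gives (l2 z)^2 <= 4/5 \<sigma>^2, below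
      \<sigma>^2. Together with u >= \<sigma> t^2 and M t <= t^2 this yields the cone
      inequality.\<close>
    have i5: "(LINT t|leb01. 5 * t ^ 4) = (1 :: real)" using integral_leb01_power[of 4] by simp
    have "(l2 z)\<^sup>2 = (LINT t|leb01. (ap z t)\<^sup>2)" by (simp add: L2_norm_def)
    also have "\<dots> \<le> (LINT t|leb01. (4 / 5 * \<sigma>\<^sup>2) * (5 * t ^ 4))"
    proof (rule integral_leb01_mono)
      show "integrable leb01 (\<lambda>t. (ap z t)\<^sup>2)"
        by (intro continuous_imp_integrable_leb01 continuous_on_power ap_cont)
      show "integrable leb01 (\<lambda>t. (4 / 5 * \<sigma>\<^sup>2) * (5 * t ^ 4))"
        by (intro continuous_imp_integrable_leb01 continuous_intros)
      fix t :: real assume t: "t \<in> {0..1}"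
      have "0 \<le> ap z t" using order_trans[OF _ le(2)[OF t]] \<sigma> z[OF t] by simp
      then have "(ap z t)\<^sup>2 \<le> (2 * \<sigma> * t\<^sup>2)\<^sup>2" using le(1)[OF t] z[OF t] by (intro power_mono) auto
      then show "(ap z t)\<^sup>2 \<le> (4 / 5 * \<sigma>\<^sup>2) * (5 * t ^ 4)" by (simp add: power_mult_distrib flip: power_mult)
    qed
    also have "\<dots> = 4 / 5 * \<sigma>\<^sup>2" using i5 by simp
    also have "\<dots> \<le> \<sigma>\<^sup>2" by simp
    finally have "(l2 z)\<^sup>2 \<le> \<sigma>\<^sup>2" .
    then show ?thesis by (rule power2_le_imp_le) (use \<sigma> in simp)
  qed
  have "z \<in> Kcone" unfolding cone_iff
  proof
    have "convex_on {0..1} u"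
    proof (rule convex_on_deriv_mono[OF du])
      fix s t :: real assume "0 \<le> s" "s \<le> t" "t \<le> 1"
      then show "u' s \<le> u' t" unfolding u'_def using \<sigma>
        by (intro mult_left_mono add_mono power_mono) auto
    qed
    then show "convex_on {0..1} (ap z)" by (rule convex_on_eq) (simp add: z)
    show "\<forall>t\<in>{0..1}. M t * l2 z \<le> ap z t"
    proof
      fix t :: real assume t: "t \<in> {0..1}"
      have "M t \<le> t\<^sup>2" unfolding M_def using t mult_right_mono[of "3 - t" 3 "t\<^sup>2"] by simp
      then have "M t * l2 z \<le> t\<^sup>2 * \<sigma>" using l2z \<sigma> M_nonneg[OF t] by (intro mult_mono) auto
      then show "M t * l2 z \<le> ap z t" using le(2)[OF t] z[OF t] by (simp add: mult.commute)
    qed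
  qed
  moreover have "L \<le> norm z"
  proof (rule power2_le_imp_le)
    \<comment> \<open>The second derivative is at least \<sigma> (n + 1)^2 t^n, whose square
      integrates to \<sigma>^2 (n + 1)^4 / (2 n + 1).\<close>
    have i1: "(LINT t|leb01. real (2 * n + 1) * t ^ (2 * n)) = (1::real)"
      using integral_leb01_power[of "2 * n"] by simp
    have "L\<^sup>2 \<le> \<sigma>\<^sup>2 * (real n / 2)"
      using n \<sigma> by (simp add: power_divide field_simps)
    also have "\<dots> \<le> \<sigma>\<^sup>2 * (real (n + 1) ^ 4 / real (2 * n + 1))"
    proof (intro mult_left_mono)
      have a: "real n * real (2 * n + 1) \<le> real (n + 1) * (2 * real (n + 1))" by (intro mult_mono) auto
      have "real (n + 1) ^ 2 \<le> real (n + 1) ^ 4" by (intro power_increasing) auto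
      then have "real n * real (2 * n + 1) \<le> 2 * real (n + 1) ^ 4"
        using a by (simp only: power2_eq_square)
      then show "real n / 2 \<le> real (n + 1) ^ 4 / real (2 * n + 1)" by (simp add: field_simps)
    qed simp
    also have "\<dots> = (LINT t|leb01. (\<sigma>\<^sup>2 * (real (n + 1) ^ 4 / real (2 * n + 1))) * (real (2 * n + 1) * t ^ (2 * n)))"
      by (subst integral_mult_right_zero) (simp only: i1 mult_1_right)
    also have "\<dots> \<le> (LINT t|leb01. (g t)\<^sup>2)"
    proof (rule integral_leb01_mono)
      show "integrable leb01 (\<lambda>t. (g t)\<^sup>2)" using gc by (intro continuous_imp_integrable_leb01 continuous_on_power)
      show "integrable leb01 (\<lambda>t. (\<sigma>\<^sup>2 * (real (n + 1) ^ 4 / real (2 * n + 1))) * (real (2 * n + 1) * t ^ (2 * n)))"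
        by (intro continuous_imp_integrable_leb01 continuous_intros)
      fix t :: real assume t: "t \<in> {0..1}"
      have "real (n + 1) * (real (n + 1) * t ^ n) \<le> real (n + 2) * (real (n + 1) * t ^ n)"
        using t by (intro mult_right_mono) auto
      then have "\<sigma> * (real (n + 1) * (real (n + 1) * t ^ n)) \<le> g t"
        unfolding g_def using \<sigma> by (intro mult_left_mono) linarith+
      then have "(\<sigma> * (real (n + 1) * (real (n + 1) * t ^ n)))\<^sup>2 \<le> (g t)\<^sup>2"
        using \<sigma> t by (intro power_mono) auto
      moreover have "(\<sigma>\<^sup>2 * (real (n + 1) ^ 4 / real (2 * n + 1))) * (real (2 * n + 1) * t ^ (2 * n))
          = (\<sigma> * (real (n + 1) * (real (n + 1) * t ^ n)))\<^sup>2"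
        by (simp add: power_mult_distrib power4_eq_xxxx power_even_eq power2_eq_square)
      ultimately show "(\<sigma>\<^sup>2 * (real (n + 1) ^ 4 / real (2 * n + 1))) * (real (2 * n + 1) * t ^ (2 * n)) \<le> (g t)\<^sup>2"
        by simp
    qed
    also have "\<dots> = (L2_norm g)\<^sup>2" by (simp add: L2_norm_def)
    also have "L2_norm g = norm z"
      using L2_norm_cong_AE[OF d2z d2_L2 continuous_imp_L2[OF gc]] norm_eq_L2_norm by simp
    finally show "L\<^sup>2 \<le> (norm z)\<^sup>2" .
  qed simp
  ultimately show ?thesis using that bound l2z by blast
qed

text \<open>A positive eigenfunction \<open>u\<close> of \<open>T\<close> realises the norm of \<open>T\<close>.  With \<open>q = x\<^sup>2 / u\<close> one has
  \<open>2 * x t * x s \<le> q t * u s + q s * u t\<close>; this is integrated against the symmetric kernel \<open>G\<close>.\<close>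

lemma positive_eigenfunction_extremal:
  assumes u: "u \<in> Kcone" "0 < l2 u" and eig: "u = \<mu> *\<^sub>R T u"
    and x: "\<And>t. t \<in> {0..1} \<Longrightarrow> \<bar>ap x t\<bar> \<le> C * t\<^sup>2"
  shows "\<mu> * (l2 x)\<^sup>2 \<le> (norm x)\<^sup>2"
proof -
  have \<mu>: "0 < \<mu>"
  proof -
    have "inner (T u) u = \<mu> * inner (T u) (T u)" using eig by (metis inner_scaleR_right)
    then have "0 < \<mu> * inner (T u) (T u)" using u(2) l2_sq[of u] by (metis zero_less_power)
    then show ?thesis by (metis inner_ge_zero zero_less_mult_pos2 order_le_less mult_zero_right order_less_irrefl)
  qed
  have lower: "2 / 3 * l2 u * t\<^sup>2 \<le> ap u t" if "t \<in> {0..1}" for t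
    using cone_lower[OF u(1) that] mult_right_mono[OF M_ge[OF that], of "l2 u"] by (simp add: mult_ac)
  have pos: "0 < ap u t" if "t \<in> {0<..1}" for t
  proof -
    have "0 < 2 / 3 * l2 u * t\<^sup>2" using that u(2) by simp
    also have "\<dots> \<le> ap u t" using lower[of t] that by simp
    finally show ?thesis .
  qed
  \<comment> \<open>Near 0 the numerator is at most C^2 t^4 and the denominator at least a multiple
    of t^2, so \<open>q\<close> is continuous there with value 0. This is what the growth bound on
    \<open>x\<close> provides.\<close>
  define q where "q t = (if t = 0 then 0 else (ap x t)\<^sup>2 / ap u t)" for t
  have qu: "q t * ap u t = (ap x t)\<^sup>2" if "t \<in> {0..1}" for t
    using pos[of t] that by (auto simp: q_def)
  define C' where "C' = C\<^sup>2 / (2 / 3 * l2 u)"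
  have q_le: "\<bar>q t\<bar> \<le> C' * t\<^sup>2" if "t \<in> {0..1}" for t
  proof (cases "t = 0")
    case False
    then have t: "t \<in> {0<..1}" using that by auto
    have "(ap x t)\<^sup>2 \<le> (C * t\<^sup>2)\<^sup>2" using x[OF that] by (rule abs_le_square_iff[THEN iffD1, OF order_trans]) simp
    then have "(ap x t)\<^sup>2 / ap u t \<le> (C * t\<^sup>2)\<^sup>2 / (2 / 3 * l2 u * t\<^sup>2)"
      using lower[OF that] u(2) t by (intro frac_le) auto
    also have "\<dots> = C' * t\<^sup>2" using t by (simp add: C'_def power_mult_distrib power2_eq_square field_simps)
    finally show ?thesis using False pos[OF t] by (simp add: q_def)
  qed (simp add: q_def)
  have qc: "continuous_on {0..1} q"
    unfolding continuous_on_eq_continuous_within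
  proof
    fix t :: real assume t: "t \<in> {0..1}"
    show "continuous (at t within {0..1}) q"
    proof (cases "t = 0")
      case True
      have "((\<lambda>t. C' * t\<^sup>2) \<longlongrightarrow> C' * 0\<^sup>2) (at 0 within {0..1})" by (intro tendsto_intros)
      then have l: "((\<lambda>t. C' * t\<^sup>2) \<longlongrightarrow> 0) (at 0 within {0..1})" by simp
      have "\<forall>\<^sub>F t in at 0 within {0..1}. norm (q t) \<le> C' * t\<^sup>2"
        unfolding eventually_at_filter using q_le by (intro always_eventually) auto
      from Lim_null_comparison[OF this l] have "(q \<longlongrightarrow> 0) (at 0 within {0..1})" .
      moreover have "q 0 = 0" by (simp add: q_def)
      ultimately have "(q \<longlongrightarrow> q 0) (at 0 within {0..1})" by simp
      then show ?thesis using True by (simp add: continuous_within)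
    next
      case False
      then have t0: "t \<in> {0<..1}" using t by auto
      have c: "continuous (at t within {0..1}) (ap x)" "continuous (at t within {0..1}) (ap u)"
        using ap_cont t by (auto simp: continuous_on_eq_continuous_within)
      have "continuous (at t within {0..1}) (\<lambda>t. (ap x t)\<^sup>2 / ap u t)"
        using pos[OF t0] by (intro continuous_intros c) auto
      then show ?thesis
        by (rule continuous_transform_within[where \<delta> = t]) (use t0 in \<open>auto simp: q_def dist_real_def\<close>)
    qed
  qed
  have amgm: "2 * (ap x t * ap x s) \<le> q t * ap u s + ap u t * q s" if "t \<in> {0..1}" "s \<in> {0..1}" for s t
  proof (cases "t = 0 \<or> s = 0")
    case False
    then have p: "0 < ap u t" "0 < ap u s" using pos that by auto
    have "0 \<le> (ap x t * ap u s - ap x s * ap u t)\<^sup>2 / (ap u t * ap u s)" using p by simp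
    also have "\<dots> = q t * ap u s + ap u t * q s - 2 * (ap x t * ap x s)"
      using p False by (simp add: q_def power2_eq_square field_simps)
    finally show ?thesis by simp
  qed (auto simp: q_def)
  have pw: "2 * (ap x t * ap (T x) t) \<le> q t * ap (T u) t + ap u t * ap (solJ q) t" if t: "t \<in> {0..1}" for t
  proof -
    have "J (\<lambda>s. (2 * ap x t) * ap x s + 0 * ap x s) t \<le> J (\<lambda>s. q t * ap u s + ap u t * q s) t"
      using amgm[OF t] t by (intro J_mono continuous_intros ap_cont qc) (auto simp: mult.assoc)
    then show ?thesis
      unfolding J_lin[OF ap_cont ap_cont] J_lin[OF ap_cont qc] T_def ap_solJ[OF ap_cont t] ap_solJ[OF qc t]
      by (simp add: mult.assoc)
  qed
  have "2 * inner (T x) (T x) = (LINT t|leb01. 2 * (ap x t * ap (T x) t))"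
    by (simp add: inner_T)
  also have "\<dots> \<le> (LINT t|leb01. q t * ap (T u) t + ap u t * ap (solJ q) t)"
    using pw by (intro integral_leb01_mono continuous_imp_integrable_leb01 continuous_intros ap_cont qc) auto
  also have "\<dots> = (LINT t|leb01. q t * ap (T u) t) + (LINT t|leb01. ap u t * ap (solJ q) t)"
    by (intro Bochner_Integration.integral_add continuous_imp_integrable_leb01 continuous_intros ap_cont qc)
  also have "\<dots> = 2 * (LINT t|leb01. q t * ap (T u) t)"
    unfolding inner_solJ[OF qc, symmetric] inner_T[symmetric] by (simp add: inner_commute)
  finally have "inner (T x) (T x) \<le> (LINT t|leb01. q t * ap (T u) t)" by simp
  then have "\<mu> * inner (T x) (T x) \<le> \<mu> * (LINT t|leb01. q t * ap (T u) t)"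
    using \<mu> by (intro mult_left_mono) auto
  also have "\<dots> = (LINT t|leb01. q t * ap u t)"
  proof -
    have "ap u t = \<mu> * ap (T u) t" for t using eig by (metis ap_scale)
    then show ?thesis by (simp add: mult.left_commute)
  qed
  also have "\<dots> = (LINT t|leb01. (ap x t)\<^sup>2)" by (rule integral_leb01_cong) (rule qu)
  also have "\<dots> = (l2 x)\<^sup>2" by (simp add: L2_norm_def)
  finally have main: "\<mu> * (norm (T x))\<^sup>2 \<le> (l2 x)\<^sup>2" by (simp add: dot_square_norm)
  show ?thesis
  proof (cases "l2 x = 0")
    case False
    then have l: "0 < (l2 x)\<^sup>2" by simp
    \<comment> \<open>Return from \<open>T x\<close> to \<open>x\<close>: Cauchy-Schwarz for (T x,
      x) is squared and combined with \<open>main\<close>, and one factor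
      \<open>(l2 x)\<^sup>2\<close> cancels.\<close>
    have "(l2 x)\<^sup>2 \<le> norm (T x) * norm x" unfolding l2_sq by (rule norm_cauchy_schwarz)
    then have "((l2 x)\<^sup>2)\<^sup>2 \<le> (norm (T x) * norm x)\<^sup>2" by (intro power_mono) auto
    then have "\<mu> * ((l2 x)\<^sup>2 * (l2 x)\<^sup>2) \<le> \<mu> * ((norm (T x))\<^sup>2 * (norm x)\<^sup>2)"
      using \<mu> by (intro mult_left_mono) (auto simp: power_mult_distrib power2_eq_square[of "(l2 x)\<^sup>2"])
    also have "\<dots> = (\<mu> * (norm (T x))\<^sup>2) * (norm x)\<^sup>2" by simp
    also have "\<dots> \<le> (l2 x)\<^sup>2 * (norm x)\<^sup>2" by (intro mult_right_mono main) simp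
    finally have "(l2 x)\<^sup>2 * (\<mu> * (l2 x)\<^sup>2) \<le> (l2 x)\<^sup>2 * (norm x)\<^sup>2" by (simp add: mult_ac)
    then show ?thesis using l by (simp add: mult_le_cancel_left)
  qed simp
qed

text \<open>\<open>phi\<close> is given by a formula on the whole line; its truncation lies in X.
  The bound \<open>norm x \<le> 1\<close>, rather than an equality, also covers a division by
  \<open>X_norm phi1 = 0\<close>. The quadratic estimate at 0 is the growth condition of
  \<open>positive_eigenfunction_extremal\<close>.\<close>

lemma phi_representation:
  obtains x C where "norm x \<le> 1" "L2_norm phi = l2 x" "\<And>t. t \<in> {0..1} \<Longrightarrow> \<bar>ap x t\<bar> \<le> C * t\<^sup>2"
proof -
  define k where "k = (sinh beta + sin beta) / (cosh beta + cos beta)"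
  define u' where "u' t = beta * (cos (beta * t) - cosh (beta * t) + k * (sinh (beta * t) + sin (beta * t)))" for t
  define g where "g t = beta\<^sup>2 * (- sin (beta * t) - sinh (beta * t) + k * (cosh (beta * t) + cos (beta * t)))" for t
  have phi1: "phi1 = (\<lambda>t. sin (beta * t) - sinh (beta * t) + k * (cosh (beta * t) - cos (beta * t)))"
    by (auto simp: phi1_def k_def)
  have gc: "continuous_on {0..1} g" unfolding g_def by (intro continuous_intros)
  have du: "(phi1 has_real_derivative u' t) (at t within {0..1})" for t
    unfolding phi1 u'_def by (auto intro!: derivative_eq_intros simp: algebra_simps)
  have du': "(u' has_real_derivative g t) (at t within {0..1})" for t
    unfolding u'_def g_def by (auto intro!: derivative_eq_intros simp: algebra_simps power2_eq_square)
  have z: "phi1 0 = 0" "u' 0 = 0" by (auto simp: phi1 u'_def)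
  define y where "y = mk (\<lambda>t. if t \<in> {0..1} then phi1 t else 0)"
  have y: "ap y t = phi1 t" if "t \<in> {0..1}" for t
    unfolding y_def by (rule ap_mk_C2(1)[OF gc du' du z that])
  have "AE t in leb01. d2 (ap y) t = d2 phi1 t"
    using ap_mk_C2(2)[OF gc du' du z] ap_mk_C2(3)[OF gc du' du z] unfolding y_def
    by eventually_elim simp
  then have ny: "norm y = X_norm phi1"
    using L2_norm_cong_AE[OF _ d2_L2 ap_mk_C2(4)[OF gc du' du z]] by (simp add: norm_eq_L2_norm X_norm_eq_L2_norm)
  define x where "x = (1 / X_norm phi1) *\<^sub>R y"
  have "norm x \<le> 1" unfolding x_def ny[symmetric] by simp
  moreover have "L2_norm phi = l2 x"
  proof -
    have "(LINT t|leb01. (phi t)\<^sup>2) = (LINT t|leb01. (ap x t)\<^sup>2)"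
      by (rule integral_leb01_cong) (simp add: phi_def y x_def)
    then show ?thesis by (simp add: L2_norm_def)
  qed
  moreover obtain B where B: "\<And>t. t \<in> {0..1} \<Longrightarrow> \<bar>g t\<bar> \<le> B" "0 \<le> B" using continuous_bounded_01[OF gc] by blast
  have u'_le: "\<bar>u' t\<bar> \<le> B * t" if t: "t \<in> {0..1}" for t
  proof -
    have "norm (u' t - u' 0) \<le> B * norm (t - 0)"
      by (rule field_differentiable_bound[of "{0..1}"]) (use du' B t in auto)
    then show ?thesis using z t by simp
  qed
  have phi1_le: "\<bar>phi1 t\<bar> \<le> B * t\<^sup>2" if t: "t \<in> {0..1}" for t
  proof -
    have "norm (phi1 t - phi1 0) \<le> (B * t) * norm (t - 0)"
    proof (rule field_differentiable_bound[of "{0..t}"])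
      fix s assume s: "s \<in> {0..t}"
      show "(phi1 has_field_derivative u' s) (at s within {0..t})"
        using du[of s] by (rule has_field_derivative_subset) (use t in auto)
      have "\<bar>u' s\<bar> \<le> B * s" using s t by (intro u'_le) auto
      also have "\<dots> \<le> B * t" using s B(2) by (intro mult_left_mono) auto
      finally show "norm (u' s) \<le> B * t" by simp
    qed (use t in auto)
    then show ?thesis using z t by (simp add: power2_eq_square)
  qed
  have "\<bar>ap x t\<bar> \<le> (B / \<bar>X_norm phi1\<bar>) * t\<^sup>2" if t: "t \<in> {0..1}" for t
    using divide_right_mono[OF phi1_le[OF t], of "\<bar>X_norm phi1\<bar>"] by (simp add: x_def y[OF t] abs_mult)
  ultimately show ?thesis using that by blast
qed

section \<open>The energy functional on the shell\<close>

text \<open>The function is uniformly continuous on the compact square, and suprema over a common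
  parameter interval inherit its modulus of continuity.\<close>

lemma continuous_on_SUP_interval:
  assumes g: "continuous_on ({0..1::real} \<times> {0..1::real}) (\<lambda>(t, \<theta>). g t \<theta> :: real)"
  shows "continuous_on {0..1} (\<lambda>t. SUP \<theta>\<in>{0..1}. g t \<theta>)"
  unfolding continuous_on_iff
proof (intro ballI allI impI)
  fix t e :: real assume t: "t \<in> {0..1}" and e: "0 < e"
  have "uniformly_continuous_on ({0..1} \<times> {0..1}) (\<lambda>(t, \<theta>). g t \<theta>)"
    by (intro compact_uniformly_continuous g compact_Times compact_Icc)
  then obtain d where d: "d > 0" "\<And>x y. x \<in> {0..1} \<times> {0..1} \<Longrightarrow> y \<in> {0..1} \<times> {0..1} \<Longrightarrow> dist y x < d
      \<Longrightarrow> dist (case y of (t, \<theta>) \<Rightarrow> g t \<theta>) (case x of (t, \<theta>) \<Rightarrow> g t \<theta>) < e / 2"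
    unfolding uniformly_continuous_on_def using e by (meson half_gt_zero)
  have bdd: "bdd_above (g s ` {0..1})" if s: "s \<in> {0..1}" for s
  proof -
    have "continuous_on {0..1} (\<lambda>\<theta>. case (s, \<theta>) of (t, \<theta>) \<Rightarrow> g t \<theta>)"
      by (rule continuous_on_compose2[OF g]) (use s in \<open>auto intro: continuous_intros\<close>)
    then have "continuous_on {0..1} (g s)" by simp
    then show ?thesis by (intro bounded_imp_bdd_above compact_imp_bounded compact_continuous_image) auto
  qed
  have le: "(SUP \<theta>\<in>{0..1}. g s \<theta>) \<le> (SUP \<theta>\<in>{0..1}. g r \<theta>) + e / 2"
    if "s \<in> {0..1}" "r \<in> {0..1}" "dist s r < d" for s r
  proof (rule cSUP_least)
    fix \<theta> :: real assume th: "\<theta> \<in> {0..1}"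
    have "dist (g s \<theta>) (g r \<theta>) < e / 2"
      using d(2)[of "(r, \<theta>)" "(s, \<theta>)"] that th by (simp add: dist_Pair_Pair)
    then have "g s \<theta> \<le> g r \<theta> + e / 2" unfolding dist_real_def abs_less_iff by linarith
    also have "g r \<theta> \<le> (SUP \<theta>\<in>{0..1}. g r \<theta>)" using th by (rule cSUP_upper) (rule bdd[OF that(2)])
    finally show "g s \<theta> \<le> (SUP \<theta>\<in>{0..1}. g r \<theta>) + e / 2" by simp
  qed simp
  show "\<exists>d>0. \<forall>s\<in>{0..1}. dist s t < d \<longrightarrow> dist (SUP \<theta>\<in>{0..1}. g s \<theta>) (SUP \<theta>\<in>{0..1}. g t \<theta>) < e"
  proof (intro exI conjI ballI impI)
    fix s :: real assume s: "s \<in> {0..1}" "dist s t < d"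
    then show "dist (SUP \<theta>\<in>{0..1}. g s \<theta>) (SUP \<theta>\<in>{0..1}. g t \<theta>) < e"
      using le[of s t] le[of t s] t e by (simp add: dist_real_def dist_commute abs_less_iff)
  qed (rule d(1))
qed

text \<open>Only the data on \<open>f\<close> and the two radii are fixed here. The end points and
  the corner condition stay outside, because the deformation is applied at two different
  levels.\<close>

locale shell_problem =
  fixes f :: "real \<Rightarrow> real \<Rightarrow> real" and c_inf R0 R1 :: real
  assumes f_cont: "continuous_on ({0..1} \<times> UNIV) (\<lambda>(t, x). f t x)"
    and f_nonneg: "\<forall>t\<in>{0..1}. \<forall>x\<ge>0. f t x \<ge> 0"
    and c_inf_pos: "c_inf > 0"
    and c_inf_bound: "\<forall>v\<in>K. max_norm v \<le> c_inf * X_norm v"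
    and R0_pos: "0 < R0"
    and R0_less: "R0 < L2_norm phi * R1"
    and lower: "R0 \<le> L2_norm (J (f_lower f c_inf R0 R1))"
    and upper: "R1 \<ge> c_inf * L1_norm (f_upper f c_inf R0 R1)"
begin

definition S :: "xs set" where "S = {x \<in> Kcone. R0 \<le> l2 x \<and> norm x \<le> R1}"

text \<open>On this set all values lie in [0, R1], so \<open>f\<close> has to be controlled only on
  a compact rectangle.\<close>

definition ball_cone :: "xs set" where "ball_cone = {x \<in> Kcone. norm x \<le> R1}"

text \<open>The gradient of \<open>En\<close> at \<open>x\<close> is \<open>x - Nf x\<close>, so its critical points are the fixed points of \<open>Nf\<close>.\<close>

definition Nf :: "xs \<Rightarrow> xs" where "Nf x = solJ (\<lambda>t. f t (ap x t))"

definition En :: "xs \<Rightarrow> real" where "En x = E f (ap x)"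

definition Psi :: "xs \<Rightarrow> real" where "Psi x = (LINT t|leb01. F f t (ap x t))"

lemma S_subset: "S \<subseteq> ball_cone" by (auto simp: S_def ball_cone_def)

lemma SD: "x \<in> S \<Longrightarrow> x \<in> Kcone" "x \<in> S \<Longrightarrow> R0 \<le> l2 x" "x \<in> S \<Longrightarrow> norm x \<le> R1"
  by (auto simp: S_def)

lemma R1_pos: "0 < R1"
  using R0_pos R0_less L2_norm_nonneg[of phi] by (metis less_trans mult_nonneg_nonpos not_le)

lemma En_eq: "En x = (norm x)\<^sup>2 / 2 - Psi x"
  by (simp add: En_def E_def Psi_def X_norm_ap)

lemma ball_cone_range: "x \<in> ball_cone \<Longrightarrow> ap x t \<in> {0..R1}"
  using cone_nonneg abs_ap_le[of x t] by (auto simp: ball_cone_def)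

lemma f_pair_cont:
  assumes "continuous_on A a" "a ` A \<subseteq> {0..1}" "continuous_on A b"
  shows "continuous_on A (\<lambda>x. f (a x) (b x))"
proof -
  have "continuous_on A (\<lambda>x. case (a x, b x) of (t, x) \<Rightarrow> f t x)"
    by (rule continuous_on_compose2[OF f_cont]) (use assms in \<open>auto intro: continuous_on_Pair\<close>)
  then show ?thesis by simp
qed

lemma f_comp_cont: "continuous_on {0..1} v \<Longrightarrow> continuous_on {0..1} (\<lambda>t. f t (v t))"
  by (rule f_pair_cont) (auto intro: continuous_on_id)

lemma f_cont_x: "t \<in> {0..1} \<Longrightarrow> continuous_on A (f t)"
  by (rule f_pair_cont) (auto intro: continuous_intros)

lemma inner_Nf: "inner (Nf x) y = (LINT t|leb01. f t (ap x t) * ap y t)"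
  unfolding Nf_def by (rule inner_solJ[OF f_comp_cont[OF ap_cont]])

lemma f_bounded:
  obtains C where "0 \<le> C" "\<And>t x. t \<in> {0..1} \<Longrightarrow> x \<in> {0..R1} \<Longrightarrow> \<bar>f t x\<bar> \<le> C"
proof -
  have "continuous_on ({0..1} \<times> {0..R1}) (\<lambda>(t, x). f t x)"
    by (rule continuous_on_subset[OF f_cont]) auto
  then have "bounded ((\<lambda>(t, x). f t x) ` ({0..1} \<times> {0..R1}))"
    by (intro compact_imp_bounded compact_continuous_image compact_Times compact_Icc)
  then obtain C where "\<forall>y\<in>(\<lambda>(t, x). f t x) ` ({0..1} \<times> {0..R1}). norm y \<le> C"
    unfolding bounded_iff by blast
  then have C: "\<bar>f t x\<bar> \<le> C" if "t \<in> {0..1}" "x \<in> {0..R1}" for t x using that by force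
  moreover have "0 \<le> C" using C[of 0 0] R1_pos by auto
  ultimately show ?thesis using that by blast
qed

lemma f_uniform:
  assumes "0 < e"
  obtains d where "0 < d"
    "\<And>t x y. t \<in> {0..1} \<Longrightarrow> x \<in> {0..R1} \<Longrightarrow> y \<in> {0..R1} \<Longrightarrow> \<bar>x - y\<bar> < d \<Longrightarrow> \<bar>f t x - f t y\<bar> < e"
proof -
  have "continuous_on ({0..1} \<times> {0..R1}) (\<lambda>(t, x). f t x)"
    by (rule continuous_on_subset[OF f_cont]) auto
  then have "uniformly_continuous_on ({0..1} \<times> {0..R1}) (\<lambda>(t, x). f t x)"
    by (intro compact_uniformly_continuous compact_Times compact_Icc)
  then obtain d where d: "d > 0" "\<And>x y. x \<in> {0..1} \<times> {0..R1} \<Longrightarrow> y \<in> {0..1} \<times> {0..R1} \<Longrightarrow> dist y x < d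
      \<Longrightarrow> dist (case y of (t, x) \<Rightarrow> f t x) (case x of (t, x) \<Rightarrow> f t x) < e"
    unfolding uniformly_continuous_on_def using assms by meson
  have "\<bar>f t x - f t y\<bar> < e" if "t \<in> {0..1}" "x \<in> {0..R1}" "y \<in> {0..R1}" "\<bar>x - y\<bar> < d" for t x y
    using d(2)[of "(t, y)" "(t, x)"] that by (simp add: dist_Pair_Pair dist_real_def)
  then show ?thesis using that d(1) by blast
qed

lemma F_eq: "0 \<le> x \<Longrightarrow> t \<in> {0..1} \<Longrightarrow> F f t x = integral {0..x} (f t)"
proof -
  assume x: "0 \<le> x" and t: "t \<in> {0..1}"
  have "set_integrable lborel {0..x} (f t)"
    unfolding set_integrable_def by (rule borel_integrable_compact[OF compact_Icc f_cont_x[OF t]])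
  then have "set_lebesgue_integral lborel {0..x} (f t) = integral {0..x} (f t)"
    by (rule set_borel_integral_eq_integral(2))
  then show ?thesis
    unfolding F_def using interval_integral_Icc[OF x, of "f t"] by (simp add: zero_ereal_def)
qed

lemma F_deriv:
  assumes "t \<in> {0..1}" "x \<in> {0..b}"
  shows "(F f t has_real_derivative f t x) (at x within {0..b})"
  by (rule has_field_derivative_transform_within[OF integral_has_real_derivative[OF f_cont_x[OF assms(1)] assms(2)],
        of 1]) (use assms F_eq in auto)

lemma F_0: "t \<in> {0..1} \<Longrightarrow> F f t 0 = 0"
  by (simp add: F_eq)

text \<open>The mean value inequality for \<open>F f t y - k * y\<close>. With \<open>k = 0\<close>
  it gives the Lipschitz bound of \<open>Psi\<close>, with \<open>k\<close> the value of
  \<open>f\<close> at the base point the first-order expansion.\<close>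

lemma F_diff:
  assumes t: "t \<in> {0..1}" and x: "x \<in> {0..R1}" and y: "y \<in> {0..R1}"
    and bound: "\<And>z. min x y \<le> z \<Longrightarrow> z \<le> max x y \<Longrightarrow> \<bar>f t z - k\<bar> \<le> e"
  shows "\<bar>F f t y - F f t x - k * (y - x)\<bar> \<le> e * \<bar>y - x\<bar>"
proof -
  have "norm ((F f t y - k * y) - (F f t x - k * x)) \<le> e * norm (y - x)"
  proof (rule field_differentiable_bound[of "{min x y..max x y}"])
    fix z assume z: "z \<in> {min x y..max x y}"
    have "(F f t has_real_derivative f t z) (at z within {min x y..max x y})"
      by (rule has_field_derivative_subset[OF F_deriv[OF t, of z R1]]) (use x y z in auto)
    then show "((\<lambda>y. F f t y - k * y) has_field_derivative f t z - k) (at z within {min x y..max x y})"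
      by (auto intro!: derivative_eq_intros)
    show "norm (f t z - k) \<le> e" using bound z by auto
  qed auto
  then show ?thesis by (simp add: algebra_simps)
qed

text \<open>The substitution s = \<theta> v(t) turns the variable upper limit into the fixed
  interval [0,1], where continuity in a parameter is available.\<close>

lemma F_comp_cont:
  assumes v: "continuous_on {0..1} v" "\<And>t. t \<in> {0..1} \<Longrightarrow> 0 \<le> v t"
  shows "continuous_on {0..1} (\<lambda>t. F f t (v t))"
proof -
  let ?h = "\<lambda>t. integral (cbox 0 1) (\<lambda>\<theta>. v t * f t (\<theta> * v t))"
  have vc: "continuous_on ({0..1} \<times> {0..1}) (\<lambda>x. v (fst x))"
    by (rule continuous_on_compose2[OF v(1)]) (auto intro: continuous_intros)
  have "continuous_on ({0..1} \<times> {0..1}) (\<lambda>x. f (fst x) (snd x * v (fst x)))"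
    using vc by (intro f_pair_cont) (auto intro!: continuous_intros)
  then have "continuous_on {0..1} ?h"
    using vc by (intro integral_continuous_on_param) (auto simp: split_beta' intro!: continuous_intros)
  moreover have "?h t = F f t (v t)" if t: "t \<in> {0..1}" for t
  proof -
    have "((\<lambda>\<theta>. v t * f t (\<theta> * v t)) has_integral F f t (1 * v t) - F f t (0 * v t)) {0..1}"
    proof (rule fundamental_theorem_of_calculus)
      fix \<theta> :: real assume th: "\<theta> \<in> {0..1}"
      have i: "\<theta> * v t \<in> {0..v t}" if "\<theta> \<in> {0..1}" for \<theta>
        using that v(2)[OF t] by (auto intro: mult_left_le_one_le)
      have g: "((\<lambda>\<theta>. \<theta> * v t) has_field_derivative v t) (at \<theta> within {0..1})"
        by (auto intro!: derivative_eq_intros)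
      have "(F f t has_field_derivative f t (\<theta> * v t)) (at (\<theta> * v t) within (\<lambda>\<theta>. \<theta> * v t) ` {0..1})"
        using F_deriv[OF t i[OF th]] by (rule has_field_derivative_subset) (use i in auto)
      from DERIV_image_chain[OF this g]
      have "((\<lambda>\<theta>. F f t (\<theta> * v t)) has_real_derivative f t (\<theta> * v t) * v t) (at \<theta> within {0..1})"
        by (simp add: o_def)
      then show "((\<lambda>\<theta>. F f t (\<theta> * v t)) has_vector_derivative v t * f t (\<theta> * v t)) (at \<theta> within {0..1})"
        by (simp add: has_real_derivative_iff_has_vector_derivative mult.commute)
    qed simp
    then have "((\<lambda>\<theta>. v t * f t (\<theta> * v t)) has_integral F f t (v t)) (cbox 0 1)" by (simp add: F_0[OF t])
    then show ?thesis by (rule integral_unique)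
  qed
  ultimately show ?thesis by (simp cong: continuous_on_cong_simp)
qed

lemma F_integrable: "x \<in> Kcone \<Longrightarrow> integrable leb01 (\<lambda>t. F f t (ap x t))"
  by (intro continuous_imp_integrable_leb01 F_comp_cont ap_cont cone_nonneg)

text \<open>The distance is measured in the max norm because \<open>near_corner\<close> compares
  points that are uniformly close but need not be close in X.\<close>

lemma Psi_lipschitz:
  assumes C: "\<And>t x. t \<in> {0..1} \<Longrightarrow> x \<in> {0..R1} \<Longrightarrow> \<bar>f t x\<bar> \<le> C"
    and x: "x \<in> ball_cone" and y: "y \<in> ball_cone"
    and e: "\<And>t. t \<in> {0..1} \<Longrightarrow> \<bar>ap y t - ap x t\<bar> \<le> e"
  shows "\<bar>Psi y - Psi x\<bar> \<le> C * e"
proof -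
  have i: "integrable leb01 (\<lambda>t. F f t (ap y t))" "integrable leb01 (\<lambda>t. F f t (ap x t))"
    using x y unfolding ball_cone_def by (blast intro: F_integrable)+
  have C0: "0 \<le> C" using C[of 0 0] R1_pos by auto
  have "\<bar>Psi y - Psi x\<bar> = \<bar>LINT t|leb01. F f t (ap y t) - F f t (ap x t)\<bar>"
    unfolding Psi_def using i by simp
  also have "\<dots> \<le> (LINT t|leb01. \<bar>F f t (ap y t) - F f t (ap x t)\<bar>)" by (rule integral_abs_bound)
  also have "\<dots> \<le> (LINT t|leb01. C * e)"
  proof (rule integral_leb01_mono)
    show "integrable leb01 (\<lambda>t. \<bar>F f t (ap y t) - F f t (ap x t)\<bar>)" using i by simp
    fix t :: real assume t: "t \<in> {0..1}"
    have "\<bar>F f t (ap y t) - F f t (ap x t) - 0 * (ap y t - ap x t)\<bar> \<le> C * \<bar>ap y t - ap x t\<bar>"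
    proof (rule F_diff[OF t ball_cone_range[OF x] ball_cone_range[OF y]])
      fix z assume "min (ap x t) (ap y t) \<le> z" "z \<le> max (ap x t) (ap y t)"
      then have "z \<in> {0..R1}" using ball_cone_range[OF x, of t] ball_cone_range[OF y, of t] by auto
      then show "\<bar>f t z - 0\<bar> \<le> C" using C[OF t] by simp
    qed
    also have "\<dots> \<le> C * e" by (rule mult_left_mono[OF e[OF t] C0])
    finally show "\<bar>F f t (ap y t) - F f t (ap x t)\<bar> \<le> C * e" by simp
  qed simp
  finally show ?thesis by simp
qed

text \<open>The radius \<open>d\<close> depends only on the modulus of continuity of
  \<open>f\<close>. This uniformity is what allows one step length for all points of the
  shell.\<close>

lemma Psi_first_order:
  assumes d: "\<And>t x y. t \<in> {0..1} \<Longrightarrow> x \<in> {0..R1} \<Longrightarrow> y \<in> {0..R1} \<Longrightarrow> \<bar>x - y\<bar> < d \<Longrightarrow> \<bar>f t x - f t y\<bar> < e"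
    and x: "x \<in> ball_cone" and y: "y \<in> ball_cone" and n: "norm (y - x) < d"
  shows "\<bar>Psi y - Psi x - inner (Nf x) (y - x)\<bar> \<le> e * norm (y - x)"
proof -
  have i: "integrable leb01 (\<lambda>t. F f t (ap y t))" "integrable leb01 (\<lambda>t. F f t (ap x t))"
    "integrable leb01 (\<lambda>t. f t (ap x t) * (ap y t - ap x t))"
    using x y unfolding ball_cone_def
    by (blast intro: F_integrable, blast intro: F_integrable,
        intro continuous_imp_integrable_leb01 continuous_on_mult continuous_on_diff f_comp_cont ap_cont)
  have yx: "\<bar>ap y t - ap x t\<bar> \<le> norm (y - x)" for t using abs_ap_le[of "y - x" t] by simp
  have "0 < d" using n norm_ge_zero[of "y - x"] by linarith
  then have e0: "0 \<le> e" using d[of 0 0 0] R1_pos by simp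
  have "\<bar>Psi y - Psi x - inner (Nf x) (y - x)\<bar>
      = \<bar>LINT t|leb01. F f t (ap y t) - F f t (ap x t) - f t (ap x t) * (ap y t - ap x t)\<bar>"
    unfolding Psi_def inner_Nf using i by simp
  also have "\<dots> \<le> (LINT t|leb01. \<bar>F f t (ap y t) - F f t (ap x t) - f t (ap x t) * (ap y t - ap x t)\<bar>)"
    by (rule integral_abs_bound)
  also have "\<dots> \<le> (LINT t|leb01. e * norm (y - x))"
  proof (rule integral_leb01_mono)
    show "integrable leb01 (\<lambda>t. \<bar>F f t (ap y t) - F f t (ap x t) - f t (ap x t) * (ap y t - ap x t)\<bar>)"
      using i by simp
    fix t :: real assume t: "t \<in> {0..1}"
    have "\<bar>F f t (ap y t) - F f t (ap x t) - f t (ap x t) * (ap y t - ap x t)\<bar> \<le> e * \<bar>ap y t - ap x t\<bar>"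
    proof (rule F_diff[OF t ball_cone_range[OF x] ball_cone_range[OF y]])
      fix z assume z: "min (ap x t) (ap y t) \<le> z" "z \<le> max (ap x t) (ap y t)"
      then have "z \<in> {0..R1}" using ball_cone_range[OF x, of t] ball_cone_range[OF y, of t] by auto
      moreover have "\<bar>z - ap x t\<bar> < d" using z yx[of t] n by (auto simp: min_def max_def abs_le_iff split: if_splits)
      ultimately show "\<bar>f t z - f t (ap x t)\<bar> \<le> e"
        using d[OF t _ ball_cone_range[OF x]] by (simp add: less_imp_le)
    qed
    also have "\<dots> \<le> e * norm (y - x)" by (rule mult_left_mono[OF yx e0])
    finally show "\<bar>F f t (ap y t) - F f t (ap x t) - f t (ap x t) * (ap y t - ap x t)\<bar> \<le> e * norm (y - x)" .
  qed simp
  finally show ?thesis by simp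
qed

lemma continuous_on_En: "continuous_on ball_cone En"
proof -
  obtain C where C: "0 \<le> C" "\<And>t x. t \<in> {0..1} \<Longrightarrow> x \<in> {0..R1} \<Longrightarrow> \<bar>f t x\<bar> \<le> C" using f_bounded by blast
  have "\<bar>Psi y - Psi x\<bar> \<le> C * norm (y - x)" if "x \<in> ball_cone" "y \<in> ball_cone" for x y
    using that abs_ap_le[of "y - x"] by (intro Psi_lipschitz C(2)) auto
  then have "C-lipschitz_on ball_cone Psi"
    using C(1) by (intro lipschitz_onI) (auto simp: dist_real_def dist_norm)
  then have "continuous_on ball_cone Psi" by (rule lipschitz_on_continuous_on)
  then show ?thesis unfolding En_eq[abs_def] by (intro continuous_intros) auto
qed

lemma En_bounded: "\<exists>B. \<forall>x\<in>ball_cone. \<bar>En x\<bar> \<le> B"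
proof -
  obtain C where C: "0 \<le> C" "\<And>t x. t \<in> {0..1} \<Longrightarrow> x \<in> {0..R1} \<Longrightarrow> \<bar>f t x\<bar> \<le> C" using f_bounded by blast
  have z: "0 \<in> ball_cone"
  proof -
    have "T 0 \<in> Kcone" unfolding T_def by (rule cone_solJ) (auto intro: ap_cont)
    moreover have "T 0 = 0" using T_scale[of 0 0] by simp
    ultimately show ?thesis using R1_pos by (simp add: ball_cone_def)
  qed
  have P0: "Psi 0 = 0" unfolding Psi_def using integral_leb01_cong[of "\<lambda>t. F f t (ap 0 t)" "\<lambda>t. 0"] by (simp add: F_0)
  have "\<bar>En x\<bar> \<le> R1\<^sup>2 / 2 + C * R1" if x: "x \<in> ball_cone" for x
  proof -
    have "\<bar>ap x t\<bar> \<le> R1" for t using ball_cone_range[OF x, of t] by simp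
    then have "\<bar>Psi x - Psi 0\<bar> \<le> C * R1" by (intro Psi_lipschitz C(2) z x) auto
    moreover have "(norm x)\<^sup>2 \<le> R1\<^sup>2" using x by (intro power_mono) (auto simp: ball_cone_def)
    moreover have "0 \<le> (norm x)\<^sup>2" by simp
    ultimately show ?thesis unfolding En_eq P0 abs_le_iff by linarith
  qed
  then show ?thesis by blast
qed

text \<open>The comparison function \<open>v\<close> is any continuous function with values in
  [0, R1], so the estimate covers uniform limits as well as elements of the ball.\<close>

lemma Nf_uniform:
  assumes d: "\<And>t x y. t \<in> {0..1} \<Longrightarrow> x \<in> {0..R1} \<Longrightarrow> y \<in> {0..R1} \<Longrightarrow> \<bar>x - y\<bar> < d \<Longrightarrow> \<bar>f t x - f t y\<bar> < e"
    and x: "x \<in> ball_cone" and v: "continuous_on {0..1} v" "\<And>t. t \<in> {0..1} \<Longrightarrow> v t \<in> {0..R1}"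
    and n: "\<And>t. t \<in> {0..1} \<Longrightarrow> \<bar>ap x t - v t\<bar> < d"
  shows "norm (Nf x - solJ (\<lambda>t. f t (v t))) \<le> e"
  unfolding Nf_def
  by (intro norm_solJ_diff_le f_comp_cont ap_cont v less_imp_le d ball_cone_range x n)

lemma continuous_on_Nf: "continuous_on ball_cone Nf"
  unfolding continuous_on_iff
proof (intro ballI allI impI)
  fix x and e :: real assume x: "x \<in> ball_cone" and e: "0 < e"
  obtain d where d: "0 < d" "\<And>t x y. t \<in> {0..1} \<Longrightarrow> x \<in> {0..R1} \<Longrightarrow> y \<in> {0..R1} \<Longrightarrow> \<bar>x - y\<bar> < d \<Longrightarrow> \<bar>f t x - f t y\<bar> < e / 2"
    using f_uniform[of "e / 2"] e by auto
  have "dist (Nf y) (Nf x) < e" if "y \<in> ball_cone" "dist y x < d" for y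
  proof -
    have "\<bar>ap y t - ap x t\<bar> < d" for t
      using abs_ap_le[of "y - x" t] that(2) by (simp add: dist_norm)
    then have "norm (Nf y - solJ (\<lambda>t. f t (ap x t))) \<le> e / 2"
      by (intro Nf_uniform[OF d(2)] that ap_cont ball_cone_range x)
    then show ?thesis using e by (simp add: dist_norm Nf_def)
  qed
  then show "\<exists>d>0. \<forall>y\<in>ball_cone. dist y x < d \<longrightarrow> dist (Nf y) (Nf x) < e" using d(1) by blast
qed

lemma ap_le_c_inf: "x \<in> Kcone \<Longrightarrow> t \<in> {0..1} \<Longrightarrow> ap x t \<le> c_inf * norm x"
proof -
  assume x: "x \<in> Kcone" and t: "t \<in> {0..1}"
  have "bdd_above ((\<lambda>t. \<bar>ap x t\<bar>) ` {0..1})" using abs_ap_le[of x] by (intro bdd_aboveI[of _ "norm x"]) auto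
  then have "\<bar>ap x t\<bar> \<le> max_norm (ap x)" unfolding max_norm_def by (rule cSUP_upper[OF t])
  also have "\<dots> \<le> c_inf * norm x" using c_inf_bound x unfolding Kcone_def X_norm_ap[symmetric] by blast
  finally show ?thesis by simp
qed

lemma S_range: "x \<in> S \<Longrightarrow> t \<in> {0..1} \<Longrightarrow> ap x t \<in> {M t * R0..c_inf * R1}"
proof -
  assume x: "x \<in> S" and t: "t \<in> {0..1}"
  have "M t * R0 \<le> ap x t"
    using mult_left_mono[OF SD(2)[OF x] M_nonneg[OF t]] cone_lower[OF SD(1)[OF x] t] by linarith
  moreover have "ap x t \<le> c_inf * R1"
    using mult_left_mono[OF SD(3)[OF x], of c_inf] ap_le_c_inf[OF SD(1)[OF x] t] c_inf_pos by linarith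
  ultimately show ?thesis by simp
qed

lemma Nf_cone: "x \<in> Kcone \<Longrightarrow> Nf x \<in> Kcone"
  unfolding Nf_def using f_nonneg cone_nonneg by (intro cone_solJ f_comp_cont ap_cont) auto

lemma f_bdd: "t \<in> {0..1} \<Longrightarrow> bdd_above (f t ` {a..b})" "t \<in> {0..1} \<Longrightarrow> bdd_below (f t ` {a..b})"
  using compact_imp_bounded[OF compact_continuous_image[OF f_cont_x compact_Icc], of t a b]
  by (auto intro: bounded_imp_bdd_above bounded_imp_bdd_below)

text \<open>The interval of the supremum moves with \<open>t\<close>; \<open>p\<close> parametrizes
  it affinely by [0,1]. The point \<open>x\<close> of the shell certifies that the interval is
  nonempty for every \<open>t\<close>.\<close>

lemma f_upper_cont:
  assumes "x \<in> S" shows "continuous_on {0..1} (f_upper f c_inf R0 R1)"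
proof -
  define p where "p t \<theta> = M t * R0 + \<theta> * (c_inf * R1 - M t * R0)" for t \<theta>
  have le: "M t * R0 \<le> c_inf * R1" if "t \<in> {0..1}" for t using S_range[OF assms that] by simp
  have img: "p t ` {0..1} = {M t * R0..c_inf * R1}" if t: "t \<in> {0..1}" for t
  proof
    show "p t ` {0..1} \<subseteq> {M t * R0..c_inf * R1}"
    proof (clarsimp simp: p_def)
      fix \<theta> :: real assume th: "0 \<le> \<theta>" "\<theta> \<le> 1"
      have "0 \<le> \<theta> * (c_inf * R1 - M t * R0)" "0 \<le> (1 - \<theta>) * (c_inf * R1 - M t * R0)"
        using le[OF t] th by (auto intro: mult_nonneg_nonneg)
      then show "0 \<le> \<theta> * (c_inf * R1 - M t * R0) \<and> M t * R0 + \<theta> * (c_inf * R1 - M t * R0) \<le> c_inf * R1"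
        by (simp add: algebra_simps)
    qed
    show "{M t * R0..c_inf * R1} \<subseteq> p t ` {0..1}"
    proof
      fix y assume y: "y \<in> {M t * R0..c_inf * R1}"
      show "y \<in> p t ` {0..1}"
      proof (cases "c_inf * R1 = M t * R0")
        case True then show ?thesis using y by (auto simp: p_def intro!: image_eqI[of _ _ 0])
      next
        case False
        then have "y = p t ((y - M t * R0) / (c_inf * R1 - M t * R0))" by (simp add: p_def)
        moreover have "(y - M t * R0) / (c_inf * R1 - M t * R0) \<in> {0..1}"
          using y False le[OF t] by (auto simp: divide_le_eq_1)
        ultimately show ?thesis by blast
      qed
    qed
  qed
  have "continuous_on ({0..1} \<times> {0..1}) (\<lambda>x. p (fst x) (snd x))"
    unfolding p_def M_def by (intro continuous_intros) auto
  then have "continuous_on ({0..1} \<times> {0..1}) (\<lambda>x. f (fst x) (p (fst x) (snd x)))"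
    by (intro f_pair_cont) (auto intro!: continuous_intros)
  then have "continuous_on {0..1} (\<lambda>t. SUP \<theta>\<in>{0..1}. f t (p t \<theta>))"
    by (intro continuous_on_SUP_interval) (simp add: split_beta')
  moreover have "(SUP \<theta>\<in>{0..1}. f t (p t \<theta>)) = f_upper f c_inf R0 R1 t" if "t \<in> {0..1}" for t
    unfolding f_upper_def img[OF that, symmetric] by (simp add: image_image)
  ultimately show ?thesis by (simp cong: continuous_on_cong_simp)
qed

text \<open>For the outer bound, |Nf x|^2 is the integral of f(., x) times Nf x; the first factor is
  at most the upper envelope, the second at most \<open>c_inf * norm (Nf x)\<close>. For the inner
  bound, positivity of Green's function puts J of the lower envelope below Nf x pointwise.\<close>

lemma Nf_S:
  assumes x: "x \<in> S" shows "Nf x \<in> S"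
proof -
  let ?v = "\<lambda>t. f t (ap x t)"
  have vc: "continuous_on {0..1} ?v" by (rule f_comp_cont[OF ap_cont])
  have v0: "0 \<le> ?v t" if "t \<in> {0..1}" for t using f_nonneg cone_nonneg[OF SD(1)[OF x]] that by auto
  have cone: "Nf x \<in> Kcone" by (rule Nf_cone[OF SD(1)[OF x]])
  have uc: "continuous_on {0..1} (f_upper f c_inf R0 R1)" by (rule f_upper_cont[OF x])
  have u: "?v t \<le> f_upper f c_inf R0 R1 t" if "t \<in> {0..1}" for t
    unfolding f_upper_def by (rule cSUP_upper[OF S_range[OF x that] f_bdd(1)[OF that]])
  have "norm (Nf x) * norm (Nf x) = inner (Nf x) (Nf x)" by (simp add: dot_square_norm power2_eq_square)
  also have "\<dots> = (LINT t|leb01. ?v t * ap (Nf x) t)" by (rule inner_Nf)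
  also have "\<dots> \<le> (LINT t|leb01. (c_inf * norm (Nf x)) * \<bar>f_upper f c_inf R0 R1 t\<bar>)"
  proof (rule integral_leb01_mono)
    show "integrable leb01 (\<lambda>t. ?v t * ap (Nf x) t)"
      "integrable leb01 (\<lambda>t. (c_inf * norm (Nf x)) * \<bar>f_upper f c_inf R0 R1 t\<bar>)"
      by (intro continuous_imp_integrable_leb01 continuous_intros vc ap_cont uc)+
    fix t :: real assume t: "t \<in> {0..1}"
    have "?v t * ap (Nf x) t \<le> \<bar>f_upper f c_inf R0 R1 t\<bar> * (c_inf * norm (Nf x))"
      using u[OF t] v0[OF t] ap_le_c_inf[OF cone t] cone_nonneg[OF cone, of t] by (intro mult_mono) auto
    then show "?v t * ap (Nf x) t \<le> (c_inf * norm (Nf x)) * \<bar>f_upper f c_inf R0 R1 t\<bar>" by (simp add: mult.commute)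
  qed
  also have "\<dots> = (c_inf * L1_norm (f_upper f c_inf R0 R1)) * norm (Nf x)" by (simp add: L1_norm_def)
  also have "\<dots> \<le> R1 * norm (Nf x)" using upper by (intro mult_right_mono) auto
  finally have n: "norm (Nf x) \<le> R1" using R1_pos by (cases "norm (Nf x) = 0") (auto simp: mult_le_cancel_right)
  have lo: "0 \<le> f_lower f c_inf R0 R1 t" "f_lower f c_inf R0 R1 t \<le> ?v t" if t: "t \<in> {0..1}" for t
  proof -
    show "f_lower f c_inf R0 R1 t \<le> ?v t"
      unfolding f_lower_def by (rule cINF_lower[OF f_bdd(2)[OF t] S_range[OF x t]])
    have "0 \<le> y" if "M t * R0 \<le> y" for y
      using that mult_nonneg_nonneg[OF M_nonneg[OF t] less_imp_le[OF R0_pos]] by linarith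
    then show "0 \<le> f_lower f c_inf R0 R1 t"
      unfolding f_lower_def using f_nonneg t S_range[OF x t] by (intro cINF_greatest) auto
  qed
  have J_lo: "0 \<le> J (f_lower f c_inf R0 R1) t" "J (f_lower f c_inf R0 R1) t \<le> ap (Nf x) t" if t: "t \<in> {0..1}" for t
  proof -
    show "0 \<le> J (f_lower f c_inf R0 R1) t"
      unfolding J_def using lo G_nonneg[OF t] by (intro Bochner_Integration.integral_nonneg) auto
    \<comment> \<open>Integrability is established for the larger, nonnegative integrand alone: were
      the smaller one not integrable, its integral would be 0 by convention and the inequality would
      still hold.\<close>
    have "J (f_lower f c_inf R0 R1) t \<le> J ?v t" unfolding J_def
    proof (rule integral_mono')
      show "integrable leb01 (\<lambda>s. G t s * ?v s)"
        by (intro continuous_imp_integrable_leb01 continuous_intros G_cont vc)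
      fix s assume "s \<in> space leb01"
      then have s: "s \<in> {0..1}" by simp
      show "G t s * f_lower f c_inf R0 R1 s \<le> G t s * ?v s"
        by (intro mult_left_mono lo G_nonneg s t)
      show "0 \<le> G t s * ?v s"
        by (intro mult_nonneg_nonneg v0 G_nonneg s t)
    qed
    then show "J (f_lower f c_inf R0 R1) t \<le> ap (Nf x) t" unfolding Nf_def using ap_solJ[OF vc t] by simp
  qed
  have "L2_norm (J (f_lower f c_inf R0 R1)) \<le> l2 (Nf x)"
    unfolding L2_norm_def
  proof (intro real_sqrt_le_mono integral_mono')
    show "integrable leb01 (\<lambda>t. (ap (Nf x) t)\<^sup>2)"
      by (intro continuous_imp_integrable_leb01 continuous_on_power ap_cont)
    fix t assume "t \<in> space leb01"
    then have t: "t \<in> {0..1}" by simp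
    show "(J (f_lower f c_inf R0 R1) t)\<^sup>2 \<le> (ap (Nf x) t)\<^sup>2" by (intro power_mono J_lo t)
  qed simp
  then show ?thesis using cone n lower by (simp add: S_def)
qed

lemma closed_S: "closed S"
proof -
  have "S = Kcone \<inter> {x. R0 \<le> l2 x} \<inter> {x. norm x \<le> R1}" by (auto simp: S_def)
  moreover have "closed {x. R0 \<le> l2 x}" by (intro closed_Collect_le continuous_on_l2 continuous_intros)
  moreover have "closed {x :: xs. norm x \<le> R1}" by (intro closed_Collect_le continuous_intros)
  ultimately show ?thesis using closed_cone by (auto intro: closed_Int)
qed

text \<open>Both operators are continuous from the max norm into X, so one uniformly convergent
  subsequence serves both.\<close>

lemma compact_maps:
  fixes Y :: "nat \<Rightarrow> xs"
  assumes Y: "\<And>n. Y n \<in> S"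
  obtains r a b where "strict_mono (r :: nat \<Rightarrow> nat)" "(\<lambda>n. T (Y (r n))) \<longlonglongrightarrow> a" "(\<lambda>n. Nf (Y (r n))) \<longlonglongrightarrow> b"
proof -
  obtain g r where gr: "continuous_on {0..1} g" "strict_mono (r :: nat \<Rightarrow> nat)"
    "\<And>e. 0 < e \<Longrightarrow> \<exists>N. \<forall>n\<ge>N. \<forall>t\<in>{0..1}. \<bar>ap (Y (r n)) t - g t\<bar> < e"
    using uniform_limit_subsequence[of Y R1] SD(3)[OF Y] by blast
  have g: "g t \<in> {0..R1}" if t: "t \<in> {0..1}" for t
  proof -
    have "(\<lambda>n. ap (Y (r n)) t) \<longlonglongrightarrow> g t"
      unfolding lim_sequentially dist_real_def using gr(3) t by meson
    moreover have "ap (Y (r n)) t \<in> {0..R1}" for n using ball_cone_range Y S_subset by blast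
    ultimately show ?thesis using closed_sequentially[OF closed_atLeastAtMost, of "\<lambda>n. ap (Y (r n)) t" 0 R1] by blast
  qed
  have "(\<lambda>n. T (Y (r n))) \<longlonglongrightarrow> solJ g"
    unfolding lim_sequentially dist_norm
  proof (intro allI impI)
    fix e :: real assume e: "0 < e"
    obtain N where N: "\<forall>n\<ge>N. \<forall>t\<in>{0..1}. \<bar>ap (Y (r n)) t - g t\<bar> < e / 2" using gr(3)[of "e / 2"] e by auto
    have "norm (T (Y (r n)) - solJ g) \<le> e / 2" if "n \<ge> N" for n
      unfolding T_def using N that by (intro norm_solJ_diff_le ap_cont gr(1)) (auto intro: less_imp_le)
    then show "\<exists>N. \<forall>n\<ge>N. norm (T (Y (r n)) - solJ g) < e" using e by (intro exI[of _ N]) force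
  qed
  moreover have "(\<lambda>n. Nf (Y (r n))) \<longlonglongrightarrow> solJ (\<lambda>t. f t (g t))"
    unfolding lim_sequentially dist_norm
  proof (intro allI impI)
    fix e :: real assume e: "0 < e"
    obtain d where d: "0 < d" "\<And>t x y. t \<in> {0..1} \<Longrightarrow> x \<in> {0..R1} \<Longrightarrow> y \<in> {0..R1} \<Longrightarrow> \<bar>x - y\<bar> < d \<Longrightarrow> \<bar>f t x - f t y\<bar> < e / 2"
      using f_uniform[of "e / 2"] e by auto
    obtain N where N: "\<forall>n\<ge>N. \<forall>t\<in>{0..1}. \<bar>ap (Y (r n)) t - g t\<bar> < d" using gr(3)[OF d(1)] by auto
    have "norm (Nf (Y (r n)) - solJ (\<lambda>t. f t (g t))) \<le> e / 2" if "n \<ge> N" for n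
      using N that Y S_subset by (intro Nf_uniform[OF d(2)] gr(1) g) auto
    then show "\<exists>N. \<forall>n\<ge>N. norm (Nf (Y (r n)) - solJ (\<lambda>t. f t (g t))) < e" using e by (intro exI[of _ N]) force
  qed
  ultimately show ?thesis using that gr(2) by blast
qed

lemma cont_En_S: "continuous_on S En" and cont_Nf_S: "continuous_on S Nf"
  using continuous_on_En continuous_on_Nf S_subset continuous_on_subset by blast+

section \<open>Deformation\<close>

lemma inner_T_self_pos: "x \<in> S \<Longrightarrow> 0 < inner (T x) (T x)"
proof -
  assume x: "x \<in> S"
  have "T x \<noteq> 0"
  proof
    assume "T x = 0"
    then have "(l2 x)\<^sup>2 = 0" by (simp add: l2_sq)
    then show False using SD(2)[OF x] R0_pos by simp
  qed
  then show ?thesis by simp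
qed

text \<open>Follows from (T x, x) = (l2 x)^2 >= R0^2. It bounds the multiplier, whose formula has
  \<open>inner (T u) (T u)\<close> in the denominator.\<close>

lemma norm_T_lower: "x \<in> S \<Longrightarrow> R0\<^sup>2 / R1 \<le> norm (T x)"
proof -
  assume x: "x \<in> S"
  have "R0\<^sup>2 \<le> (l2 x)\<^sup>2" using SD(2)[OF x] R0_pos by (intro power_mono) auto
  also have "\<dots> \<le> norm (T x) * norm x" unfolding l2_sq by (rule norm_cauchy_schwarz)
  also have "\<dots> \<le> norm (T x) * R1" using SD(3)[OF x] by (intro mult_left_mono) auto
  finally show ?thesis using R1_pos by (simp add: field_simps)
qed

lemma norm_T_upper: "x \<in> S \<Longrightarrow> norm (T x) \<le> R1"
  using norm_T_le[of x] SD(3)[of x] by simp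

text \<open>The negative gradient of \<open>En\<close>.\<close>

definition w :: "xs \<Rightarrow> xs" where "w x = Nf x - x"

lemma norm_w: "x \<in> S \<Longrightarrow> norm (w x) \<le> 2 * R1"
  unfolding w_def using norm_triangle_ineq4[of "Nf x" x] SD(3)[of x] SD(3)[OF Nf_S, of x] by simp

text \<open>The multiplier belongs to the constraint \<open>l2 u \<ge> R0\<close>; since \<open>l2 (Nf u) \<ge> R0\<close> and \<open>T u\<close> is
  positive, it vanishes in the limit.\<close>

lemma palais_smale:
  fixes Y :: "nat \<Rightarrow> xs" and m :: "nat \<Rightarrow> real"
  assumes Y: "\<And>n. Y n \<in> S" and m: "\<And>n. 0 \<le> m n" "\<And>n. m n \<le> B"
    and lim: "(\<lambda>n. w (Y n) + m n *\<^sub>R T (Y n)) \<longlonglongrightarrow> 0"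
    and slack: "\<And>n. m n = 0 \<or> (l2 (Y n))\<^sup>2 \<le> R0\<^sup>2 + e n" and e: "e \<longlonglongrightarrow> 0"
    and En: "(\<lambda>n. En (Y n)) \<longlonglongrightarrow> c"
  obtains u where "u \<in> S" "Nf u = u" "En u = c"
proof -
  obtain r a b where r: "strict_mono r" and a: "(\<lambda>n. T (Y (r n))) \<longlonglongrightarrow> a" and b: "(\<lambda>n. Nf (Y (r n))) \<longlonglongrightarrow> b"
    by (rule compact_maps[OF Y])
  have "\<forall>n. (\<lambda>n. m (r n)) n \<in> {0..B}" using m by simp
  then obtain k s where k: "k \<in> {0..B}" and s: "strict_mono s" and ms: "((\<lambda>n. m (r n)) \<circ> s) \<longlonglongrightarrow> k"
    by (rule seq_compactE[OF compact_Icc[unfolded compact_eq_seq_compact_metric]])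
  define q where "q n = r (s n)" for n
  have q: "strict_mono q" unfolding q_def using r s by (simp add: strict_mono_def)
  have mq: "(\<lambda>n. m (q n)) \<longlonglongrightarrow> k" using ms by (simp add: q_def o_def)
  have aq: "(\<lambda>n. T (Y (q n))) \<longlonglongrightarrow> a" and bq: "(\<lambda>n. Nf (Y (q n))) \<longlonglongrightarrow> b"
    using LIMSEQ_subseq_LIMSEQ[OF a s] LIMSEQ_subseq_LIMSEQ[OF b s] by (simp_all add: q_def o_def)
  have lq: "(\<lambda>n. w (Y (q n)) + m (q n) *\<^sub>R T (Y (q n))) \<longlonglongrightarrow> 0"
    using LIMSEQ_subseq_LIMSEQ[OF lim q] by (simp add: o_def)
  \<comment> \<open>The point is expressed as Y = Nf Y + m T Y - (w Y + m T Y), where every term on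
    the right converges along the subsequence; so \<open>Y\<close> converges strongly.\<close>
  define u where "u = b + k *\<^sub>R a"
  have "(\<lambda>n. Nf (Y (q n)) + m (q n) *\<^sub>R T (Y (q n)) - (w (Y (q n)) + m (q n) *\<^sub>R T (Y (q n)))) \<longlonglongrightarrow> b + k *\<^sub>R a - 0"
    by (intro tendsto_intros bq aq mq lq)
  then have Yu: "(\<lambda>n. Y (q n)) \<longlonglongrightarrow> u" by (simp add: w_def u_def)
  have uS: "u \<in> S"
    by (rule closed_sequentially[OF closed_S _ Yu]) (rule Y)
  have "(\<lambda>n. T (Y (q n))) \<longlonglongrightarrow> T u"
    using continuous_on_tendsto_compose[OF continuous_on_T Yu, of UNIV] by simp
  then have Ta: "T u = a" using aq LIMSEQ_unique by blast
  have "(\<lambda>n. Nf (Y (q n))) \<longlonglongrightarrow> Nf u"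
    using continuous_on_tendsto_compose[OF cont_Nf_S Yu uS] Y by simp
  then have Nb: "Nf u = b" using bq LIMSEQ_unique by blast
  have "(\<lambda>n. En (Y (q n))) \<longlonglongrightarrow> En u"
    using continuous_on_tendsto_compose[OF cont_En_S Yu uS] Y by simp
  moreover have "(\<lambda>n. En (Y (q n))) \<longlonglongrightarrow> c"
    using LIMSEQ_subseq_LIMSEQ[OF En q] by (simp add: o_def)
  ultimately have Ec: "En u = c" by (rule LIMSEQ_unique)
  have u_eq: "u = Nf u + k *\<^sub>R T u" unfolding Ta Nb by (rule u_def)
  have "k = 0"
  proof (rule ccontr)
    assume "k \<noteq> 0"
    then have k0: "0 < k" using k by simp
    \<comment> \<open>A positive limit \<open>k\<close> forces the second alternative of
      \<open>slack\<close> from some index on, so the limit \<open>u\<close> lies on the inner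
      boundary \<open>l2 u = R0\<close>.\<close>
    then have "\<forall>\<^sub>F n in sequentially. 0 < m (q n)" using mq by (rule order_tendstoD(1)[rotated])
    then have ev: "\<forall>\<^sub>F n in sequentially. (l2 (Y (q n)))\<^sup>2 \<le> R0\<^sup>2 + e (q n)"
      by eventually_elim (use slack in \<open>metis less_irrefl\<close>)
    have "(\<lambda>n. R0\<^sup>2 + e (q n)) \<longlonglongrightarrow> R0\<^sup>2 + 0"
      using LIMSEQ_subseq_LIMSEQ[OF e q] by (intro tendsto_intros) (simp add: o_def)
    then have le: "(l2 u)\<^sup>2 \<le> R0\<^sup>2 + 0"
      by (rule tendsto_le[OF sequentially_bot _ tendsto_power[OF tendsto_l2[OF Yu]] ev])
    have "(l2 u)\<^sup>2 = (l2 (Nf u))\<^sup>2 + 2 * inner (T (Nf u)) (k *\<^sub>R T u) + (l2 (k *\<^sub>R T u))\<^sup>2"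
      using l2_sq_add[of "Nf u" "k *\<^sub>R T u"] u_eq by simp
    moreover have "0 \<le> inner (T (Nf u)) (k *\<^sub>R T u)"
      using k0 SD(1)[OF Nf_S[OF uS]] T_cone[OF SD(1)[OF uS]] by (intro inner_T_cone_nonneg cone_scale) auto
    moreover have "R0\<^sup>2 \<le> (l2 (Nf u))\<^sup>2" using SD(2)[OF Nf_S[OF uS]] R0_pos by (intro power_mono) auto
    ultimately have "(l2 (k *\<^sub>R T u))\<^sup>2 \<le> 0" using le by linarith
    then have z: "l2 (T u) = 0" using k0 by (simp add: l2_scale)
    have "inner (T u) (T u) \<le> l2 u * l2 (T u)" by (rule inner_T_le)
    then show False using z inner_T_self_pos[OF uS] by simp
  qed
  then have "Nf u = u" using u_eq by simp
  then show ?thesis using that uS Ec by blast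
qed

lemma no_critical_point_gradient_bound:
  assumes "\<And>u. u \<in> S \<Longrightarrow> Nf u = u \<Longrightarrow> En u \<noteq> c"
  obtains \<kappa> where "0 < \<kappa>" "\<And>u m. u \<in> S \<Longrightarrow> 0 \<le> m \<Longrightarrow> m \<le> B \<Longrightarrow> \<bar>En u - c\<bar> \<le> \<kappa>
      \<Longrightarrow> m = 0 \<or> (l2 u)\<^sup>2 \<le> R0\<^sup>2 + \<kappa> \<Longrightarrow> \<kappa> \<le> norm (w u + m *\<^sub>R T u)"
proof -
  let ?P = "\<lambda>\<kappa> u m. u \<in> S \<and> 0 \<le> m \<and> m \<le> B \<and> \<bar>En u - c\<bar> \<le> \<kappa> \<and> (m = 0 \<or> (l2 u)\<^sup>2 \<le> R0\<^sup>2 + \<kappa>)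
    \<and> norm (w u + m *\<^sub>R T u) < \<kappa>"
  have "\<exists>\<kappa>>0. \<forall>u m. \<not> ?P \<kappa> u m"
  proof (rule ccontr)
    assume "\<not> ?thesis"
    then have "\<forall>n. \<exists>u m. ?P (inverse (real (Suc n))) u m"
      by (metis inverse_positive_iff_positive of_nat_0_less_iff zero_less_Suc)
    then obtain Y m where P: "\<And>n. ?P (inverse (real (Suc n))) (Y n) (m n)" by metis
    have i0: "(\<lambda>n. inverse (real (Suc n))) \<longlonglongrightarrow> 0" by (rule LIMSEQ_inverse_real_of_nat)
    have "(\<lambda>n. w (Y n) + m n *\<^sub>R T (Y n)) \<longlonglongrightarrow> 0"
      by (rule Lim_null_comparison[OF always_eventually i0]) (use P in \<open>auto intro: less_imp_le\<close>)
    moreover have "(\<lambda>n. En (Y n)) \<longlonglongrightarrow> c"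
      by (rule LIM_zero_cancel, rule Lim_null_comparison[OF always_eventually i0]) (use P in auto)
    ultimately obtain u where "u \<in> S" "Nf u = u" "En u = c"
      using palais_smale[of Y m B "\<lambda>n. inverse (real (Suc n))" c] P i0 by blast
    then show False using assms by blast
  qed
  then show ?thesis using that by (metis not_less)
qed

text \<open>A point close to the corner \<open>l2 u = R0\<close>, \<open>norm u = R1\<close> is uniformly close to a point of the corner:
  adding a uniformly small cone element of large norm lowers the quotient \<open>l2 u / norm u\<close> to \<open>R0 / R1\<close>,
  and rescaling does the rest.\<close>

lemma near_corner:
  assumes corner: "\<And>u. u \<in> S \<Longrightarrow> l2 u = R0 \<Longrightarrow> norm u = R1 \<Longrightarrow> c + \<rho> \<le> En u" and \<rho>: "0 < \<rho>"
  obtains \<delta> where "0 < \<delta>" "\<And>u. u \<in> S \<Longrightarrow> R1 - \<delta> \<le> norm u \<Longrightarrow> (l2 u)\<^sup>2 \<le> R0\<^sup>2 + \<delta> \<Longrightarrow> c + \<rho> / 2 \<le> En u"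
proof -
  obtain C where C: "0 \<le> C" "\<And>t x. t \<in> {0..1} \<Longrightarrow> x \<in> {0..R1} \<Longrightarrow> \<bar>f t x\<bar> \<le> C" using f_bounded by blast
  \<comment> \<open>\<open>A\<close> bounds the max-norm distance to the corner per unit of
    \<delta>: the summand 2 comes from adding \<open>b *\<^sub>R z\<close>, the rest from the
    rescaling by \<open>s\<close>.\<close>
  define A where "A = 2 + (1 / (2 * R0) + 1) / R0 * (R1 + 2)"
  have A: "0 < A" unfolding A_def using R0_pos R1_pos by (auto intro!: add_pos_nonneg mult_nonneg_nonneg)
  \<comment> \<open>\<open>R1\<close> pays for the change of |u|^2 / 2 and \<open>C * A\<close> for
    that of \<open>Psi\<close>; the bound 1 keeps \<open>p b\<close> below R1 + 2.\<close>
  define \<delta> where "\<delta> = min 1 (\<rho> / (2 * (R1 + C * A)))"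
  have CA: "0 < R1 + C * A" using R1_pos C A by (auto intro: add_pos_nonneg)
  have \<delta>: "0 < \<delta>" "\<delta> \<le> 1" unfolding \<delta>_def using \<rho> CA by auto
  have \<delta>\<rho>: "\<delta> * (R1 + C * A) \<le> \<rho> / 2"
  proof -
    have "\<delta> \<le> \<rho> / (2 * (R1 + C * A))" unfolding \<delta>_def by (rule min.cobounded2)
    then show ?thesis using CA by (simp add: field_simps)
  qed
  have "c + \<rho> / 2 \<le> En u" if u: "u \<in> S" and n: "R1 - \<delta> \<le> norm u" and l: "(l2 u)\<^sup>2 \<le> R0\<^sup>2 + \<delta>" for u
  proof -
    \<comment> \<open>The norm of \<open>z\<close> is so large that u + z has quotient l2 / norm at
      most R0 / R1, while the quotient of \<open>u\<close> is at least that. The intermediate value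
      theorem for \<open>h\<close> then finds a \<open>b\<close> with exactly this quotient.\<close>
    obtain z where z: "z \<in> Kcone" "\<And>t. \<bar>ap z t\<bar> \<le> 2 * \<delta>" "R1 + (R1 + \<delta>) * R1 / R0 \<le> norm z" "l2 z \<le> \<delta>"
      using small_large_cone[OF \<delta>(1)] by metis
    define p where "p b = u + b *\<^sub>R z" for b
    have pc: "p b \<in> Kcone" if "0 \<le> b" for b
      unfolding p_def using z(1) that by (intro cone_add cone_scale SD(1)[OF u])
    have lu: "l2 u \<le> R1" using L2_norm_ap_le[of u] SD(3)[OF u] by simp
    have lp: "l2 (p b) \<le> l2 u + \<delta>" if "0 \<le> b" "b \<le> 1" for b
    proof -
      have "l2 (p b) \<le> l2 u + b * l2 z" unfolding p_def using l2_triangle[of u "b *\<^sub>R z"] that by (simp add: l2_scale)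
      also have "b * l2 z \<le> 1 * \<delta>" using that z(4) by (intro mult_mono) auto
      finally show ?thesis by simp
    qed
    have lup: "l2 u \<le> l2 (p b)" if "0 \<le> b" for b
      unfolding p_def using cone_nonneg[OF SD(1)[OF u]] cone_nonneg[OF z(1)] that by (intro l2_mono) auto
    define h where "h b = R0 * norm (p b) - l2 (p b) * R1" for b
    have hc: "continuous_on {0..1} h"
      unfolding h_def p_def
      by (intro continuous_intros continuous_on_compose2[OF continuous_on_l2[of UNIV]]) auto
    have h0: "h 0 \<le> 0"
    proof -
      have "R0 * norm u \<le> l2 u * R1" using SD(2,3)[OF u] R0_pos by (intro mult_mono) auto
      then show ?thesis by (simp add: h_def p_def)
    qed
    have h1: "0 \<le> h 1"
    proof -
      have "(R1 + \<delta>) * R1 / R0 \<le> norm z - norm u" using z(3) SD(3)[OF u] by linarith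
      also have "\<dots> \<le> norm (p 1)" unfolding p_def using norm_diff_ineq[of z u] by (simp add: add.commute)
      finally have "(R1 + \<delta>) * R1 \<le> R0 * norm (p 1)" using R0_pos by (simp add: field_simps)
      moreover have "l2 (p 1) * R1 \<le> (R1 + \<delta>) * R1"
        using lp[of 1] lu R1_pos by (intro mult_right_mono) auto
      ultimately show ?thesis by (simp add: h_def)
    qed
    obtain b where b: "0 \<le> b" "b \<le> 1" "h b = 0"
      using IVT'[of h 0 0 1] h0 h1 hc by auto
    let ?l = "l2 (p b)"
    have lb: "R0 \<le> ?l" using lup[OF b(1)] SD(2)[OF u] by simp
    define s where "s = R0 / ?l"
    have s: "0 \<le> s" "s \<le> 1" using lb R0_pos by (auto simp: s_def divide_le_eq_1)
    define v where "v = s *\<^sub>R p b"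
    have lv: "l2 v = R0" using lb R0_pos by (simp add: v_def l2_scale s_def)
    have nv: "norm v = R1" using b(3) lb R0_pos by (simp add: v_def s_def h_def)
    have vS: "v \<in> S" unfolding S_def using lv nv pc[OF b(1)] s(1) by (simp add: v_def cone_scale)
    have lu2: "l2 u - R0 \<le> \<delta> / (2 * R0)"
    proof -
      have "(l2 u - R0) * (2 * R0) \<le> (l2 u - R0) * (l2 u + R0)"
        using SD(2)[OF u] by (intro mult_left_mono) auto
      also have "\<dots> = (l2 u)\<^sup>2 - R0\<^sup>2" by (simp add: power2_eq_square algebra_simps)
      also have "\<dots> \<le> \<delta>" using l by simp
      finally show ?thesis using R0_pos by (simp add: field_simps)
    qed
    have s1: "1 - s \<le> \<delta> * ((1 / (2 * R0) + 1) / R0)"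
    proof -
      have "1 - s = (?l - R0) / ?l" using lb R0_pos by (simp add: s_def field_simps)
      also have "\<dots> \<le> (\<delta> / (2 * R0) + \<delta>) / R0"
        using lp[OF b(1,2)] lu2 lb R0_pos \<delta>(1) by (intro frac_le) auto
      also have "\<dots> = \<delta> * ((1 / (2 * R0) + 1) / R0)" by (simp add: field_simps)
      finally show ?thesis .
    qed
    have close: "\<bar>ap v t - ap u t\<bar> \<le> \<delta> * A" for t
    proof -
      have bz: "\<bar>b * ap z t\<bar> \<le> 2 * \<delta>"
        using mult_mono[of "\<bar>b\<bar>" 1 "\<bar>ap z t\<bar>" "2 * \<delta>"] b z(2)[of t] by (simp add: abs_mult)
      have pb: "\<bar>ap (p b) t\<bar> \<le> R1 + 2"
        using bz abs_ap_le[of u t] SD(3)[OF u] \<delta>(2) unfolding p_def by (simp add: abs_le_iff)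
      have "ap v t - ap u t = b * ap z t - (1 - s) * ap (p b) t"
        by (simp add: v_def p_def algebra_simps)
      also have "\<bar>\<dots>\<bar> \<le> \<bar>b * ap z t\<bar> + \<bar>(1 - s) * ap (p b) t\<bar>" by (rule abs_triangle_ineq4)
      also have "\<bar>(1 - s) * ap (p b) t\<bar> \<le> (\<delta> * ((1 / (2 * R0) + 1) / R0)) * (R1 + 2)"
        unfolding abs_mult using s s1 pb R1_pos by (intro mult_mono) auto
      finally have "\<bar>ap v t - ap u t\<bar> \<le> 2 * \<delta> + \<delta> * ((1 / (2 * R0) + 1) / R0) * (R1 + 2)"
        using bz by linarith
      also have "\<dots> = \<delta> * A" by (simp add: A_def algebra_simps)
      finally show ?thesis .
    qed
    have "\<bar>Psi v - Psi u\<bar> \<le> C * (\<delta> * A)"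
      using vS u S_subset close by (intro Psi_lipschitz[OF C(2)]) auto
    moreover have "R1\<^sup>2 / 2 - \<delta> * R1 \<le> (norm u)\<^sup>2 / 2"
    proof (cases "R1 \<le> \<delta>")
      case True
      then have "R1 * R1 \<le> \<delta> * R1" using R1_pos by (intro mult_right_mono) auto
      moreover have "0 \<le> \<delta> * R1" using R1_pos \<delta>(1) by simp
      ultimately have "R1\<^sup>2 / 2 - \<delta> * R1 \<le> 0" by (simp add: power2_eq_square)
      also have "0 \<le> (norm u)\<^sup>2 / 2" by simp
      finally show ?thesis .
    next
      case False
      then have "(R1 - \<delta>)\<^sup>2 \<le> (norm u)\<^sup>2" using n by (intro power_mono) auto
      moreover have "0 \<le> \<delta>\<^sup>2" by simp
      moreover have "(R1 - \<delta>)\<^sup>2 = R1\<^sup>2 - 2 * (\<delta> * R1) + \<delta>\<^sup>2" by (simp add: power2_diff)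
      ultimately show ?thesis by linarith
    qed
    moreover have "c + \<rho> \<le> En v" by (rule corner[OF vS lv nv])
    moreover have "\<delta> * R1 + C * (\<delta> * A) \<le> \<rho> / 2" using \<delta>\<rho> by (simp add: algebra_simps)
    ultimately show ?thesis unfolding En_eq nv abs_le_iff by linarith
  qed
  then show ?thesis using that \<delta>(1) by blast
qed

text \<open>A single explicit step of length \<open>h\<close> along \<open>w u + \<lambda> T u\<close> replaces the deformation by a flow: the
  energy decrease is uniform because \<open>T\<close> and \<open>Nf\<close> are compact.  The multiplier \<open>\<lambda>\<close> is chosen so that
  \<open>2 h (T u, w u + \<lambda> T u) \<ge> R0\<^sup>2 - (l2 u)\<^sup>2\<close>, which keeps \<open>l2\<close> above \<open>R0\<close> exactly.\<close>

lemma deformation: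
  assumes nocrit: "\<And>u. u \<in> S \<Longrightarrow> Nf u = u \<Longrightarrow> En u \<noteq> c"
    and \<delta>: "0 < \<delta>" and corner: "\<And>u. u \<in> S \<Longrightarrow> R1 - \<delta> \<le> norm u \<Longrightarrow> (l2 u)\<^sup>2 \<le> R0\<^sup>2 + \<delta> \<Longrightarrow> c + \<delta> < En u"
    and e0: "e0 < c"
  shows "\<exists>\<epsilon> \<eta>. 0 < \<epsilon> \<and> continuous_on S \<eta>
    \<and> (\<forall>u\<in>S. En u \<le> c + \<epsilon> \<longrightarrow> \<eta> u \<in> S \<and> En (\<eta> u) \<le> c - \<epsilon>)
    \<and> (\<forall>u. En u \<le> e0 \<longrightarrow> \<eta> u = u)"
proof -
  \<comment> \<open>Bound for the multiplier: \<open>norm (w u) \<le> 2 * R1\<close> divided by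
    \<open>norm (T u) \<ge> R0\<^sup>2 / R1\<close>.\<close>
  define B where "B = 2 * R1 * R1 / R0\<^sup>2"
  obtain \<kappa> where \<kappa>: "0 < \<kappa>" "\<And>u m. u \<in> S \<Longrightarrow> 0 \<le> m \<Longrightarrow> m \<le> B \<Longrightarrow> \<bar>En u - c\<bar> \<le> \<kappa>
      \<Longrightarrow> m = 0 \<or> (l2 u)\<^sup>2 \<le> R0\<^sup>2 + \<kappa> \<Longrightarrow> \<kappa> \<le> norm (w u + m *\<^sub>R T u)"
    using no_critical_point_gradient_bound[OF nocrit, of B] by blast
  \<comment> \<open>As \<open>norm (\<xi> u) \<le> 4 * R1\<close>, the error of the first-order
    expansion of \<open>Psi\<close> costs at most a quarter of the descent \<kappa>^2.\<close>
  define \<tau> where "\<tau> = \<kappa>\<^sup>2 / (16 * R1)"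
  have \<tau>: "0 < \<tau>" unfolding \<tau>_def using \<kappa>(1) R1_pos by simp
  obtain d where d: "0 < d" "\<And>t x y. t \<in> {0..1} \<Longrightarrow> x \<in> {0..R1} \<Longrightarrow> y \<in> {0..R1} \<Longrightarrow> \<bar>x - y\<bar> < d \<Longrightarrow> \<bar>f t x - f t y\<bar> < \<tau>"
    using f_uniform[OF \<tau>] by blast
  \<comment> \<open>In order, the bounds on \<open>h\<close> serve: the convex combination; a
    positive multiplier only in the strips of width \<kappa> and \<delta>; a norm increase of at
    most \<delta>; a step shorter than \<open>d\<close>; a quadratic term of at most half the
    descent.\<close>
  have "\<exists>h>0. h \<le> 1 \<and> h * (4 * R1\<^sup>2) \<le> min \<kappa> \<delta> \<and> h * (4 * R1) \<le> \<delta> \<and> h * (8 * R1) \<le> d \<and> h * (8 * R1\<^sup>2) \<le> \<kappa>\<^sup>2 / 4"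
  proof -
    define h where "h = min 1 (min (min \<kappa> \<delta> / (4 * R1\<^sup>2)) (min (\<delta> / (4 * R1)) (min (d / (8 * R1)) (\<kappa>\<^sup>2 / 4 / (8 * R1\<^sup>2)))))"
    have p: "0 < 4 * R1\<^sup>2" "0 < 4 * R1" "0 < 8 * R1" "0 < 8 * R1\<^sup>2" using R1_pos by auto
    have "0 < h" unfolding h_def using p \<kappa>(1) \<delta> d(1) by (simp add: min_def)
    moreover have "h \<le> 1" "h \<le> min \<kappa> \<delta> / (4 * R1\<^sup>2)" "h \<le> \<delta> / (4 * R1)" "h \<le> d / (8 * R1)" "h \<le> \<kappa>\<^sup>2 / 4 / (8 * R1\<^sup>2)"
      unfolding h_def by linarith+
    ultimately show ?thesis
      using p unfolding pos_le_divide_eq[OF p(1)] pos_le_divide_eq[OF p(2)] pos_le_divide_eq[OF p(3)] pos_le_divide_eq[OF p(4)]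
      by blast
  qed
  then obtain h where h: "0 < h" "h \<le> 1" "h * (4 * R1\<^sup>2) \<le> min \<kappa> \<delta>" "h * (4 * R1) \<le> \<delta>" "h * (8 * R1) \<le> d" "h * (8 * R1\<^sup>2) \<le> \<kappa>\<^sup>2 / 4"
    by blast
  define b where "b u = inner (T u) (w u)" for u
  define tt where "tt u = inner (T u) (T u)" for u
  define lam where "lam u = max 0 ((- b u - ((l2 u)\<^sup>2 - R0\<^sup>2) / (2 * h)) / tt u)" for u
  define \<xi> where "\<xi> u = w u + lam u *\<^sub>R T u" for u
  \<comment> \<open>The levels between c - 2 \<epsilon>1 and c + \<epsilon>1 stay within \<kappa> of
    \<open>c\<close>, below the corner energies and not below \<open>e0\<close>.\<close>
  define \<epsilon>1 where "\<epsilon>1 = min (\<kappa> / 2) (min \<delta> ((c - e0) / 2))"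
  have "0 < \<epsilon>1" unfolding \<epsilon>1_def using \<kappa>(1) \<delta> e0 by simp
  moreover have "\<epsilon>1 \<le> \<kappa> / 2" unfolding \<epsilon>1_def by (rule min.cobounded1)
  moreover have "\<epsilon>1 \<le> \<delta>" unfolding \<epsilon>1_def by linarith
  moreover have "\<epsilon>1 \<le> (c - e0) / 2" unfolding \<epsilon>1_def by linarith
  ultimately have \<epsilon>1: "0 < \<epsilon>1" "\<epsilon>1 \<le> \<kappa> / 2" "\<epsilon>1 \<le> \<delta>" "\<epsilon>1 \<le> (c - e0) / 2" by blast+
  \<comment> \<open>The cutoff is 0 below c - 2 \<epsilon>1, which fixes the points of low energy,
    and 1 above c - \<epsilon>1, where the full step is taken.\<close>
  define cut where "cut u = min 1 (max 0 ((En u - (c - 2 * \<epsilon>1)) / \<epsilon>1))" for u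
  have cut01: "0 \<le> cut u" "cut u \<le> 1" for u by (auto simp: cut_def)
  define \<eta> where "\<eta> u = u + (h * cut u) *\<^sub>R \<xi> u" for u
  define \<epsilon> where "\<epsilon> = min \<epsilon>1 (h * \<kappa>\<^sup>2 / 4)"
  have \<epsilon>: "0 < \<epsilon>" "\<epsilon> \<le> \<epsilon>1" "\<epsilon> \<le> h * \<kappa>\<^sup>2 / 4" unfolding \<epsilon>_def using \<epsilon>1 h(1) \<kappa>(1) by auto
  have tt: "0 < tt u" if "u \<in> S" for u unfolding tt_def by (rule inner_T_self_pos[OF that])
  have wc: "continuous_on S w" unfolding w_def[abs_def] by (intro continuous_intros cont_Nf_S)
  have lamc: "continuous_on S lam"
    unfolding lam_def b_def tt_def
    using inner_T_self_pos h(1) by (intro continuous_intros continuous_on_T continuous_on_l2 wc) (auto simp: less_le)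
  have cutc: "continuous_on S cut" unfolding cut_def using \<epsilon>1(1) by (intro continuous_intros cont_En_S) auto
  have \<eta>c: "continuous_on S \<eta>" unfolding \<eta>_def \<xi>_def by (intro continuous_intros cutc wc lamc continuous_on_T)
  have low: "\<eta> u = u" if "En u \<le> c - 2 * \<epsilon>1" for u
  proof -
    have "(En u - (c - 2 * \<epsilon>1)) / \<epsilon>1 \<le> 0" using that \<epsilon>1(1) by (simp add: divide_nonpos_pos)
    then have "cut u = 0" by (simp add: cut_def)
    then show ?thesis by (simp add: \<eta>_def)
  qed
  have main: "\<eta> u \<in> S \<and> En (\<eta> u) \<le> En u - h * cut u * (\<kappa>\<^sup>2 / 2)"
    if u: "u \<in> S" and E: "En u \<le> c + \<epsilon>" and E': "c - 2 * \<epsilon>1 < En u" for u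
  proof -
    note uc = SD(1)[OF u] and Nc = SD(1)[OF Nf_S[OF u]] and Tc = T_cone[OF SD(1)[OF u]]
    have Eb: "\<bar>En u - c\<bar> \<le> \<kappa>" using E E' \<epsilon>(2) \<epsilon>1(2) by linarith
    have l0: "0 \<le> (l2 u)\<^sup>2 - R0\<^sup>2" using SD(2)[OF u] R0_pos by (simp add: power_mono)
    have nT: "0 < norm (T u)" using tt[OF u] by (simp add: tt_def)
    have tt_n: "tt u = (norm (T u))\<^sup>2" by (simp add: tt_def dot_square_norm)
    have b_le: "\<bar>b u\<bar> \<le> norm (T u) * norm (w u)" unfolding b_def by (rule Cauchy_Schwarz_ineq2)
    have lam0: "0 \<le> lam u" by (simp add: lam_def)
    \<comment> \<open>If \<open>b u < 0\<close>, this multiplier makes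
      \<open>w u + mu *\<^sub>R T u\<close> orthogonal to \<open>T u\<close>. The gradient bound is
      applied with \<open>mu\<close>, whereas the step uses the smaller, continuous
      \<open>lam\<close>.\<close>
    define mu where "mu = max 0 (- b u / tt u)"
    have lam_mu: "lam u \<le> mu"
    proof -
      have "(- b u - ((l2 u)\<^sup>2 - R0\<^sup>2) / (2 * h)) / tt u \<le> - b u / tt u"
        using l0 h(1) tt[OF u] by (intro divide_right_mono) auto
      then show ?thesis unfolding lam_def mu_def by linarith
    qed
    have mu_T: "mu * norm (T u) \<le> norm (w u)"
    proof -
      have "- b u / tt u * norm (T u) = - b u / norm (T u)" using nT by (simp add: tt_n power2_eq_square)
      also have "\<dots> \<le> norm (w u)"
        unfolding pos_divide_le_eq[OF nT] using b_le by (simp add: mult.commute abs_le_iff)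
      finally show ?thesis using nT by (auto simp: mu_def max_def)
    qed
    have mu_B: "mu \<le> B"
    proof -
      have "mu * (R0\<^sup>2 / R1) \<le> mu * norm (T u)"
        using norm_T_lower[OF u] by (intro mult_left_mono) (auto simp: mu_def)
      also have "\<dots> \<le> 2 * R1" using mu_T norm_w[OF u] by simp
      finally show ?thesis using R0_pos R1_pos by (simp add: B_def field_simps)
    qed
    have \<xi>n: "norm (\<xi> u) \<le> 4 * R1"
    proof -
      have "norm (\<xi> u) \<le> norm (w u) + lam u * norm (T u)"
        unfolding \<xi>_def using norm_triangle_ineq[of "w u" "lam u *\<^sub>R T u"] lam0 by simp
      also have "lam u * norm (T u) \<le> mu * norm (T u)" using lam_mu by (intro mult_right_mono) auto
      finally show ?thesis using mu_T norm_w[OF u] by simp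
    qed
    have active: "(l2 u)\<^sup>2 \<le> R0\<^sup>2 + h * (4 * R1\<^sup>2) \<and> b u < 0" if "0 < lam u"
    proof -
      have "0 < (- b u - ((l2 u)\<^sup>2 - R0\<^sup>2) / (2 * h)) / tt u" using that by (simp add: lam_def)
      then have *: "((l2 u)\<^sup>2 - R0\<^sup>2) / (2 * h) < - b u" using tt[OF u] by (simp add: zero_less_divide_iff)
      have "0 \<le> ((l2 u)\<^sup>2 - R0\<^sup>2) / (2 * h)" using l0 h(1) by simp
      then have bn: "b u < 0" using * by linarith
      have "norm (T u) * norm (w u) \<le> R1 * (2 * R1)"
        using norm_T_upper[OF u] norm_w[OF u] R1_pos by (intro mult_mono) auto
      then have "- b u \<le> 2 * R1\<^sup>2" using b_le by (simp add: power2_eq_square abs_le_iff)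
      then have "((l2 u)\<^sup>2 - R0\<^sup>2) / (2 * h) \<le> 2 * R1\<^sup>2" using * by linarith
      then have "(l2 u)\<^sup>2 - R0\<^sup>2 \<le> 2 * R1\<^sup>2 * (2 * h)" using h(1) by (simp add: pos_divide_le_eq)
      then show ?thesis using bn by (simp add: mult_ac)
    qed
    \<comment> \<open>With an active multiplier, b < 0 and lam <= mu give (w, \<xi>) = |w|^2 + lam b
      >= |w|^2 + mu b, and the right-hand side is |w + mu T u|^2 by orthogonality.\<close>
    have descent: "\<kappa>\<^sup>2 \<le> inner (w u) (\<xi> u)"
    proof (cases "lam u = 0")
      case True
      have "\<kappa> \<le> norm (w u + 0 *\<^sub>R T u)"
        using R0_pos R1_pos by (intro \<kappa>(2) u Eb) (auto simp: B_def)
      then have "\<kappa>\<^sup>2 \<le> (norm (w u))\<^sup>2" using \<kappa>(1) by (intro power_mono) auto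
      then show ?thesis by (simp add: \<xi>_def True dot_square_norm)
    next
      case False
      then have lp: "0 < lam u" using lam0 by simp
      note act = active[OF lp]
      then have mu: "mu = - b u / tt u" "0 \<le> mu"
        using tt[OF u] by (auto simp: mu_def max_def divide_le_0_iff split: if_splits)
      have "\<kappa> \<le> norm (w u + mu *\<^sub>R T u)"
        using act h(3) by (intro \<kappa>(2) u Eb mu_B mu(2)) auto
      then have "\<kappa>\<^sup>2 \<le> (norm (w u + mu *\<^sub>R T u))\<^sup>2" using \<kappa>(1) by (intro power_mono) auto
      also have "\<dots> = inner (w u) (w u) + 2 * (mu * b u) + mu * (mu * tt u)"
        unfolding dot_square_norm[symmetric] b_def tt_def
        by (simp add: inner_add_left inner_add_right inner_commute algebra_simps)
      also have "mu * tt u = - b u" using tt[OF u] mu by simp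
      also have "inner (w u) (w u) + 2 * (mu * b u) + mu * - b u = inner (w u) (w u) + mu * b u" by simp
      also have "\<dots> \<le> inner (w u) (w u) + lam u * b u"
        using lam_mu act by (simp add: mult_right_mono_neg)
      also have "\<dots> = inner (w u) (\<xi> u)" unfolding \<xi>_def b_def by (simp add: inner_add_right inner_commute)
      finally show ?thesis .
    qed
    define k where "k = h * cut u"
    have k: "0 \<le> k" "k \<le> h" "k \<le> 1"
      unfolding k_def using cut01[of u] h(1,2) by (auto intro: mult_le_one mult_left_le)
    have \<eta>k: "\<eta> u = u + k *\<^sub>R \<xi> u" by (simp add: \<eta>_def k_def)
    \<comment> \<open>Written as a convex combination of elements of the cone; the direction \<xi>
      itself need not lie in the cone.\<close>
    have \<eta>conv: "\<eta> u = (1 - k) *\<^sub>R u + k *\<^sub>R (Nf u + lam u *\<^sub>R T u)"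
      by (simp add: \<eta>k \<xi>_def w_def algebra_simps)
    have \<eta>cone: "\<eta> u \<in> Kcone" unfolding \<eta>conv using k lam0 by (intro cone_add cone_scale uc Nc Tc) auto
    have \<eta>norm: "norm (\<eta> u) \<le> R1"
    proof (cases "lam u = 0")
      case True
      have "norm (\<eta> u) \<le> (1 - k) * norm u + k * norm (Nf u)"
        unfolding \<eta>conv True using norm_triangle_ineq[of "(1 - k) *\<^sub>R u" "k *\<^sub>R Nf u"] k by simp
      also have "\<dots> \<le> (1 - k) * R1 + k * R1"
        using k SD(3)[OF u] SD(3)[OF Nf_S[OF u]] by (intro add_mono mult_left_mono) auto
      finally show ?thesis by (simp add: algebra_simps)
    next
      case False
      then have "(l2 u)\<^sup>2 \<le> R0\<^sup>2 + \<delta>" using active lam0 h(3) by force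
      then have nu: "norm u < R1 - \<delta>" using corner[OF u] E \<epsilon>(2) \<epsilon>1(3) by force
      have "norm (\<eta> u) \<le> norm u + k * norm (\<xi> u)" unfolding \<eta>k using norm_triangle_ineq[of u "k *\<^sub>R \<xi> u"] k by simp
      also have "k * norm (\<xi> u) \<le> h * (4 * R1)" using k \<xi>n by (intro mult_mono) auto
      finally show ?thesis using nu h(4) by linarith
    qed
    have \<eta>l2: "R0 \<le> l2 (\<eta> u)"
    proof (rule power2_le_imp_le)
      have "(- b u - (((l2 u)\<^sup>2 - R0\<^sup>2) / (2 * h))) / tt u \<le> lam u" by (simp add: lam_def)
      then have "- (((l2 u)\<^sup>2 - R0\<^sup>2) / (2 * h)) \<le> b u + lam u * tt u"
        unfolding pos_divide_le_eq[OF tt[OF u]] by linarith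
      also have "b u + lam u * tt u = inner (T u) (\<xi> u)" by (simp add: b_def tt_def \<xi>_def inner_add_right)
      finally have "k * (- (((l2 u)\<^sup>2 - R0\<^sup>2) / (2 * h))) \<le> k * inner (T u) (\<xi> u)" using k by (intro mult_left_mono) auto
      then have "2 * (k * - (((l2 u)\<^sup>2 - R0\<^sup>2) / (2 * h))) \<le> 2 * (k * inner (T u) (\<xi> u))"
        by (rule mult_left_mono) simp
      also have "2 * (k * - (((l2 u)\<^sup>2 - R0\<^sup>2) / (2 * h))) = - (cut u * ((l2 u)\<^sup>2 - R0\<^sup>2))"
        using h(1) by (simp add: k_def field_simps)
      finally have a: "- (cut u * ((l2 u)\<^sup>2 - R0\<^sup>2)) \<le> 2 * (k * inner (T u) (\<xi> u))" .
      have "cut u * ((l2 u)\<^sup>2 - R0\<^sup>2) \<le> 1 * ((l2 u)\<^sup>2 - R0\<^sup>2)" using cut01[of u] l0 by (intro mult_right_mono) auto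
      then have "R0\<^sup>2 \<le> (l2 u)\<^sup>2 + - (cut u * ((l2 u)\<^sup>2 - R0\<^sup>2)) + 0" by simp
      \<comment> \<open>The second-order term of the square is nonnegative, so the first-order
        condition on the multiplier suffices.\<close>
      also have "\<dots> \<le> (l2 u)\<^sup>2 + 2 * (k * inner (T u) (\<xi> u)) + (l2 (k *\<^sub>R \<xi> u))\<^sup>2"
        by (intro add_mono a order_refl zero_le_power2)
      also have "\<dots> = (l2 (\<eta> u))\<^sup>2" unfolding \<eta>k l2_sq_add by simp
      finally show "R0\<^sup>2 \<le> (l2 (\<eta> u))\<^sup>2" .
    qed simp
    have \<eta>S: "\<eta> u \<in> S" using \<eta>cone \<eta>norm \<eta>l2 by (simp add: S_def)
    have "norm (\<eta> u - u) = k * norm (\<xi> u)" using k by (simp add: \<eta>k)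
    moreover have "k * norm (\<xi> u) \<le> h * (4 * R1)" using k \<xi>n by (intro mult_mono) auto
    moreover have "0 < h * (4 * R1)" using h(1) R1_pos by simp
    ultimately have "norm (\<eta> u - u) < d" using h(5) by linarith
    then have "\<bar>Psi (\<eta> u) - Psi u - inner (Nf u) (\<eta> u - u)\<bar> \<le> \<tau> * norm (\<eta> u - u)"
      using u \<eta>S S_subset by (intro Psi_first_order[OF d(2)]) auto
    then have e1: "Psi u + k * inner (Nf u) (\<xi> u) - \<tau> * norm (\<eta> u - u) \<le> Psi (\<eta> u)"
      by (simp add: \<eta>k abs_le_iff)
    have e2: "\<tau> * norm (\<eta> u - u) \<le> k * \<kappa>\<^sup>2 / 4"
    proof -
      have "\<tau> * norm (\<xi> u) \<le> \<tau> * (4 * R1)" using \<xi>n \<tau> by (intro mult_left_mono) auto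
      also have "\<dots> = \<kappa>\<^sup>2 / 4" using R1_pos by (simp add: \<tau>_def)
      finally have "k * (\<tau> * norm (\<xi> u)) \<le> k * (\<kappa>\<^sup>2 / 4)" using k by (intro mult_left_mono) auto
      then show ?thesis using k by (simp add: \<eta>k mult.left_commute)
    qed
    have e3: "(norm (\<eta> u))\<^sup>2 = (norm u)\<^sup>2 + 2 * (k * inner u (\<xi> u)) + k * (k * (norm (\<xi> u))\<^sup>2)"
      unfolding dot_square_norm[symmetric] \<eta>k
      by (simp add: inner_add_left inner_add_right inner_commute algebra_simps)
    have "k * (norm (\<xi> u))\<^sup>2 \<le> h * (4 * R1)\<^sup>2"
      using k h(1) \<xi>n by (intro mult_mono power_mono) auto
    also have "\<dots> \<le> \<kappa>\<^sup>2 / 2" using h(6) by (simp add: power2_eq_square)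
    finally have e4: "k * (k * (norm (\<xi> u))\<^sup>2) \<le> k * \<kappa>\<^sup>2 / 2"
      using mult_left_mono[OF _ k(1)] by fastforce
    have "k * \<kappa>\<^sup>2 \<le> k * inner (w u) (\<xi> u)" using descent k by (intro mult_left_mono) auto
    then have e5: "k * \<kappa>\<^sup>2 \<le> k * inner (Nf u) (\<xi> u) - k * inner u (\<xi> u)"
      by (simp add: w_def inner_diff_left right_diff_distrib)
    \<comment> \<open>Here q = k \<kappa>^2 is the descent. The error of \<open>Psi\<close> takes q
      / 4, half of the quadratic norm term takes another q / 4, and q / 2 remains.\<close>
    have arith: "n1 / 2 - p1 \<le> n0 / 2 - p0 - q / 2"
      if "p0 + a - e \<le> p1" "e \<le> q / 4" "n1 = n0 + 2 * b' + s" "s \<le> q / 2" "q \<le> a - b'"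
      for n0 n1 p0 p1 a b' e q s :: real using that by linarith
    have "En (\<eta> u) \<le> En u - k * \<kappa>\<^sup>2 / 2"
      unfolding En_eq by (rule arith[OF e1 e2 e3 e4 e5])
    then show ?thesis using \<eta>S by (simp add: k_def)
  qed
  show ?thesis
  proof (intro exI conjI ballI allI impI)
    show "0 < \<epsilon>" "continuous_on S \<eta>" by fact+
    show "\<eta> u = u" if "En u \<le> e0" for u using low that \<epsilon>1(4) by simp
    fix u assume u: "u \<in> S" and E: "En u \<le> c + \<epsilon>"
    consider "En u \<le> c - 2 * \<epsilon>1" | "c - 2 * \<epsilon>1 < En u" "En u \<le> c - \<epsilon>1" | "c - \<epsilon>1 < En u" by linarith
    then have "\<eta> u \<in> S \<and> En (\<eta> u) \<le> c - \<epsilon>"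
    proof cases
      case 1
      then show ?thesis using low[of u] u \<epsilon>(2) \<epsilon>1(1) by simp
    next
      case 2
      have "0 \<le> h * cut u * (\<kappa>\<^sup>2 / 2)" using h(1) cut01[of u] by simp
      then show ?thesis using main[OF u E 2(1)] 2(2) \<epsilon>(2) by linarith
    next
      case 3
      then have "1 \<le> (En u - (c - 2 * \<epsilon>1)) / \<epsilon>1" using \<epsilon>1(1) by (simp add: pos_le_divide_eq)
      then have "cut u = 1" by (simp add: cut_def)
      moreover have "c - 2 * \<epsilon>1 < En u" using 3 \<epsilon>1(1) by linarith
      \<comment> \<open>A full step lowers the energy by h \<kappa>^2 / 2 >= 2 \<epsilon>, enough to
        cross from c + \<epsilon> to c - \<epsilon>.\<close>
      moreover have "2 * (h * \<kappa>\<^sup>2 / 4) = h * 1 * (\<kappa>\<^sup>2 / 2)" by simp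
      ultimately show ?thesis using main[OF u E] E \<epsilon>(3) by fastforce
    qed
    then show "\<eta> u \<in> S" "En (\<eta> u) \<le> c - \<epsilon>" by auto
  qed
qed

text \<open>A fixed point is \<open>J\<close> of a continuous function, so its four derivatives and
  the conditions at 1 are those of \<open>J\<close>. It is nonzero because the cone inequality at 1
  reads u(1) >= 2/3 ||u||.\<close>

lemma fixed_point_solution:
  assumes u: "u \<in> S" and fp: "Nf u = u"
  shows "positive_solution f (ap u)"
proof -
  let ?v = "\<lambda>t. f t (ap u t)"
  have v: "continuous_on {0..1} ?v" by (rule f_comp_cont[OF ap_cont])
  have J: "ap u t = J ?v t" if "t \<in> {0..1}" for t
    using ap_solJ[OF v that] fp unfolding Nf_def by simp
  define D where "D k = (if k = 0 then ap u else if k = 1 then J1 ?v else if k = 2 then J2 ?v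
    else if k = 3 then J3 ?v else ?v)" for k :: nat
  have d0: "(ap u has_real_derivative J1 ?v t) (at t within {0..1})" if "t \<in> {0..1}" for t
    by (rule has_field_derivative_transform_within[OF J_deriv(1)[OF v that], of 1]) (use that J in auto)
  have "(D k has_real_derivative D (Suc k) t) (at t within {0..1})" if k: "k < 4" and t: "t \<in> {0..1}" for k t
  proof -
    consider "k = 0" | "k = 1" | "k = 2" | "k = 3" using k by linarith
    then show ?thesis
      by cases (use d0 J_deriv[OF v] t in \<open>simp_all add: D_def\<close>)
  qed
  then have "bvp_solution f (ap u)"
    unfolding bvp_solution_def using v J_boundary by (intro exI[of _ D]) (simp add: D_def)
  moreover have "0 < ap u 1"
  proof -
    have "0 < M 1 * l2 u" using SD(2)[OF u] R0_pos by (simp add: M_def)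
    also have "\<dots> \<le> ap u 1" using cone_lower[OF SD(1)[OF u], of 1] by simp
    finally show ?thesis .
  qed
  moreover have "\<forall>t\<in>{0..1}. 0 \<le> ap u t" using cone_nonneg[OF SD(1)[OF u]] by blast
  ultimately show ?thesis
    unfolding positive_solution_def by (auto intro!: bexI[of _ 1])
qed

section \<open>Paths in the shell\<close>

lemma norm_S_pos: "x \<in> S \<Longrightarrow> 0 < norm x"
  using L2_norm_ap_le[of x] SD(2)[of x] R0_pos by linarith

text \<open>The inequalities between consecutive moments \<open>(x, x)\<close>, \<open>(T x, x)\<close>, \<open>(T x, T x)\<close>, \<open>(T (T x), T x)\<close>
  show that moving from \<open>x\<close> towards \<open>T x\<close> does not decrease the quotient \<open>l2 x / norm x\<close>.\<close>

lemma moments: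
  assumes x: "x \<in> S"
  shows "(inner (T x) x)\<^sup>2 \<le> (norm x)\<^sup>2 * inner (T x) (T x)"
    and "inner (T x) x * inner (T x) (T x) \<le> (norm x)\<^sup>2 * (l2 (T x))\<^sup>2"
proof -
  define m0 m1 m2 m3 where m: "m0 = (norm x)\<^sup>2" "m1 = inner (T x) x" "m2 = inner (T x) (T x)" "m3 = (l2 (T x))\<^sup>2"
  have "(inner (T x) x)\<^sup>2 \<le> inner (T x) (T x) * inner x x" by (rule Cauchy_Schwarz_ineq)
  then show 1: "(inner (T x) x)\<^sup>2 \<le> (norm x)\<^sup>2 * inner (T x) (T x)" by (simp add: dot_square_norm mult.commute)
  have p1: "0 < m1" unfolding m using SD(2)[OF x] R0_pos by (simp add: l2_sq[symmetric])
  have p2: "0 < m2" unfolding m by (rule inner_T_self_pos[OF x])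
  have 2: "m2\<^sup>2 \<le> m1 * m3"
  proof -
    have "m2 \<le> l2 x * l2 (T x)" unfolding m by (rule inner_T_le)
    then have "m2\<^sup>2 \<le> (l2 x * l2 (T x))\<^sup>2" using p2 by (intro power_mono) auto
    then show ?thesis by (simp add: m power_mult_distrib l2_sq)
  qed
  have "m1\<^sup>2 * m2\<^sup>2 \<le> (m0 * m2) * (m1 * m3)"
    using 1 2 unfolding m by (intro mult_mono) auto
  then have "(m1 * m2) * (m1 * m2) \<le> (m0 * m3) * (m1 * m2)" by (simp add: power2_eq_square mult_ac)
  then have "m1 * m2 \<le> m0 * m3" using p1 p2 by (simp add: mult_le_cancel_right)
  then show "inner (T x) x * inner (T x) (T x) \<le> (norm x)\<^sup>2 * (l2 (T x))\<^sup>2" by (simp add: m)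
qed

lemma norm_sq_add_T: "(norm (x + s *\<^sub>R T x))\<^sup>2 = (norm x)\<^sup>2 + 2 * s * inner (T x) x + s\<^sup>2 * inner (T x) (T x)"
  unfolding dot_square_norm[symmetric]
  by (simp add: inner_add_left inner_add_right inner_commute power2_eq_square algebra_simps)

lemma l2_sq_add_T: "(l2 (x + s *\<^sub>R T x))\<^sup>2 = inner (T x) x + 2 * s * inner (T x) (T x) + s\<^sup>2 * (l2 (T x))\<^sup>2"
  unfolding l2_sq_add l2_scale power_mult_distrib power2_abs l2_sq[of x] by simp

text \<open>The difference of the two sides is a polynomial in \<open>s\<close> without constant
  term; its coefficients are the two moment inequalities.\<close>

lemma quotient_sq_le:
  assumes x: "x \<in> S" and s: "0 \<le> s"
  shows "(norm (x + s *\<^sub>R T x))\<^sup>2 * (l2 x)\<^sup>2 \<le> (l2 (x + s *\<^sub>R T x))\<^sup>2 * (norm x)\<^sup>2"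
proof -
  have "0 \<le> 2 * s * ((norm x)\<^sup>2 * inner (T x) (T x) - (inner (T x) x)\<^sup>2)
      + s\<^sup>2 * ((norm x)\<^sup>2 * (l2 (T x))\<^sup>2 - inner (T x) x * inner (T x) (T x))"
    using moments[OF x] s by (intro add_nonneg_nonneg mult_nonneg_nonneg) auto
  then show ?thesis unfolding norm_sq_add_T l2_sq_add_T l2_sq[of x]
    by (simp add: algebra_simps power2_eq_square)
qed

lemma quotient_le:
  assumes x: "x \<in> S" and s: "0 \<le> s"
  shows "norm (x + s *\<^sub>R T x) * l2 x \<le> l2 (x + s *\<^sub>R T x) * norm x"
  by (rule power2_le_imp_le) (use quotient_sq_le[OF assms] in \<open>simp_all add: power_mult_distrib\<close>)

lemma norm_add_T_pos: "x \<in> S \<Longrightarrow> 0 \<le> s \<Longrightarrow> 0 < norm (x + s *\<^sub>R T x)"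
proof -
  assume x: "x \<in> S" and s: "0 \<le> s"
  have "0 < (norm x)\<^sup>2 + 2 * s * inner (T x) x + s\<^sup>2 * inner (T x) (T x)"
    using norm_S_pos[OF x] s by (intro add_pos_nonneg mult_nonneg_nonneg inner_T_nonneg) auto
  then show ?thesis unfolding norm_sq_add_T[symmetric] by simp
qed

text \<open>The scalar factor prescribes the norm, which moves linearly from that of
  \<open>x\<close> to R1. As the quotient l2 / norm does not decrease and the norm grows,
  \<open>l2\<close> cannot fall below its initial value.\<close>

definition lift :: "real \<Rightarrow> xs \<Rightarrow> xs" where
  "lift s x = (((1 - s) * norm x + s * R1) / norm (x + s *\<^sub>R T x)) *\<^sub>R (x + s *\<^sub>R T x)"

lemma lift_0: "x \<in> S \<Longrightarrow> lift 0 x = x"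
  using norm_S_pos[of x] by (simp add: lift_def)

lemma lift_S:
  assumes x: "x \<in> S" and s: "0 \<le> s" "s \<le> 1"
  shows "lift s x \<in> S"
proof -
  define k where "k = (1 - s) * norm x + s * R1"
  let ?y = "x + s *\<^sub>R T x"
  have y: "0 < norm ?y" by (rule norm_add_T_pos[OF x s(1)])
  have "s * norm x \<le> s * R1" using s SD(3)[OF x] by (intro mult_left_mono) auto
  then have k1: "norm x \<le> k" by (simp add: k_def algebra_simps)
  have "(1 - s) * norm x \<le> (1 - s) * R1" using s SD(3)[OF x] by (intro mult_left_mono) auto
  then have k2: "k \<le> R1" by (simp add: k_def algebra_simps)
  have k0: "0 \<le> k" using k1 norm_S_pos[OF x] by linarith
  have eq: "lift s x = (k / norm ?y) *\<^sub>R ?y" by (simp add: lift_def k_def)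
  have "lift s x \<in> Kcone" unfolding eq
    using SD(1)[OF x] T_cone k0 s by (intro cone_scale cone_add) auto
  moreover have "norm (lift s x) \<le> R1" unfolding eq using y k0 k2 by simp
  moreover have "R0 \<le> l2 (lift s x)"
  proof -
    have "l2 x * norm ?y \<le> norm x * l2 ?y" using quotient_le[OF x s(1)] by (simp add: mult.commute)
    also have "\<dots> \<le> k * l2 ?y" using k1 by (intro mult_right_mono) auto
    finally have "l2 x \<le> k / norm ?y * l2 ?y" using y by (simp add: pos_le_divide_eq)
    also have "\<dots> = l2 (lift s x)" unfolding eq using k0 by (simp add: l2_scale)
    finally show ?thesis using SD(2)[OF x] by simp
  qed
  ultimately show ?thesis by (simp add: S_def)
qed

text \<open>In the case of equality \<open>x\<close> would be a positive eigenfunction, hence extremal, and its quotient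
  would be at least that of \<open>phi\<close>.\<close>

lemma lift_1_interior:
  assumes x: "x \<in> S" shows "R0 < l2 (lift 1 x)"
proof (rule ccontr)
  assume c: "\<not> R0 < l2 (lift 1 x)"
  let ?y = "x + T x"
  have y: "0 < norm ?y" using norm_add_T_pos[OF x, of 1] by simp
  have nx: "0 < norm x" by (rule norm_S_pos[OF x])
  have lx: "0 < l2 x" using SD(2)[OF x] R0_pos by simp
  have q: "norm ?y * l2 x \<le> l2 ?y * norm x" using quotient_le[OF x, of 1] by simp
  have "l2 (lift 1 x) = R1 * l2 ?y / norm ?y" using R1_pos by (simp add: lift_def l2_scale)
  then have "R1 * l2 ?y / norm ?y \<le> R0" using c by simp
  then have le: "R1 * l2 ?y \<le> R0 * norm ?y" unfolding pos_divide_le_eq[OF y] .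
  have "R1 * (norm ?y * l2 x) \<le> R1 * (l2 ?y * norm x)" using q R1_pos by (intro mult_left_mono) auto
  also have "\<dots> = (R1 * l2 ?y) * norm x" by simp
  also have "\<dots> \<le> (R0 * norm ?y) * norm x" using le by (intro mult_right_mono) auto
  finally have "norm ?y * (R1 * l2 x) \<le> norm ?y * (R0 * norm x)" by (simp add: mult_ac)
  then have R: "R1 * l2 x \<le> R0 * norm x" using y by (simp add: mult_le_cancel_left)
  have "R1 * (l2 ?y * norm x) \<le> (R0 * norm ?y) * norm x" using le nx by simp
  also have "\<dots> = (R0 * norm x) * norm ?y" by simp
  also have "\<dots> \<le> (R1 * l2 x) * norm ?y"
    using SD(2,3)[OF x] R0_pos R1_pos mult_mono[of R0 "l2 x" "norm x" R1] by (intro mult_right_mono) (auto simp: mult.commute)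
  also have "\<dots> = R1 * (norm ?y * l2 x)" by simp
  finally have "l2 ?y * norm x \<le> norm ?y * l2 x" using R1_pos by (simp add: mult_le_cancel_left)
  then have "(l2 ?y * norm x)\<^sup>2 \<le> (norm ?y * l2 x)\<^sup>2" by (intro power_mono) auto
  then have "(l2 ?y)\<^sup>2 * (norm x)\<^sup>2 \<le> (norm ?y)\<^sup>2 * (l2 x)\<^sup>2" by (simp add: power_mult_distrib)
  then have "(inner (T x) x + 2 * inner (T x) (T x) + (l2 (T x))\<^sup>2) * (norm x)\<^sup>2
      \<le> ((norm x)\<^sup>2 + 2 * inner (T x) x + inner (T x) (T x)) * inner (T x) x"
    using norm_sq_add_T[of x 1] l2_sq_add_T[of x 1] l2_sq[of x] by simp
  then have "(norm x)\<^sup>2 * inner (T x) (T x) \<le> (inner (T x) x)\<^sup>2"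
    using moments(2)[OF x] unfolding power2_eq_square[of "inner (T x) x"] by (simp add: algebra_simps)
  \<comment> \<open>This is equality in Cauchy-Schwarz for \<open>T x\<close> and \<open>x\<close>,
    hence the two are proportional; \<mu> below is the factor.\<close>
  then have eq: "(norm x)\<^sup>2 * inner (T x) (T x) = (inner (T x) x)\<^sup>2" using moments(1)[OF x] by simp
  define \<mu> where "\<mu> = (norm x)\<^sup>2 / (l2 x)\<^sup>2"
  have \<mu>l: "\<mu> * (l2 x)\<^sup>2 = (norm x)\<^sup>2" using lx by (simp add: \<mu>_def)
  have "(norm (x - \<mu> *\<^sub>R T x))\<^sup>2 = (norm x)\<^sup>2 - 2 * \<mu> * (l2 x)\<^sup>2 + \<mu> * (\<mu> * inner (T x) (T x))"
    unfolding dot_square_norm[symmetric] l2_sq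
    by (simp add: inner_diff_left inner_diff_right inner_commute algebra_simps)
  also have "\<mu> * inner (T x) (T x) = (l2 x)\<^sup>2"
    unfolding \<mu>_def using eq lx by (simp add: l2_sq[symmetric] power2_eq_square)
  finally have "(norm (x - \<mu> *\<^sub>R T x))\<^sup>2 = 0" using \<mu>l by simp
  then have ev: "x = \<mu> *\<^sub>R T x" by simp
  obtain p C where p: "norm p \<le> 1" "L2_norm phi = l2 p" "\<And>t. t \<in> {0..1} \<Longrightarrow> \<bar>ap p t\<bar> \<le> C * t\<^sup>2"
    using phi_representation by blast
  have "\<mu> * (l2 p)\<^sup>2 \<le> (norm p)\<^sup>2"
    by (rule positive_eigenfunction_extremal[OF SD(1)[OF x] lx ev p(3)])
  also have "\<dots> \<le> 1" using p(1) by (simp add: power_le_one)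
  finally have "(\<mu> * (l2 p)\<^sup>2) * (l2 x)\<^sup>2 \<le> 1 * (l2 x)\<^sup>2" by (intro mult_right_mono) auto
  then have "(norm x)\<^sup>2 * (l2 p)\<^sup>2 \<le> (l2 x)\<^sup>2" unfolding \<mu>l[symmetric] by (simp add: mult_ac)
  then have "(norm x * l2 p)\<^sup>2 \<le> (l2 x)\<^sup>2" by (simp add: power_mult_distrib)
  then have "norm x * l2 p \<le> l2 x" using lx by (simp add: abs_le_square_iff[symmetric])
  then have "R1 * (norm x * l2 p) \<le> R1 * l2 x" using R1_pos by (intro mult_left_mono) auto
  also have "\<dots> \<le> R0 * norm x" by (rule R)
  finally have "norm x * (l2 p * R1) \<le> norm x * R0" by (simp add: mult_ac)
  then have "l2 p * R1 \<le> R0" using nx by (simp add: mult_le_cancel_left)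
  then show False using R0_less p(2) by simp
qed

lemma path_component_lift: "x \<in> S \<Longrightarrow> path_component S x (lift 1 x)"
proof -
  assume x: "x \<in> S"
  have "continuous_on {0..1} (\<lambda>s. lift s x)"
    unfolding lift_def using norm_add_T_pos[OF x] by (intro continuous_intros) (auto simp: less_le)
  then show ?thesis
    unfolding path_component_def path_def path_image_def pathstart_def pathfinish_def
    using lift_S[OF x] lift_0[OF x] by (intro exI[of _ "\<lambda>s. lift s x"]) auto
qed

text \<open>The shell is not convex, so the segment is drawn between the lifted points: there
  \<open>l2\<close> exceeds R0 by a margin, and a short segment stays within it by
  \<open>l2_lipschitz\<close>.\<close>

lemma locally_path_joined:
  assumes u: "u \<in> S"
  obtains d where "0 < d" "\<And>v. v \<in> S \<Longrightarrow> dist v u < d \<Longrightarrow> path_component S u v"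
proof -
  have "continuous_on S (lift 1)"
    unfolding lift_def using norm_add_T_pos[of _ 1]
    by (intro continuous_intros continuous_on_T) (auto simp: less_le)
  moreover have "0 < l2 (lift 1 u) - R0" using lift_1_interior[OF u] by simp
  ultimately obtain d where d: "0 < d" "\<And>v. v \<in> S \<Longrightarrow> dist v u < d \<Longrightarrow> dist (lift 1 v) (lift 1 u) < l2 (lift 1 u) - R0"
    using u unfolding continuous_on_iff by meson
  have "path_component S u v" if v: "v \<in> S" "dist v u < d" for v
  proof -
    let ?a = "lift 1 u" and ?b = "lift 1 v"
    have ab: "?a \<in> S" "?b \<in> S" using lift_S u v by auto
    have "closed_segment ?a ?b \<subseteq> S"
    proof
      fix y assume "y \<in> closed_segment ?a ?b"
      then obtain t where t: "0 \<le> t" "t \<le> 1" "y = (1 - t) *\<^sub>R ?a + t *\<^sub>R ?b"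
        unfolding closed_segment_def by auto
      have "y \<in> Kcone" unfolding t(3) using t ab by (intro cone_add cone_scale SD(1)) auto
      moreover have "norm y \<le> R1"
      proof -
        have "norm y \<le> (1 - t) * norm ?a + t * norm ?b"
          unfolding t(3) using norm_triangle_ineq[of "(1 - t) *\<^sub>R ?a" "t *\<^sub>R ?b"] t by simp
        also have "\<dots> \<le> (1 - t) * R1 + t * R1" using t ab by (intro add_mono mult_left_mono SD(3)) auto
        finally show ?thesis by (simp add: algebra_simps)
      qed
      moreover have "R0 \<le> l2 y"
      proof -
        have "y - ?a = t *\<^sub>R (?b - ?a)" unfolding t(3) by (simp add: algebra_simps)
        then have "norm (y - ?a) \<le> norm (?b - ?a)" using t by (simp add: mult_left_le_one_le)
        then have "norm (y - ?a) < l2 ?a - R0" using d(2)[OF v] by (simp add: dist_norm)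
        then show ?thesis using l2_lipschitz[of y ?a] by linarith
      qed
      ultimately show "y \<in> S" by (simp add: S_def)
    qed
    then have "path_component S ?a ?b"
      unfolding path_component_def by (intro exI[of _ "linepath ?a ?b"]) (auto simp: path_image_linepath)
    then show ?thesis
      using path_component_lift[OF u] path_component_lift[OF v(1)] by (meson path_component_sym path_component_trans)
  qed
  then show ?thesis using that d(1) by blast
qed

text \<open>By local joinability, being reachable from \<open>a\<close> is locally constant on
  \<open>A\<close>; connectedness makes it constant.\<close>

lemma connected_imp_path_component:
  assumes "connected A" "A \<subseteq> S" "a \<in> A" "b \<in> A"
  shows "path_component S a b"
proof (rule connected_induction_simple[OF assms(1,3,4)])
  show "path_component S a a" using assms by (auto intro: path_component_refl)
  fix x assume x: "x \<in> A"
  then obtain d where d: "0 < d" "\<And>v. v \<in> S \<Longrightarrow> dist v x < d \<Longrightarrow> path_component S x v"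
    using locally_path_joined[of x] assms(2) by (metis subsetD)
  show "\<exists>T. openin (top_of_set A) T \<and> x \<in> T \<and> (\<forall>y\<in>T. \<forall>z\<in>T. path_component S a y \<longrightarrow> path_component S a z)"
  proof (intro exI conjI ballI impI)
    show "openin (top_of_set A) (A \<inter> ball x d)" by (rule openin_open_Int) simp
    show "x \<in> A \<inter> ball x d" using x d(1) by simp
    fix y z assume yz: "y \<in> A \<inter> ball x d" "z \<in> A \<inter> ball x d" and ay: "path_component S a y"
    have "path_component S x y" "path_component S x z"
      using yz assms(2) by (auto intro!: d(2) simp: dist_commute)
    then show "path_component S a z"
      using ay path_component_sym path_component_trans by blast
  qed
qed

lemma shell_iff: "shell R0 R1 = ap ` S"
proof (rule set_eqI)
  fix v
  have *: "v = ap (mk v)" if "v \<in> X" using mk_inverse[OF that] by simp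
  have "v \<in> X" if "v \<in> shell R0 R1" using that by (simp add: shell_def K_def)
  then show "v \<in> shell R0 R1 \<longleftrightarrow> v \<in> ap ` S"
    unfolding S_def Kcone_def shell_def image_iff by (smt (verit) * X_norm_ap mem_Collect_eq)
qed

end

section \<open>The topology of X\<close>

lemma has_weak_deriv_minus: "has_weak_deriv u g \<Longrightarrow> has_weak_deriv (\<lambda>t. - u t) (\<lambda>t. - g t)"
  unfolding has_weak_deriv_def by simp

lemma L2_minus: "g \<in> L2 \<Longrightarrow> (\<lambda>t. - g t) \<in> L2"
  using L2_lin[of g g "-1" 0] by simp

text \<open>\<^const>\<open>Metric_space\<close> asks for a symmetric distance on the whole type, hence the case of functions
  without weak derivatives.\<close>

lemma weak_deriv_minus:
  "(\<forall>g. \<not> (g \<in> L2 \<and> has_weak_deriv u g)) \<and> weak_deriv (\<lambda>t. - u t) = weak_deriv u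
   \<or> weak_deriv u \<in> L2 \<and> weak_deriv (\<lambda>t. - u t) \<in> L2 \<and> (AE t in leb01. weak_deriv (\<lambda>t. - u t) t = - weak_deriv u t)"
proof (cases "\<exists>g. g \<in> L2 \<and> has_weak_deriv u g")
  case True
  then obtain g where g: "g \<in> L2" "has_weak_deriv u g" by blast
  note a = weak_derivI[OF g] and b = weak_derivI[OF L2_minus[OF g(1)] has_weak_deriv_minus[OF g(2)]]
  have "AE t in leb01. weak_deriv (\<lambda>t. - u t) t = - weak_deriv u t"
    using a(3) b(3) by eventually_elim simp
  then show ?thesis using a b by blast
next
  case False
  have "\<not> (g \<in> L2 \<and> has_weak_deriv (\<lambda>t. - u t) g)" for g
    using False L2_minus[of g] has_weak_deriv_minus[of "\<lambda>t. - u t" g] by auto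
  then have "(\<lambda>g. g \<in> L2 \<and> has_weak_deriv (\<lambda>t. - u t) g) = (\<lambda>g. g \<in> L2 \<and> has_weak_deriv u g)"
    using False by blast
  then have "weak_deriv (\<lambda>t. - u t) = weak_deriv u" unfolding weak_deriv_def by simp
  then show ?thesis using False by blast
qed

text \<open>The equality is literal: both functions have the same candidates for a weak derivative,
  so the choice operator returns the same one.\<close>

lemma weak_deriv_cong_AE:
  assumes "AE t in leb01. u t = v t" "u \<in> L2" "v \<in> L2"
  shows "weak_deriv u = weak_deriv v"
proof -
  have "AE t in leb01. v t = u t" using assms(1) by eventually_elim simp
  then have "has_weak_deriv u g \<longleftrightarrow> has_weak_deriv v g" for g using has_weak_deriv_cong_AE assms by blast
  then show ?thesis unfolding weak_deriv_def by simp
qed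

lemma X_norm_minus: "X_norm (\<lambda>t. - u t) = X_norm u"
proof -
  have L: "L2_norm (weak_deriv (\<lambda>t. - g t)) = L2_norm (weak_deriv g)" for g
    using weak_deriv_minus[of g]
  proof
    assume a: "weak_deriv g \<in> L2 \<and> weak_deriv (\<lambda>t. - g t) \<in> L2
      \<and> (AE t in leb01. weak_deriv (\<lambda>t. - g t) t = - weak_deriv g t)"
    then have "L2_norm (weak_deriv (\<lambda>t. - g t)) = L2_norm (\<lambda>t. - weak_deriv g t)"
      by (intro L2_norm_cong_AE L2_minus) auto
    then show ?thesis by (simp add: L2_norm_def)
  qed simp
  show ?thesis using weak_deriv_minus[of u]
  proof
    assume a: "weak_deriv u \<in> L2 \<and> weak_deriv (\<lambda>t. - u t) \<in> L2
      \<and> (AE t in leb01. weak_deriv (\<lambda>t. - u t) t = - weak_deriv u t)"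
    then have "weak_deriv (weak_deriv (\<lambda>t. - u t)) = weak_deriv (\<lambda>t. - weak_deriv u t)"
      by (intro weak_deriv_cong_AE L2_minus) auto
    then show ?thesis using L[of "weak_deriv u"] by (simp add: X_norm_eq_L2_norm d2_def)
  qed (simp add: X_norm_eq_L2_norm d2_def)
qed

lemma X_dist: "u \<in> X \<Longrightarrow> v \<in> X \<Longrightarrow> X_norm (\<lambda>t. u t - v t) = dist (mk u) (mk v)"
proof -
  assume "u \<in> X" "v \<in> X"
  then have "(\<lambda>t. u t - v t) = ap (mk u - mk v)" by (auto simp: mk_inverse)
  then show ?thesis by (simp add: X_norm_ap dist_norm)
qed

interpretation X_metric: Metric_space X "\<lambda>u v. X_norm (\<lambda>t. u t - v t)"
proof
  fix u v w :: "real \<Rightarrow> real"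
  show "0 \<le> X_norm (\<lambda>t. u t - v t)" by (simp add: X_norm_def)
  show "X_norm (\<lambda>t. u t - v t) = X_norm (\<lambda>t. v t - u t)"
    using X_norm_minus[of "\<lambda>t. u t - v t"] by simp
  assume u: "u \<in> X" and v: "v \<in> X"
  show "X_norm (\<lambda>t. u t - v t) = 0 \<longleftrightarrow> u = v"
    unfolding X_dist[OF u v] using u v mk_inject by simp
  assume w: "w \<in> X"
  show "X_norm (\<lambda>t. u t - w t) \<le> X_norm (\<lambda>t. u t - v t) + X_norm (\<lambda>t. v t - w t)"
    unfolding X_dist[OF u v] X_dist[OF u w] X_dist[OF v w] by (rule dist_triangle)
qed

lemma topspace_X_topology: "topspace X_topology = X"
  unfolding X_topology_def by simp

lemma continuous_map_mk: "continuous_map X_topology euclidean mk"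
  unfolding continuous_map_def topspace_X_topology
proof (intro conjI allI impI)
  fix V :: "xs set" assume "openin euclidean V"
  then have V: "open V" by simp
  show "openin X_topology {u \<in> X. mk u \<in> V}"
    unfolding X_topology_def X_metric.openin_mtopology
  proof (intro conjI allI impI)
    fix u assume u: "u \<in> {u \<in> X. mk u \<in> V}"
    then have "mk u \<in> V" by simp
    then obtain e where e: "0 < e" "ball (mk u) e \<subseteq> V" by (rule openE[OF V])
    have "mk v \<in> V" if "v \<in> X_metric.mball u e" for v
      using that e(2) X_dist[of u v] by (auto simp: subset_iff)
    then have "X_metric.mball u e \<subseteq> {u \<in> X. mk u \<in> V}" by auto
    then show "\<exists>r>0. X_metric.mball u r \<subseteq> {u \<in> X. mk u \<in> V}" using e(1) by blast
  qed auto
qed auto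

lemma continuous_map_ap: "continuous_map euclidean X_topology ap"
  unfolding continuous_map_def topspace_X_topology
proof (intro conjI allI impI)
  show "ap \<in> topspace euclidean \<rightarrow> X" by (auto intro: ap_X)
  fix V assume V: "openin X_topology V"
  have "open {x. ap x \<in> V}"
    unfolding open_contains_ball
  proof
    fix x assume "x \<in> {x. ap x \<in> V}"
    then obtain r where r: "0 < r" "X_metric.mball (ap x) r \<subseteq> V"
      using V unfolding X_topology_def X_metric.openin_mtopology by auto
    have "ball x r \<subseteq> {x. ap x \<in> V}"
      using r(2) X_dist[OF ap_X ap_X] ap_X by (auto simp: ap_inverse subset_iff)
    then show "\<exists>e>0. ball x e \<subseteq> {x. ap x \<in> V}" using r(1) by blast
  qed
  then show "openin euclidean {x \<in> topspace euclidean. ap x \<in> V}" by simp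
qed

section \<open>The minimax level, the minimum, and the two solutions\<close>

theorem theorem3p6:
  fixes f :: "real \<Rightarrow> real \<Rightarrow> real"
    and c_inf R0 R1 r :: real
    and u0 u1 :: "real \<Rightarrow> real"
  assumes f_cont: "continuous_on ({0..1} \<times> UNIV) (\<lambda>(t, x). f t x)"
    and f_nonneg: "\<forall>t\<in>{0..1}. \<forall>x\<ge>0. f t x \<ge> 0"
    and c_inf_pos: "c_inf > 0"
    and c_inf_bound: "\<forall>v\<in>K. max_norm v \<le> c_inf * X_norm v"
    and R0_pos: "0 < R0"
    and R0_less: "R0 < L2_norm phi * R1"
    and lower: "R0 \<le> L2_norm (J (f_lower f c_inf R0 R1))"
    and upper: "R1 \<ge> c_inf * L1_norm (f_upper f c_inf R0 R1)"
    and component: "connected_component_of (subtopology X_topology (shell R0 R1)) u0 u1"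
    and r_pos: "r > 0"
    and u0_r: "X_norm u0 < r"
    and r_u1: "r < X_norm u1"
    and mp_geometry: "max (E f u0) (E f u1) < (INF u\<in>{u \<in> shell R0 R1. X_norm u = r}. E f u)"
    and corner: "\<exists>\<rho>>0. \<forall>u\<in>shell R0 R1. L2_norm u = R0 \<and> X_norm u = R1 \<longrightarrow>
                   E f u \<ge> mp_level f R0 R1 u0 u1 + \<rho>"
  shows "\<exists>u_m\<in>shell R0 R1. \<exists>u_c\<in>shell R0 R1. u_m \<noteq> u_c \<and>
           positive_solution f u_m \<and> positive_solution f u_c \<and>
           E f u_m = (INF u\<in>shell R0 R1. E f u) \<and>
           E f u_c = mp_level f R0 R1 u0 u1"
proof -
  interpret shell_problem f c_inf R0 R1 by standard (fact assms)+
  define c where "c = mp_level f R0 R1 u0 u1"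
  define m where "m = (INF u\<in>shell R0 R1. E f u)"
  define \<Gamma> :: "(real \<Rightarrow> xs) set" where "\<Gamma> = {g. continuous_on {0..1} g \<and> (\<forall>t\<in>{0..1}. g t \<in> S) \<and> g 0 = mk u0 \<and> g 1 = mk u1}"
  have shell_X: "shell R0 R1 \<subseteq> X" by (auto simp: shell_def K_def)
  have mkS: "mk u \<in> S" "ap (mk u) = u" if "u \<in> shell R0 R1" for u
    using that shell_X unfolding shell_iff by (auto simp: ap_inverse)
  obtain B where B: "\<And>x. x \<in> S \<Longrightarrow> \<bar>En x\<bar> \<le> B" using En_bounded S_subset by (meson subsetD)
  obtain A where A: "connectedin (subtopology X_topology (shell R0 R1)) A" "u0 \<in> A" "u1 \<in> A"
    using component unfolding connected_component_of_def by blast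
  have A': "connectedin X_topology A" "A \<subseteq> shell R0 R1" using A(1) by (auto simp: connectedin_subtopology)
  have u01: "u0 \<in> shell R0 R1" "u1 \<in> shell R0 R1" using A A' by auto
  have E01: "E f u0 = En (mk u0)" "E f u1 = En (mk u1)" using mkS[OF u01(1)] mkS[OF u01(2)] by (simp_all add: En_def)
  \<comment> \<open>Without a path the infimum in the minimax level would be taken over the empty
    set.\<close>
  have "\<exists>g. g \<in> \<Gamma>"
  proof -
    have "connectedin euclidean (mk ` A)" by (rule connectedin_continuous_map_image[OF continuous_map_mk A'(1)])
    then have "path_component S (mk u0) (mk u1)"
      using A A'(2) mkS(1) by (intro connected_imp_path_component[of "mk ` A"]) auto
    then have "\<exists>g. path g \<and> path_image g \<subseteq> S \<and> pathstart g = mk u0 \<and> pathfinish g = mk u1"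
      by (simp only: path_component_def)
    then obtain g where "path g" "path_image g \<subseteq> S" "pathstart g = mk u0" "pathfinish g = mk u1" by metis
    then have "continuous_on {0..1} g" "\<forall>t\<in>{0..1}. g t \<in> S" "g 0 = mk u0" "g 1 = mk u1"
      by (auto simp: path_def path_image_def pathstart_def pathfinish_def)
    then have "g \<in> \<Gamma>" unfolding \<Gamma>_def by blast
    then show ?thesis by blast
  qed
  have paths: "paths R0 R1 u0 u1 = {\<gamma>. mk \<circ> \<gamma> \<in> \<Gamma> \<and> (\<forall>t\<in>{0..1}. \<gamma> t \<in> shell R0 R1) \<and> \<gamma> 0 = u0 \<and> \<gamma> 1 = u1}"
  proof (rule set_eqI, rule iffI)
    fix \<gamma> assume "\<gamma> \<in> paths R0 R1 u0 u1"
    then have g: "continuous_map (top_of_set {0..1}) X_topology \<gamma>" "(\<forall>t\<in>{0..1}. \<gamma> t \<in> shell R0 R1)" "\<gamma> 0 = u0" "\<gamma> 1 = u1"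
      by (auto simp: paths_def pathin_def continuous_map_in_subtopology Pi_iff)
    have "continuous_on {0..1} (mk \<circ> \<gamma>)"
      using continuous_map_compose[OF g(1) continuous_map_mk] by simp
    moreover have "\<forall>t\<in>{0..1}. (mk \<circ> \<gamma>) t \<in> S" using g(2) mkS(1) by auto
    ultimately show "\<gamma> \<in> {\<gamma>. mk \<circ> \<gamma> \<in> \<Gamma> \<and> (\<forall>t\<in>{0..1}. \<gamma> t \<in> shell R0 R1) \<and> \<gamma> 0 = u0 \<and> \<gamma> 1 = u1}"
      using g by (simp add: \<Gamma>_def)
  next
    fix \<gamma> assume "\<gamma> \<in> {\<gamma>. mk \<circ> \<gamma> \<in> \<Gamma> \<and> (\<forall>t\<in>{0..1}. \<gamma> t \<in> shell R0 R1) \<and> \<gamma> 0 = u0 \<and> \<gamma> 1 = u1}"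
    then have g: "continuous_on {0..1} (mk \<circ> \<gamma>)" "(\<forall>t\<in>{0..1}. \<gamma> t \<in> shell R0 R1)" "\<gamma> 0 = u0" "\<gamma> 1 = u1"
      by (auto simp: \<Gamma>_def)
    have "continuous_map (top_of_set {0..1}) X_topology (ap \<circ> (mk \<circ> \<gamma>))"
      using g(1) by (intro continuous_map_compose[OF _ continuous_map_ap]) simp
    then have "continuous_map (top_of_set {0..1}) X_topology \<gamma>"
      by (rule continuous_map_eq) (use g(2) in \<open>auto intro!: mkS(2)\<close>)
    then show "\<gamma> \<in> paths R0 R1 u0 u1"
      using g by (simp add: paths_def pathin_def continuous_map_in_subtopology Pi_iff)
  qed
  define top where "top g = (SUP t\<in>{0..1}. En (g t))" for g :: "real \<Rightarrow> xs"
  have top_upper: "En (g t) \<le> top g" if "g \<in> \<Gamma>" "t \<in> {0..1}" for g t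
    unfolding top_def
  proof (rule cSUP_upper[OF that(2)])
    have "En (g s) \<le> B" if "s \<in> {0..1}" for s using B[of "g s"] \<open>g \<in> \<Gamma>\<close> that by (auto simp: \<Gamma>_def abs_le_iff)
    then show "bdd_above ((\<lambda>t. En (g t)) ` {0..1})" by (rule bdd_aboveI2)
  qed
  have c_eq: "c = (INF g\<in>\<Gamma>. top g)"
  proof -
    have "(\<lambda>\<gamma>. SUP t\<in>{0..1}. E f (\<gamma> t)) ` paths R0 R1 u0 u1 = top ` \<Gamma>"
    proof (rule set_eqI, rule iffI)
      fix y assume "y \<in> (\<lambda>\<gamma>. SUP t\<in>{0..1}. E f (\<gamma> t)) ` paths R0 R1 u0 u1"
      then obtain \<gamma> where g: "mk \<circ> \<gamma> \<in> \<Gamma>" "(\<forall>t\<in>{0..1}. \<gamma> t \<in> shell R0 R1)" "y = (SUP t\<in>{0..1}. E f (\<gamma> t))"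
        unfolding paths by auto
      have "E f (\<gamma> t) = En ((mk \<circ> \<gamma>) t)" if "t \<in> {0..1}" for t
        using g(2) that mkS(2)[of "\<gamma> t"] by (auto simp: En_def)
      then have "y = top (mk \<circ> \<gamma>)" unfolding g(3) top_def by (rule SUP_cong[OF refl])
      then show "y \<in> top ` \<Gamma>" using g(1) by blast
    next
      fix y assume "y \<in> top ` \<Gamma>"
      then obtain g where g: "g \<in> \<Gamma>" "y = top g" by blast
      have "mk \<circ> (ap \<circ> g) = g" by (auto simp: ap_inverse)
      moreover have "\<forall>t\<in>{0..1}. (ap \<circ> g) t \<in> shell R0 R1" using g(1) unfolding shell_iff \<Gamma>_def by auto
      moreover have "(ap \<circ> g) 0 = u0" "(ap \<circ> g) 1 = u1" using g(1) mkS(2) u01 by (auto simp: \<Gamma>_def)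
      ultimately have "ap \<circ> g \<in> paths R0 R1 u0 u1" unfolding paths using g(1) by simp
      moreover have "y = (SUP t\<in>{0..1}. E f ((ap \<circ> g) t))" unfolding g(2) top_def En_def by simp
      ultimately show "y \<in> (\<lambda>\<gamma>. SUP t\<in>{0..1}. E f (\<gamma> t)) ` paths R0 R1 u0 u1" by blast
    qed
    then show ?thesis unfolding c_def mp_level_def by simp
  qed
  define b where "b = (INF u\<in>{u \<in> shell R0 R1. X_norm u = r}. E f u)"
  \<comment> \<open>Along each path the norm passes from below \<open>r\<close> to above
    \<open>r\<close>, so the path meets the sphere on which \<open>b\<close> is the infimum.\<close>
  have b_le: "b \<le> top g" if g: "g \<in> \<Gamma>" for g
  proof -
    have "continuous_on {0..1} (\<lambda>t. norm (g t))" using g by (auto simp: \<Gamma>_def intro: continuous_intros)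
    moreover have "norm (g 0) \<le> r" "r \<le> norm (g 1)"
      using g u0_r r_u1 X_norm_ap[of "mk u0"] X_norm_ap[of "mk u1"] mkS(2)[OF u01(1)] mkS(2)[OF u01(2)] by (auto simp: \<Gamma>_def)
    ultimately obtain t where t: "0 \<le> t" "t \<le> 1" "norm (g t) = r" using IVT'[of "\<lambda>t. norm (g t)" 0 r 1] by auto
    have gS: "g t \<in> S" using g t by (auto simp: \<Gamma>_def)
    have "b \<le> E f (ap (g t))" unfolding b_def
    proof (rule cINF_lower)
      have "- B \<le> E f u" if "u \<in> shell R0 R1" for u
        using B[OF mkS(1)[OF that]] mkS(2)[OF that] by (simp add: En_def abs_le_iff)
      then show "bdd_below (E f ` {u \<in> shell R0 R1. X_norm u = r})" by (intro bdd_belowI2[of _ "- B"]) auto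
      show "ap (g t) \<in> {u \<in> shell R0 R1. X_norm u = r}" using gS t(3) by (simp add: shell_iff X_norm_ap)
    qed
    also have "\<dots> \<le> top g" using top_upper[OF g, of t] t by (simp add: En_def)
    finally show ?thesis .
  qed
  have bdd_top: "bdd_below (top ` \<Gamma>)" using b_le by (rule bdd_belowI2)
  have "b \<le> c" unfolding c_eq using b_le \<open>\<exists>g. g \<in> \<Gamma>\<close> by (intro cINF_greatest) auto
  then have c_gt: "max (E f u0) (E f u1) < c" using mp_geometry unfolding b_def by linarith
  have bdd_shell: "bdd_below (E f ` shell R0 R1)"
  proof (rule bdd_belowI2)
    show "- B \<le> E f u" if "u \<in> shell R0 R1" for u
      using B[OF mkS(1)[OF that]] mkS(2)[OF that] by (simp add: En_def abs_le_iff)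
  qed
  have m_le: "m \<le> En x" if "x \<in> S" for x
    unfolding m_def En_def using that by (intro cINF_lower bdd_shell) (simp add: shell_iff)
  have m_lt: "m < c" using m_le[OF mkS(1)[OF u01(1)]] E01 c_gt by simp
  obtain \<rho> where \<rho>: "0 < \<rho>" "\<And>x. x \<in> S \<Longrightarrow> l2 x = R0 \<Longrightarrow> norm x = R1 \<Longrightarrow> c + \<rho> \<le> En x"
    using corner unfolding shell_iff c_def En_def by (auto simp: X_norm_ap)
  obtain \<delta> where \<delta>: "0 < \<delta>" "\<And>x. x \<in> S \<Longrightarrow> R1 - \<delta> \<le> norm x \<Longrightarrow> (l2 x)\<^sup>2 \<le> R0\<^sup>2 + \<delta> \<Longrightarrow> c + \<rho> / 2 \<le> En x"
    using near_corner[OF \<rho>(2,1)] by blast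
  \<comment> \<open>Taking \<rho> / 4 instead of \<rho> / 2 leaves the strict margin that the
    deformation asks for near the corner.\<close>
  define d where "d = min \<delta> (\<rho> / 4)"
  have d: "0 < d" "d \<le> \<delta>" "d \<le> \<rho> / 4" using \<delta>(1) \<rho>(1) by (auto simp: d_def)
  \<comment> \<open>Stated for every level up to \<open>c\<close>, so that one corner neighbourhood
    serves both the minimax level and the minimum.\<close>
  have near: "l + d < En x" if "l \<le> c" "x \<in> S" "R1 - d \<le> norm x" "(l2 x)\<^sup>2 \<le> R0\<^sup>2 + d" for l x
    using \<delta>(2)[OF that(2)] that d \<rho>(1) by linarith
  have "\<exists>x\<in>S. Nf x = x \<and> En x = c"
  proof (rule ccontr)
    assume "\<not> ?thesis"
    then have "\<And>u. u \<in> S \<Longrightarrow> Nf u = u \<Longrightarrow> En u \<noteq> c" by blast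
    then obtain \<epsilon> \<eta> where \<eta>: "0 < \<epsilon>" "continuous_on S \<eta>"
      "\<And>x. x \<in> S \<Longrightarrow> En x \<le> c + \<epsilon> \<Longrightarrow> \<eta> x \<in> S \<and> En (\<eta> x) \<le> c - \<epsilon>"
      "\<And>x. En x \<le> max (E f u0) (E f u1) \<Longrightarrow> \<eta> x = x"
      using deformation[OF _ d(1) near[OF order_refl] c_gt] by blast
    have "(INF g\<in>\<Gamma>. top g) < c + \<epsilon>" using c_eq \<eta>(1) by simp
    then obtain g where g: "g \<in> \<Gamma>" "top g < c + \<epsilon>"
      using cINF_less_iff[OF _ bdd_top] \<open>\<exists>g. g \<in> \<Gamma>\<close> by blast
    have gS: "g t \<in> S" "En (g t) \<le> c + \<epsilon>" if "t \<in> {0..1}" for t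
      using g that top_upper[OF g(1) that] by (auto simp: \<Gamma>_def)
    have "\<eta> \<circ> g \<in> \<Gamma>"
      using g(1) \<eta>(2) \<eta>(3)[OF gS] \<eta>(4)[of "mk u0"] \<eta>(4)[of "mk u1"] E01 gS(1)
      by (auto simp: \<Gamma>_def o_def intro: continuous_on_compose2)
    then have "c \<le> top (\<eta> \<circ> g)" unfolding c_eq by (rule cINF_lower[OF bdd_top])
    also have "\<dots> \<le> c - \<epsilon>" unfolding top_def using \<eta>(3)[OF gS] by (intro cSUP_least) auto
    finally show False using \<eta>(1) by simp
  qed
  then obtain xc where xc: "xc \<in> S" "Nf xc = xc" "En xc = c" by blast
  have "\<exists>x\<in>S. Nf x = x \<and> En x = m"
  proof (rule ccontr)
    assume "\<not> ?thesis"
    then have "\<And>u. u \<in> S \<Longrightarrow> Nf u = u \<Longrightarrow> En u \<noteq> m" by blast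
    \<comment> \<open>The deformation is applied to single points here, none of which has to stay
      fixed; \<open>m - 1\<close> is just some level below \<open>m\<close>.\<close>
    then obtain \<epsilon> \<eta> where \<eta>: "0 < \<epsilon>" "\<And>x. x \<in> S \<Longrightarrow> En x \<le> m + \<epsilon> \<Longrightarrow> \<eta> x \<in> S \<and> En (\<eta> x) \<le> m - \<epsilon>"
      using deformation[OF _ d(1) near[OF less_imp_le[OF m_lt]], of "m - 1"] by auto
    have "m < m + \<epsilon>" using \<eta>(1) by simp
    then obtain u where u: "u \<in> shell R0 R1" "E f u < m + \<epsilon>"
      using cINF_less_iff[OF _ bdd_shell, of "m + \<epsilon>"] u01 unfolding m_def by blast
    have "En (mk u) \<le> m + \<epsilon>" using u mkS(2)[OF u(1)] by (simp add: En_def)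
    then have "\<eta> (mk u) \<in> S \<and> En (\<eta> (mk u)) \<le> m - \<epsilon>" by (rule \<eta>(2)[OF mkS(1)[OF u(1)]])
    then show False using m_le[of "\<eta> (mk u)"] \<eta>(1) by linarith
  qed
  then obtain xm where xm: "xm \<in> S" "Nf xm = xm" "En xm = m" by blast
  have "ap xm \<noteq> ap xc" using xm(3) xc(3) m_lt by (auto simp: En_def)
  moreover have "ap xm \<in> shell R0 R1" "ap xc \<in> shell R0 R1" using xm xc by (auto simp: shell_iff)
  ultimately show ?thesis
    using fixed_point_solution[OF xm(1,2)] fixed_point_solution[OF xc(1,2)] xm(3) xc(3)
    unfolding m_def c_def En_def by blast
qed

end
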